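(* Let $\mathcal X,\mathcal Y$ be countable sets, $\lambda>0$, and let $c\colon\mathcal X\times\mathcal Y\to\mathbb R$ admit dominating functions $c_{\mathcal X}^-,c_{\mathcal X}^+,c_{\mathcal Y}^-,c_{\mathcal Y}^+$ such that $\|c_{\mathcal X}^+-c_{\mathcal X}^-\|_{\ell^\infty(\mathcal X)}<\infty$, with weights $\mathcal C_{\mathcal X},\mathcal C_{\mathcal Y},\phi_{\mathcal Y}$. Let $r\in\mathcal P(\mathcal X)$, $s\in\mathcal P(\mathcal Y)$ satisfy $\sum_x\mathcal C_{\mathcal X}(x)\sqrt{r_x}<\infty$ and $\sum_y\mathcal C_{\mathcal Y}(y)\phi_{\mathcal Y}^4(y)s_y<\infty$, and let $\hat r_n=\frac1n\sum_{i=1}^n\delta_{X_i}$ with $X_1,\dots,X_n$ i.i.d. $\sim r$. Then the Sinkhorn cost $S^\lambda$ satisfies, as $n\to\infty$, $$\sqrt n\big(S^\lambda(\hat r_n,s)-S^\lambda(r,s)\big)\xrightarrow{\ \mathcal D\ }\mathcal N\big(0,\tilde\sigma^2_{\lambda,\pi^\lambda}(r|s)\big),$$ where $$\tilde\sigma^2_{\lambda,\pi^\lambda}(r|s)=\sum_{x,x'\in\mathcal X,\ y,y'\in\mathcal Y}c(x,y)\,c(x',y')\,\big(\Sigma_{\lambda,\pi^\lambda}(r|s)\big)_{(x,y),(x',y')}.$$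
   Context: $\mathcal P(\mathcal X)$: probability measures $r=(r_x)$ on the countable set $\mathcal X$. For a positive function $f$ on a countable set $Z$: $\ell^1_f(Z)$ has norm $\sum_zf(z)|a_z|$, $\ell^\infty_f(Z)$ has norm $\sup_z|b_z|/f(z)$. $\xrightarrow{\mathcal D}$ is weak convergence. EROT: $\Pi(r,s)$ is the set of couplings of $r,s$; $M(\pi)=\sum_{x,y}\pi_{xy}\log(\pi_{xy}/(r_xs_y))$ (with $0\log0=0$). If $c$ is $r\otimes s$-integrable, the EROT plan $\pi^\lambda(r,s)$ is the unique minimizer of $\pi\mapsto\langle c,\pi\rangle+\lambda M(\pi)$ over $\Pi(r,s)$, where $\langle c,\pi\rangle=\sum_{x,y}c(x,y)\pi_{xy}$. The Sinkhorn cost is $S^\lambda(r,s)=\langle c,\pi^\lambda(r,s)\rangle$. Dominating functions for $c$: real functions $c_{\mathcal X}^-\le c_{\mathcal X}^+$ on $\mathcal X$, $c_{\mathcal Y}^-\le c_{\mathcal Y}^+$ on $\mathcal Y$ with $c_{\mathcal X}^-(x)+c_{\mathcal Y}^-(y)\le c(x,y)\le c_{\mathcal X}^+(x)+c_{\mathcal Y}^+(y)$. Weights: $\mathcal C_{\mathcal X}=1+|c_{\mathcal X}^+|+|c_{\mathcal X}^-|$, $\mathcal C_{\mathcal Y}=1+|c_{\mathcal Y}^+|+|c_{\mathcal Y}^-|$, $\phi_{\mathcal Y}=\exp((c_{\mathcal Y}^+-c_{\mathcal Y}^-)/\lambda)$. $\Sigma_{\lambda,\pi^\lambda}(r|s)$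 is the covariance of the centered Gaussian process $D(G_r,0)$ in $\ell^1_{\mathcal C_{\mathcal X}\oplus\mathcal C_{\mathcal Y}}(\mathcal X\times\mathcal Y)$, where $G_r$ is a tight centered Gaussian process in $\ell^1_{\mathcal C_{\mathcal X}}(\mathcal X)$ with $\mathrm{Cov}((G_r)_x,(G_r)_{x'})=r_x(1-r_x)$ if $x=x'$, $-r_xr_{x'}$ otherwise, and $D$ is the following operator. Put $X'=\mathrm{supp}(r)$, $Y'=\mathrm{supp}(s)$, fix $y_1\in Y'$, $\pi=\pi^\lambda(r,s)$. Let $\mathcal A^{\mathcal X}\colon\ell^\infty_{\phi_{\mathcal Y}}(Y'\setminus\{y_1\})\to\ell^\infty(X')$, $(\mathcal A^{\mathcal X}b)_x=\sum_{y\in Y'\setminus\{y_1\}}\frac{\pi_{xy}}{r_x}b_y$; $\mathcal A^{\mathcal Y}\colon\ell^\infty(X')\to\ell^\infty_{\phi_{\mathcal Y}}(Y'\setminus\{y_1\})$, $(\mathcal A^{\mathcal Y}a)_y=\sum_{x\in X'}\frac{\pi_{xy}}{s_y}a_x$; $\mathcal B^{\mathcal Y}\colon\ell^1_{\mathcal C_{\mathcal X}}(X')\to\ell^\infty_{\phi_{\mathcal Y}}(Y'\setminus\{y_1\})$, $(\mathcal B^{\mathcal Y}h)_y=\sum_{x\in X'}\frac{\pi_{xy}}{r_xs_y}h_x$. The operators $\mathrm{Id}-\mathcal A^{\mathcal X}\mathcal A^{\mathcal Y}$ and $\mathrm{Id}-\mathcal A^{\mathcal Y}\mathcal A^{\mathcal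 X}$ have bounded inverses. With $a=-(\mathrm{Id}-\mathcal A^{\mathcal X}\mathcal A^{\mathcal Y})^{-1}\mathcal A^{\mathcal X}\mathcal B^{\mathcal Y}h$, $b=(\mathrm{Id}-\mathcal A^{\mathcal Y}\mathcal A^{\mathcal X})^{-1}\mathcal B^{\mathcal Y}h$, $b_{y_1}:=0$, one has $D(h,0)_{xy}=\frac{\pi_{xy}}{r_x}h_x-\pi_{xy}(a_x+b_y)$ for $(x,y)\in X'\times Y'$ and $0$ otherwise. *)

theory Defs
  imports "HOL-Probability.Probability"
begin

section \<open>Weighted sequence spaces\<close>

text \<open>Sequences are total functions. \<open>ell1 f\<close> is the weighted space over the whole index type;
  \<open>linfty f Z\<close> is the weighted space over the index set \<open>Z\<close>, whose members are extended by \<open>0\<close>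
  outside \<open>Z\<close>.\<close>

definition ell1 :: "('a \<Rightarrow> real) \<Rightarrow> ('a \<Rightarrow> real) set" where
  "ell1 f = {a. (\<lambda>z. f z * \<bar>a z\<bar>) summable_on UNIV}"

definition ell1_norm :: "('a \<Rightarrow> real) \<Rightarrow> ('a \<Rightarrow> real) \<Rightarrow> real" where
  "ell1_norm f a = (\<Sum>\<^sub>\<infinity>z. f z * \<bar>a z\<bar>)"

definition linfty :: "('a \<Rightarrow> real) \<Rightarrow> 'a set \<Rightarrow> ('a \<Rightarrow> real) set" where
  "linfty f Z = {b. (\<forall>z. z \<notin> Z \<longrightarrow> b z = 0) \<and> bdd_above ((\<lambda>z. \<bar>b z\<bar> / f z) ` Z)}"

definition ell1_topology :: "('a \<Rightarrow> real) \<Rightarrow> ('a \<Rightarrow> real) topology" where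
  "ell1_topology f = Metric_space.mtopology (ell1 f) (\<lambda>a b. ell1_norm f (\<lambda>z. a z - b z))"

definition ell1_borel :: "('a \<Rightarrow> real) \<Rightarrow> ('a \<Rightarrow> real) measure" where
  "ell1_borel f = sigma (ell1 f) {U. openin (ell1_topology f) U}"

lemma Metric_space_ell1:
  assumes pos: "\<And>z. f z > 0"
  shows "Metric_space (ell1 f) (\<lambda>a b. ell1_norm f (\<lambda>z. a z - b z))"
proof
  have dom: "(\<lambda>z. f z * \<bar>x z - y z\<bar>) summable_on UNIV" if "x \<in> ell1 f" "y \<in> ell1 f" for x y
  proof (rule summable_on_comparison_test)
    show "(\<lambda>z. f z * \<bar>x z\<bar> + f z * \<bar>y z\<bar>) summable_on UNIV"
      using that by (intro summable_on_add) (auto simp: ell1_def)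
    show "f z * \<bar>x z - y z\<bar> \<le> f z * \<bar>x z\<bar> + f z * \<bar>y z\<bar>" for z
      using mult_left_mono[OF abs_triangle_ineq4[of "x z" "y z"], of "f z"] pos[of z]
      by (simp add: distrib_left)
    show "0 \<le> f z * \<bar>x z - y z\<bar>" for z
      using pos[of z] by simp
  qed
  show "0 \<le> ell1_norm f (\<lambda>z. x z - y z)" for x y
    unfolding ell1_norm_def
    by (intro infsum_nonneg mult_nonneg_nonneg) (simp_all add: pos[THEN less_imp_le])
  show "ell1_norm f (\<lambda>z. x z - y z) = ell1_norm f (\<lambda>z. y z - x z)" for x y
    by (simp add: ell1_norm_def abs_minus_commute)
  show "ell1_norm f (\<lambda>z. x z - y z) = 0 \<longleftrightarrow> x = y" if "x \<in> ell1 f" "y \<in> ell1 f" for x y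
  proof
    assume "ell1_norm f (\<lambda>z. x z - y z) = 0"
    then have "f z * \<bar>x z - y z\<bar> = 0" for z
      using nonneg_infsum_le_0D[of "\<lambda>z. f z * \<bar>x z - y z\<bar>" UNIV z] dom[OF that] pos[THEN less_imp_le]
      by (simp add: ell1_norm_def)
    then show "x = y"
      using pos by (intro ext) (metis abs_eq_0 eq_iff_diff_eq_0 less_irrefl mult_eq_0_iff)
  qed (simp add: ell1_norm_def)
  show "ell1_norm f (\<lambda>z. x z - w z)
      \<le> ell1_norm f (\<lambda>z. x z - y z) + ell1_norm f (\<lambda>z. y z - w z)"
    if "x \<in> ell1 f" "y \<in> ell1 f" "w \<in> ell1 f" for x y w
  proof -
    have "f z * \<bar>x z - w z\<bar> \<le> f z * \<bar>x z - y z\<bar> + f z * \<bar>y z - w z\<bar>" for z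
      using mult_left_mono[of "\<bar>x z - w z\<bar>" "\<bar>x z - y z\<bar> + \<bar>y z - w z\<bar>" "f z"] pos[of z]
      by (simp add: distrib_left)
    then have "ell1_norm f (\<lambda>z. x z - w z)
        \<le> (\<Sum>\<^sub>\<infinity>z. f z * \<bar>x z - y z\<bar> + f z * \<bar>y z - w z\<bar>)"
      unfolding ell1_norm_def by (intro infsum_mono summable_on_add dom that)
    then show ?thesis
      using that by (simp add: ell1_norm_def infsum_add dom)
  qed
qed


section \<open>Entropy regularized optimal transport\<close>

definition couplings :: "'x pmf \<Rightarrow> 'y pmf \<Rightarrow> ('x \<times> 'y) pmf set" where
  "couplings r s = {\<pi>. map_pmf fst \<pi> = r \<and> map_pmf snd \<pi> = s}"

text \<open>The negative parts of the summands of \<open>M\<close> are always summable for a coupling, so failure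
  of summability means that the sum is \<open>\<infinity>\<close> (whereas \<open>infsum\<close> alone would return \<open>0\<close>).\<close>

definition mutual_info :: "'x pmf \<Rightarrow> 'y pmf \<Rightarrow> ('x \<times> 'y) pmf \<Rightarrow> ereal" where
  "mutual_info r s \<pi> =
     (let m = (\<lambda>(x, y). pmf \<pi> (x, y) * ln (pmf \<pi> (x, y) / (pmf r x * pmf s y)))
      in if m summable_on UNIV then ereal (infsum m UNIV) else \<infinity>)"

text \<open>If \<open>c\<close> has dominating functions integrable for \<open>r\<close> and \<open>s\<close>, this sum converges absolutely
  for every coupling of \<open>r\<close> and \<open>s\<close>.\<close>

definition transport_cost :: "('x \<times> 'y \<Rightarrow> real) \<Rightarrow> ('x \<times> 'y) pmf \<Rightarrow> real" where
  "transport_cost c \<pi> = (\<Sum>\<^sub>\<infinity>z. c z * pmf \<pi> z)"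

definition erot_objective ::
  "('x \<times> 'y \<Rightarrow> real) \<Rightarrow> real \<Rightarrow> 'x pmf \<Rightarrow> 'y pmf \<Rightarrow> ('x \<times> 'y) pmf \<Rightarrow> ereal" where
  "erot_objective c lam r s \<pi> = ereal (transport_cost c \<pi>) + ereal lam * mutual_info r s \<pi>"

definition erot_plan ::
  "('x \<times> 'y \<Rightarrow> real) \<Rightarrow> real \<Rightarrow> 'x pmf \<Rightarrow> 'y pmf \<Rightarrow> ('x \<times> 'y) pmf" where
  "erot_plan c lam r s =
     (THE \<pi>. is_arg_min (erot_objective c lam r s) (\<lambda>\<pi>. \<pi> \<in> couplings r s) \<pi>)"

definition sinkhorn_cost ::
  "('x \<times> 'y \<Rightarrow> real) \<Rightarrow> real \<Rightarrow> 'x pmf \<Rightarrow> 'y pmf \<Rightarrow> real" where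
  "sinkhorn_cost c lam r s = transport_cost c (erot_plan c lam r s)"

definition dominating ::
  "('x \<times> 'y \<Rightarrow> real) \<Rightarrow> ('x \<Rightarrow> real) \<Rightarrow> ('x \<Rightarrow> real) \<Rightarrow> ('y \<Rightarrow> real) \<Rightarrow> ('y \<Rightarrow> real) \<Rightarrow> bool"
where
  "dominating c cXm cXp cYm cYp \<longleftrightarrow>
     (\<forall>x. cXm x \<le> cXp x) \<and> (\<forall>y. cYm y \<le> cYp y) \<and>
     (\<forall>x y. cXm x + cYm y \<le> c (x, y) \<and> c (x, y) \<le> cXp x + cYp y)"

definition cost_weight :: "('a \<Rightarrow> real) \<Rightarrow> ('a \<Rightarrow> real) \<Rightarrow> 'a \<Rightarrow> real" where
  "cost_weight cm cp z = 1 + \<bar>cp z\<bar> + \<bar>cm z\<bar>"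

definition exp_weight :: "real \<Rightarrow> ('a \<Rightarrow> real) \<Rightarrow> ('a \<Rightarrow> real) \<Rightarrow> 'a \<Rightarrow> real" where
  "exp_weight lam cm cp z = exp ((cp z - cm z) / lam)"


section \<open>The operator \<open>D(\<cdot>, 0)\<close>\<close>

text \<open>\<open>Y1\<close> stands for the support of \<open>s\<close> without the point \<open>y1\<close>.\<close>

definition op_AX :: "('x \<times> 'y) pmf \<Rightarrow> 'x pmf \<Rightarrow> 'y set \<Rightarrow> ('y \<Rightarrow> real) \<Rightarrow> 'x \<Rightarrow> real" where
  "op_AX \<pi> r Y1 b x =
     (if x \<in> set_pmf r then \<Sum>\<^sub>\<infinity>y\<in>Y1. pmf \<pi> (x, y) / pmf r x * b y else 0)"

definition op_AY ::
  "('x \<times> 'y) pmf \<Rightarrow> 'x pmf \<Rightarrow> 'y pmf \<Rightarrow> 'y set \<Rightarrow> ('x \<Rightarrow> real) \<Rightarrow> 'y \<Rightarrow> real" where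
  "op_AY \<pi> r s Y1 a y =
     (if y \<in> Y1 then \<Sum>\<^sub>\<infinity>x\<in>set_pmf r. pmf \<pi> (x, y) / pmf s y * a x else 0)"

definition op_BY ::
  "('x \<times> 'y) pmf \<Rightarrow> 'x pmf \<Rightarrow> 'y pmf \<Rightarrow> 'y set \<Rightarrow> ('x \<Rightarrow> real) \<Rightarrow> 'y \<Rightarrow> real" where
  "op_BY \<pi> r s Y1 h y =
     (if y \<in> Y1 then \<Sum>\<^sub>\<infinity>x\<in>set_pmf r. pmf \<pi> (x, y) / (pmf r x * pmf s y) * h x else 0)"

text \<open>The inverse of \<open>Id - T\<close> as a map on the space \<open>V\<close>.\<close>

definition inv_Id_minus ::
  "('a \<Rightarrow> real) set \<Rightarrow> (('a \<Rightarrow> real) \<Rightarrow> 'a \<Rightarrow> real) \<Rightarrow> ('a \<Rightarrow> real) \<Rightarrow> 'a \<Rightarrow> real" where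
  "inv_Id_minus V T = inv_into V (\<lambda>u z. u z - T u z)"

text \<open>The value \<open>b y1 = 0\<close> is part of the membership of \<open>b\<close> in \<open>linfty phi Y1\<close>.\<close>

definition erot_deriv ::
  "('x \<times> 'y) pmf \<Rightarrow> 'x pmf \<Rightarrow> 'y pmf \<Rightarrow> ('y \<Rightarrow> real) \<Rightarrow> 'y
    \<Rightarrow> ('x \<Rightarrow> real) \<Rightarrow> 'x \<times> 'y \<Rightarrow> real" where
  "erot_deriv \<pi> r s phi y1 h =
     (let Y1 = set_pmf s - {y1};
          AX = op_AX \<pi> r Y1;
          AY = op_AY \<pi> r s Y1;
          BY = op_BY \<pi> r s Y1;
          a = (\<lambda>x. - inv_Id_minus (linfty (\<lambda>_. 1) (set_pmf r)) (AX \<circ> AY) (AX (BY h)) x);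
          b = inv_Id_minus (linfty phi Y1) (AY \<circ> AX) (BY h)
      in (\<lambda>(x, y). if x \<in> set_pmf r \<and> y \<in> set_pmf s
            then pmf \<pi> (x, y) / pmf r x * h x - pmf \<pi> (x, y) * (a x + b y)
            else 0))"


section \<open>Gaussian laws and the limiting variance\<close>

text \<open>The normal law with mean \<open>m\<close> and variance \<open>v \<ge> 0\<close>; for \<open>v = 0\<close> it is the point mass
  at \<open>m\<close>.\<close>

definition normal_law :: "real \<Rightarrow> real \<Rightarrow> real measure" where
  "normal_law m v = distr std_normal_distribution borel (\<lambda>z. m + sqrt v * z)"

definition covar :: "'w measure \<Rightarrow> ('w \<Rightarrow> real) \<Rightarrow> ('w \<Rightarrow> real) \<Rightarrow> real" where
  "covar M U V = (\<integral>w. (U w - (\<integral>v. U v \<partial>M)) * (V w - (\<integral>v. V v \<partial>M)) \<partial>M)"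

text \<open>A random element of \<open>ell1 f\<close> is represented by its law, a Borel measure on \<open>ell1 f\<close>; the
  process is then given by the coordinate maps.\<close>

definition tight_centered_gaussian :: "('a \<Rightarrow> real) \<Rightarrow> ('a \<Rightarrow> real) measure \<Rightarrow> bool" where
  "tight_centered_gaussian f P \<longleftrightarrow>
     prob_space P \<and> sets P = sets (ell1_borel f) \<and>
     (\<forall>e>0. \<exists>K. compactin (ell1_topology f) K \<and> K \<in> sets P \<and> measure P K \<ge> 1 - e) \<and>
     (\<forall>F t. finite F \<longrightarrow>
        (\<exists>v\<ge>0. distr P borel (\<lambda>g. \<Sum>x\<in>F. t x * g x) = normal_law 0 v))"

definition multinomial_cov :: "'x pmf \<Rightarrow> 'x \<Rightarrow> 'x \<Rightarrow> real" where
  "multinomial_cov r x x' =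
     (if x = x' then pmf r x * (1 - pmf r x) else - (pmf r x * pmf r x'))"

text \<open>A centered Gaussian law is determined by its covariances, so the choice is immaterial.\<close>

definition law_G :: "('x \<Rightarrow> real) \<Rightarrow> 'x pmf \<Rightarrow> ('x \<Rightarrow> real) measure" where
  "law_G f r = (SOME P. tight_centered_gaussian f P \<and>
     (\<forall>x x'. covar P (\<lambda>g. g x) (\<lambda>g. g x') = multinomial_cov r x x'))"

definition plan_cov ::
  "('x \<Rightarrow> real) \<Rightarrow> ('y \<Rightarrow> real) \<Rightarrow> ('x \<times> 'y) pmf \<Rightarrow> 'x pmf \<Rightarrow> 'y pmf \<Rightarrow> 'y
    \<Rightarrow> 'x \<times> 'y \<Rightarrow> 'x \<times> 'y \<Rightarrow> real" where
  "plan_cov wX phi \<pi> r s y1 z z' =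
     covar (law_G wX r) (\<lambda>g. erot_deriv \<pi> r s phi y1 g z) (\<lambda>g. erot_deriv \<pi> r s phi y1 g z')"

definition sinkhorn_var ::
  "('x \<times> 'y \<Rightarrow> real) \<Rightarrow> ('x \<Rightarrow> real) \<Rightarrow> ('y \<Rightarrow> real) \<Rightarrow> ('x \<times> 'y) pmf
    \<Rightarrow> 'x pmf \<Rightarrow> 'y pmf \<Rightarrow> 'y \<Rightarrow> real" where
  "sinkhorn_var c wX phi \<pi> r s y1 =
     (\<Sum>\<^sub>\<infinity>(z, z'). c z * c z' * plan_cov wX phi \<pi> r s y1 z z')"

text \<open>The empirical measure of \<open>X 0, \<dots>, X (n - 1)\<close>, meaningful for \<open>n \<ge> 1\<close>.\<close>

definition empirical :: "nat \<Rightarrow> (nat \<Rightarrow> 'x) \<Rightarrow> 'x pmf" where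
  "empirical n X = map_pmf X (pmf_of_set {..<n})"

end

theory Submission
  imports Defs
begin

text \<open>The plan has the form \<open>r x * s y * u x * k x y * w y\<close> with \<open>k = exp (- (c - cXm - cYm) / lam)\<close>.
  If \<open>w y1 = 1\<close>, then \<open>u\<close> is bounded above and below and \<open>w\<close> is bounded by a multiple of
  \<open>phi\<close>, uniformly in \<open>r\<close>. Dropping the point \<open>y1\<close> makes the linearised Sinkhorn operator a strict
  contraction in the supremum norm; this gives the inverses in the derivative and, applied to the exact
  equations for the ratios of two scalings, a Taylor expansion of the Sinkhorn cost whose remainder is
  quadratic in \<open>r' - r\<close> with respect to the weighted \<open>\<ell>\<^sup>1\<close> norm. For the empirical measure this norm is
  of order \<open>1 / sqrt n\<close> in mean, so the remainder vanishes after multiplication by \<open>sqrt n\<close>. The linear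
  part is the centred empirical mean of a function \<open>v\<close>, to which the classical central limit theorem
  applies, and its variance is identified with the quadratic form in the covariances of \<open>D(G, 0)\<close> by
  interchanging sums and expectations.\<close>

section \<open>Sums over pmfs\<close>

text \<open>Scalings are required to satisfy their equations at every point of both index types, not
  only on the supports, so the scalings of \<open>r\<close> and of a perturbed marginal can be
  compared pointwise. Without the normalisation at \<open>y1\<close> there is no contraction:
  multiplying \<open>u\<close> by a constant and dividing \<open>w\<close> by it changes nothing, so
  the full linearised operator fixes the constants. Boundedness of \<open>cXp - cXm\<close> makes
  the lower bound \<open>1 / psi y\<close> of the kernel independent of \<open>x\<close>; hence
  \<open>u\<close> is bounded, while \<open>w\<close> may grow like \<open>psi\<close>. The powers
  of \<open>psi\<close> record this asymmetry: the ratio of two \<open>w\<close> differs from 1 by a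
  multiple of \<open>psi\<close>, its quadratic error costs \<open>psi ^ 2\<close>, and the density
  contributes one more factor, which gives the \<open>psi ^ 3\<close> that is summed against the
  cost weight. The empirical norm is controlled in first mean, whereas the remainder is quadratic in
  it. Inside characteristic functions the inequality \<open>min 2 z \<le> sqrt (2 * z)\<close>
  brings the remainder down to first order, so that the first mean suffices.\<close>

lemma summable_on_iff_integrable_count_space:
  fixes f :: "'a \<Rightarrow> real"
  shows "f summable_on A \<longleftrightarrow> integrable (count_space A) f"
  using summable_on_iff_abs_summable_on_real[of f A] abs_summable_equivalent[of f A]
  unfolding abs_summable_on_def by blast

text \<open>Both sides default to \<open>0\<close> when the sum diverges, so the identity is
  unconditional. It is the bridge by which Fubini and measurability of parametrised integrals apply
  to \<open>infsum\<close>.\<close>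

lemma infsum_eq_integral_count_space:
  fixes f :: "'a \<Rightarrow> real"
  shows "infsum f A = (\<integral>x. f x \<partial>count_space A)"
proof (cases "f summable_on A")
  case True
  then have "Infinite_Set_Sum.abs_summable_on f A"
    unfolding summable_on_iff_integrable_count_space abs_summable_on_def .
  from infsetsum_infsum[OF this] show ?thesis
    unfolding infsetsum_def by (rule sym)
next
  case False
  then show ?thesis
    using not_integrable_integral_eq[of "count_space A" f] infsum_not_exists[OF False]
    unfolding summable_on_iff_integrable_count_space by metis
qed

lemma summable_on_real_bound:
  fixes f :: "'a \<Rightarrow> real"
  assumes "g summable_on A" "\<And>x. x \<in> A \<Longrightarrow> \<bar>f x\<bar> \<le> g x"
  shows "f summable_on A"
proof -
  have "(\<lambda>x. norm (f x)) summable_on A"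
    by (rule summable_on_comparison_test[OF assms(1)]) (use assms(2) in auto)
  then show ?thesis by (rule abs_summable_summable)
qed

lemma summable_on_real_abs:
  fixes f :: "'a \<Rightarrow> real"
  assumes "f summable_on A"
  shows "(\<lambda>x. \<bar>f x\<bar>) summable_on A"
  using assms summable_on_iff_abs_summable_on_real[of f A] by simp

lemma abs_infsum_le:
  fixes f :: "'a \<Rightarrow> real"
  assumes "g summable_on A" "\<And>x. x \<in> A \<Longrightarrow> \<bar>f x\<bar> \<le> g x"
  shows "\<bar>infsum f A\<bar> \<le> infsum g A"
proof -
  have s: "f summable_on A" using summable_on_real_bound[OF assms] by blast
  have "\<bar>infsum f A\<bar> \<le> infsum (\<lambda>x. \<bar>f x\<bar>) A"
    using norm_infsum_bound[of f A] summable_on_real_abs[OF s] by simp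
  also have "\<dots> \<le> infsum g A"
    by (rule infsum_mono) (use assms summable_on_real_abs[OF s] in auto)
  finally show ?thesis .
qed

lemma integrable_measure_pmf_iff_summable_on:
  fixes f :: "'a \<Rightarrow> real"
  shows "integrable (measure_pmf p) f \<longleftrightarrow> (\<lambda>x. pmf p x * f x) summable_on UNIV"
  unfolding summable_on_iff_integrable_count_space measure_pmf_eq_density
  by (subst integrable_density) auto

lemma integral_measure_pmf_infsum:
  fixes f :: "'a \<Rightarrow> real"
  shows "(\<integral>x. f x \<partial>measure_pmf p) = (\<Sum>\<^sub>\<infinity>x. pmf p x * f x)"
  unfolding infsum_eq_integral_count_space measure_pmf_eq_density
  by (subst integral_density) auto

lemma summable_on_times:
  fixes f :: "'a \<Rightarrow> real" and g :: "'b \<Rightarrow> real"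
  assumes "f summable_on UNIV" "g summable_on UNIV"
  shows "(\<lambda>(x, y). f x * g y) summable_on UNIV"
proof -
  have "(\<lambda>z. \<bar>f (fst z)\<bar> * \<bar>g (snd z)\<bar>) summable_on Sigma UNIV (\<lambda>_. UNIV)"
  proof (rule summable_on_SigmaI[where g="\<lambda>x. \<bar>f x\<bar> * (\<Sum>\<^sub>\<infinity>y. \<bar>g y\<bar>)"])
    show "((\<lambda>y. \<bar>f (fst (x, y))\<bar> * \<bar>g (snd (x, y))\<bar>) has_sum \<bar>f x\<bar> * (\<Sum>\<^sub>\<infinity>y. \<bar>g y\<bar>)) UNIV" for x
      using has_sum_cmult_right[OF has_sum_infsum[OF summable_on_real_abs[OF assms(2)]]] by simp
    show "(\<lambda>x. \<bar>f x\<bar> * (\<Sum>\<^sub>\<infinity>y. \<bar>g y\<bar>)) summable_on UNIV"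
      by (rule summable_on_cmult_left) (rule summable_on_real_abs[OF assms(1)])
  qed simp
  then show ?thesis
    by - (rule summable_on_real_bound[where g="\<lambda>z. \<bar>f (fst z)\<bar> * \<bar>g (snd z)\<bar>"],
        auto simp: abs_mult)
qed

lemma infsum_times:
  fixes f :: "'a \<Rightarrow> real" and g :: "'b \<Rightarrow> real"
  assumes "f summable_on UNIV" "g summable_on UNIV"
  shows "(\<Sum>\<^sub>\<infinity>(x, y). f x * g y) = infsum f UNIV * infsum g UNIV"
proof -
  have "(\<Sum>\<^sub>\<infinity>x. \<Sum>\<^sub>\<infinity>y. f x * g y) = (\<Sum>\<^sub>\<infinity>(x, y)\<in>Sigma UNIV (\<lambda>_. UNIV). f x * g y)"
    by (rule infsum_Sigma'_banach) (use summable_on_times[OF assms] in simp)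
  then show ?thesis by (simp add: infsum_cmult_right' infsum_cmult_left')
qed

text \<open>A product majorant with integrable factors makes the weighted double sum absolutely
  convergent, and then the order of summation is free.\<close>

lemma pmf_fubini:
  fixes F :: "'a \<Rightarrow> 'b \<Rightarrow> real"
  assumes "integrable (measure_pmf r) g" "integrable (measure_pmf s) h"
    and "\<And>x y. \<bar>F x y\<bar> \<le> g x * h y"
  shows "(\<integral>x. (\<integral>y. F x y \<partial>measure_pmf s) \<partial>measure_pmf r)
       = (\<integral>y. (\<integral>x. F x y \<partial>measure_pmf r) \<partial>measure_pmf s)"
proof -
  have "(\<lambda>(x, y). (pmf r x * g x) * (pmf s y * h y)) summable_on UNIV"
    by (rule summable_on_times) (use assms in \<open>auto simp: integrable_measure_pmf_iff_summable_on\<close>)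
  then have S: "(\<lambda>(x, y). pmf r x * (pmf s y * F x y)) summable_on UNIV"
  proof (rule summable_on_real_bound)
    fix z :: "'a \<times> 'b"
    have "pmf r (fst z) * pmf s (snd z) * \<bar>F (fst z) (snd z)\<bar>
        \<le> pmf r (fst z) * pmf s (snd z) * (g (fst z) * h (snd z))"
      by (intro mult_left_mono assms(3)) simp
    then show "\<bar>case z of (x, y) \<Rightarrow> pmf r x * (pmf s y * F x y)\<bar>
        \<le> (case z of (x, y) \<Rightarrow> (pmf r x * g x) * (pmf s y * h y))"
      by (simp add: case_prod_unfold abs_mult mult_ac)
  qed
  have "(\<integral>x. (\<integral>y. F x y \<partial>measure_pmf s) \<partial>measure_pmf r)
      = (\<Sum>\<^sub>\<infinity>x. \<Sum>\<^sub>\<infinity>y. pmf r x * (pmf s y * F x y))"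
    by (simp add: integral_measure_pmf_infsum infsum_cmult_right')
  also have "\<dots> = (\<Sum>\<^sub>\<infinity>y. \<Sum>\<^sub>\<infinity>x. pmf r x * (pmf s y * F x y))"
    by (rule infsum_swap_banach) (use S in simp)
  also have "\<dots> = (\<Sum>\<^sub>\<infinity>y. \<Sum>\<^sub>\<infinity>x. pmf s y * (pmf r x * F x y))"
    by (simp only: mult.left_commute)
  also have "\<dots> = (\<integral>y. (\<integral>x. F x y \<partial>measure_pmf r) \<partial>measure_pmf s)"
    by (simp add: integral_measure_pmf_infsum infsum_cmult_right')
  finally show ?thesis .
qed

section \<open>Existence of Sinkhorn scalings\<close>

lemma pmf_integrable_bound:
  fixes f :: "'a \<Rightarrow> real"
  assumes "integrable (measure_pmf p) g" "\<And>x. x \<in> set_pmf p \<Longrightarrow> \<bar>f x\<bar> \<le> g x"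
  shows "integrable (measure_pmf p) f"
proof (rule Bochner_Integration.integrable_bound[OF assms(1)])
  show "AE x in measure_pmf p. norm (f x) \<le> norm (g x)"
    using assms(2) by (force simp: AE_measure_pmf_iff)
qed simp

lemma pmf_abs_integral_le:
  fixes f :: "'a \<Rightarrow> real"
  assumes "integrable (measure_pmf p) g" "\<And>x. x \<in> set_pmf p \<Longrightarrow> \<bar>f x\<bar> \<le> g x"
  shows "\<bar>\<integral>x. f x \<partial>measure_pmf p\<bar> \<le> (\<integral>x. g x \<partial>measure_pmf p)"
proof -
  have i: "integrable (measure_pmf p) f" by (rule pmf_integrable_bound[OF assms])
  have "\<bar>\<integral>x. f x \<partial>measure_pmf p\<bar> \<le> (\<integral>x. \<bar>f x\<bar> \<partial>measure_pmf p)"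
    using integral_norm_bound[of "measure_pmf p" f] by simp
  also have "\<dots> \<le> (\<integral>x. g x \<partial>measure_pmf p)"
    by (rule integral_mono_AE) (use i assms in \<open>auto simp: AE_measure_pmf_iff\<close>)
  finally show ?thesis .
qed

lemma pmf_integral_split_point:
  fixes a b :: real
  shows "(\<integral>y. (if y = y1 then a else b) \<partial>measure_pmf s) = b + pmf s y1 * (a - b)"
proof -
  have "(\<integral>y. (if y = y1 then a else b) \<partial>measure_pmf s)
      = (\<integral>y. b + (a - b) * indicator {y1} y \<partial>measure_pmf s)"
    by (rule Bochner_Integration.integral_cong) (auto simp: indicator_def)
  also have "\<dots> = b + (a - b) * measure (measure_pmf s) {y1}"
    by (subst Bochner_Integration.integral_add)
       (auto intro!: integrable_mult_right pmf_integrable_bound[of s "\<lambda>_. 1" "indicator {y1}"])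
  finally show ?thesis by (simp add: measure_pmf_single)
qed

section \<open>Two-sided kernel bounds and the normalised Sinkhorn iteration\<close>

locale sinkhorn_kernel =
  fixes k :: "'x \<Rightarrow> 'y \<Rightarrow> real" and s :: "'y pmf" and psi :: "'y \<Rightarrow> real" and y1 :: 'y
  assumes k_le1: "\<And>x y. k x y \<le> 1"
    and k_ge: "\<And>x y. 1 / psi y \<le> k x y"
    and psi_ge1: "\<And>y. 1 \<le> psi y"
    and y1_in: "y1 \<in> set_pmf s"
    and psi4: "integrable (measure_pmf s) (\<lambda>y. psi y ^ 4)"
begin

text \<open>With \<open>w y1 = 1\<close> the point \<open>y1\<close> alone gives
  \<open>\<integral>y. k x y * w y \<ge> pmf s y1 / psi y1\<close>, whose inverse is
  \<open>Umax\<close>; \<open>w \<le> psi\<close> and \<open>k \<le> 1\<close> bound the same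
  integral by \<open>1 / Umin\<close>. The mass that a row of the density places on
  \<open>y1\<close> is \<open>pmf s y1 * u x * k x y1\<close>, which is at least
  \<open>eps\<close>.\<close>

definition "Umax = psi y1 / pmf s y1"
definition "Umin = 1 / (\<integral>y. psi y \<partial>measure_pmf s)"
definition "eps = pmf s y1 * Umin / psi y1"

text \<open>The equation \<open>w y1 = 1\<close> fixes the free multiplicative constant of the pair.
  The bounds are part of the notion and do not mention \<open>r\<close>, which makes all later
  estimates uniform in the marginal.\<close>

definition is_scaling :: "'x pmf \<Rightarrow> ('x \<Rightarrow> real) \<Rightarrow> ('y \<Rightarrow> real) \<Rightarrow> bool" where
  "is_scaling r u w \<longleftrightarrow>
     (\<forall>x. Umin \<le> u x \<and> u x \<le> Umax) \<and> (\<forall>y. 1 / Umax \<le> w y \<and> w y \<le> psi y) \<and> w y1 = 1 \<and>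
     (\<forall>x. u x * (\<integral>y. k x y * w y \<partial>measure_pmf s) = 1) \<and>
     (\<forall>y. w y * (\<integral>x. k x y * u x \<partial>measure_pmf r) = 1)"

lemma psi_pos: "0 < psi y" using psi_ge1[of y] by linarith

lemma k_pos: "0 < k x y"
  using k_ge[of y x] psi_pos[of y] by (meson divide_pos_pos less_le_trans zero_less_one)

lemma psi_power_integrable:
  assumes "j \<le> 4"
  shows "integrable (measure_pmf s) (\<lambda>y. psi y ^ j)"
proof (rule pmf_integrable_bound[OF psi4])
  fix y
  have "psi y ^ j \<le> psi y ^ 4" by (rule power_increasing[OF assms psi_ge1])
  then show "\<bar>psi y ^ j\<bar> \<le> psi y ^ 4" using psi_pos[of y] by simp
qed

lemma psi_integrable: "integrable (measure_pmf s) psi"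
  using psi_power_integrable[of 1] by simp

lemma s1_pos: "0 < pmf s y1" using y1_in by (simp add: pmf_positive)

lemma s1_le1: "pmf s y1 \<le> 1" by (rule pmf_le_1)

lemma Umax_ge1: "1 \<le> Umax"
  using s1_pos s1_le1 psi_ge1[of y1] by (simp add: Umax_def field_simps)

lemma Umax_pos: "0 < Umax" using Umax_ge1 by linarith

lemma int_psi_ge1: "1 \<le> (\<integral>y. psi y \<partial>measure_pmf s)"
proof -
  have "(\<integral>y. 1 \<partial>measure_pmf s) \<le> (\<integral>y. psi y \<partial>measure_pmf s)"
    by (rule integral_mono) (use psi_integrable psi_ge1 in auto)
  then show ?thesis by simp
qed

lemma Umin_pos: "0 < Umin" and Umin_le1: "Umin \<le> 1"
  using int_psi_ge1 by (auto simp: Umin_def)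

lemma eps_pos: "0 < eps"
  using s1_pos Umin_pos psi_pos by (simp add: eps_def)

lemma eps_le1: "eps \<le> 1"
proof -
  have "pmf s y1 * Umin \<le> 1 * 1"
    by (rule mult_mono) (use s1_le1 Umin_le1 Umin_pos in auto)
  then show ?thesis using psi_ge1[of y1] psi_pos[of y1] by (simp add: eps_def field_simps)
qed

lemma k_u_integrable:
  assumes "\<And>x. 0 \<le> u x \<and> u x \<le> Umax"
  shows "integrable (measure_pmf r) (\<lambda>x. k x y * u x)"
proof (rule pmf_integrable_bound[where g="\<lambda>_. Umax"])
  fix x
  have "k x y * u x \<le> 1 * Umax"
    by (rule mult_mono) (use assms[of x] k_le1 k_pos in \<open>auto intro: less_imp_le\<close>)
  then show "\<bar>k x y * u x\<bar> \<le> Umax" using k_pos[of x y] assms[of x] by simp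
qed simp

lemma k_w_bound:
  assumes "\<And>y. 0 \<le> w y \<and> w y \<le> psi y"
  shows "\<bar>k x y * w y\<bar> \<le> psi y"
proof -
  have "k x y * w y \<le> 1 * psi y"
    by (rule mult_mono) (use assms[of y] k_le1 k_pos in \<open>auto intro: less_imp_le\<close>)
  then show ?thesis using k_pos[of x y] assms[of y] by simp
qed

lemma k_w_integrable:
  assumes "\<And>y. 0 \<le> w y \<and> w y \<le> psi y"
  shows "integrable (measure_pmf s) (\<lambda>y. k x y * w y)"
  by (rule pmf_integrable_bound[OF psi_integrable]) (rule k_w_bound[OF assms])

text \<open>One Sinkhorn step in which the marginal constraint at \<open>y1\<close> is replaced by the normalisation
  \<open>w y1 = 1\<close>. The step is monotone and decreases the constant \<open>Umax\<close>, so its iterates converge.\<close>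

definition sink_w :: "'x pmf \<Rightarrow> ('x \<Rightarrow> real) \<Rightarrow> 'y \<Rightarrow> real" where
  "sink_w r u y = (if y = y1 then 1 else 1 / (\<integral>x. k x y * u x \<partial>measure_pmf r))"

definition sink_u :: "'x pmf \<Rightarrow> ('x \<Rightarrow> real) \<Rightarrow> 'x \<Rightarrow> real" where
  "sink_u r u x = 1 / (\<integral>y. k x y * sink_w r u y \<partial>measure_pmf s)"

text \<open>The last conjunct is what survives of the dropped marginal constraint at
  \<open>y1\<close>: an inequality instead of an equality. It is the source of the bound
  \<open>w \<le> psi\<close> along the iteration.\<close>

definition admissible :: "'x pmf \<Rightarrow> ('x \<Rightarrow> real) \<Rightarrow> bool" where
  "admissible r u \<longleftrightarrow> (\<forall>x. Umin \<le> u x \<and> u x \<le> Umax) \<and> 1 \<le> (\<integral>x. k x y1 * u x \<partial>measure_pmf r)"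

lemma admissibleD:
  assumes "admissible r u"
  shows "Umin \<le> u x" "u x \<le> Umax" "0 < u x" "1 \<le> (\<integral>x. k x y1 * u x \<partial>measure_pmf r)"
    "integrable (measure_pmf r) (\<lambda>x. k x y * u x)"
proof -
  show *: "Umin \<le> u x" "u x \<le> Umax" "1 \<le> (\<integral>x. k x y1 * u x \<partial>measure_pmf r)" for x
    using assms by (auto simp: admissible_def)
  show "0 < u x" for x using *(1)[of x] Umin_pos by linarith
  then show "integrable (measure_pmf r) (\<lambda>x. k x y * u x)"
    by (intro k_u_integrable) (use * in \<open>auto intro: less_imp_le\<close>)
qed

text \<open>Since \<open>k x y1 \<le> 1\<close> and \<open>1 / psi y \<le> k x y\<close>, one has
  \<open>k x y \<ge> k x y1 / psi y\<close>; the lower bound at \<open>y1\<close> therefore spreads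
  to every \<open>y\<close> at the price of a factor \<open>psi y\<close>.\<close>

lemma int_ku_bounds:
  assumes "admissible r u"
  shows "1 / psi y \<le> (\<integral>x. k x y * u x \<partial>measure_pmf r)" "(\<integral>x. k x y * u x \<partial>measure_pmf r) \<le> Umax"
    "0 < (\<integral>x. k x y * u x \<partial>measure_pmf r)"
proof -
  note D = admissibleD[OF assms]
  have "1 / psi y \<le> (\<integral>x. k x y1 * u x \<partial>measure_pmf r) / psi y"
    using D(4) psi_pos[of y] by (simp add: divide_right_mono)
  also have "\<dots> = (\<integral>x. (k x y1 * u x) / psi y \<partial>measure_pmf r)" by simp
  also have "\<dots> \<le> (\<integral>x. k x y * u x \<partial>measure_pmf r)"
  proof (rule integral_mono)
    fix x
    have "k x y1 * u x * (1 / psi y) \<le> 1 * u x * k x y"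
      by (intro mult_mono k_le1 k_ge) (use D(3)[of x] psi_pos[of y] in \<open>auto intro: less_imp_le\<close>)
    then show "(k x y1 * u x) / psi y \<le> k x y * u x" by (simp add: mult_ac)
  qed (use D(5) in auto)
  finally show *: "1 / psi y \<le> (\<integral>x. k x y * u x \<partial>measure_pmf r)" .
  then show "0 < (\<integral>x. k x y * u x \<partial>measure_pmf r)"
    using psi_pos[of y] by (meson divide_pos_pos less_le_trans zero_less_one)
  have "(\<integral>x. k x y * u x \<partial>measure_pmf r) \<le> (\<integral>x. Umax \<partial>measure_pmf r)"
  proof (rule integral_mono)
    fix x
    have "k x y * u x \<le> 1 * Umax"
      by (intro mult_mono k_le1) (use D(2,3)[of x] in \<open>auto intro: less_imp_le\<close>)
    then show "k x y * u x \<le> Umax" by simp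
  qed (use D(5) in auto)
  then show "(\<integral>x. k x y * u x \<partial>measure_pmf r) \<le> Umax" by simp
qed

lemma sink_w_bounds:
  assumes "admissible r u"
  shows "1 / Umax \<le> sink_w r u y" "sink_w r u y \<le> psi y" "0 < sink_w r u y"
proof -
  note b = int_ku_bounds[OF assms, of y]
  show "1 / Umax \<le> sink_w r u y"
    using b Umax_ge1 by (auto simp: sink_w_def intro: divide_left_mono)
  then show "0 < sink_w r u y" using Umax_pos by (meson divide_pos_pos less_le_trans zero_less_one)
  have "1 / (\<integral>x. k x y * u x \<partial>measure_pmf r) \<le> 1 / (1 / psi y)"
    by (rule divide_left_mono) (use b psi_pos[of y] in auto)
  then show "sink_w r u y \<le> psi y" using psi_ge1[of y] by (auto simp: sink_w_def)
qed

lemma int_kw_bounds: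
  assumes w: "\<And>y. 0 < w y \<and> w y \<le> psi y" "w y1 = 1"
  shows "1 / Umax \<le> (\<integral>y. k x y * w y \<partial>measure_pmf s)"
    "(\<integral>y. k x y * w y \<partial>measure_pmf s) \<le> 1 / Umin"
    "0 < (\<integral>y. k x y * w y \<partial>measure_pmf s)"
proof -
  have i: "integrable (measure_pmf s) (\<lambda>y. k x y * w y)"
    by (rule k_w_integrable) (use w in \<open>auto intro: less_imp_le\<close>)
  have "(\<integral>y. k x y * w y \<partial>measure_pmf s) \<le> (\<integral>y. psi y \<partial>measure_pmf s)"
  proof (rule integral_mono[OF i psi_integrable])
    fix y show "k x y * w y \<le> psi y" using k_w_bound[of w x y] w by (simp add: less_imp_le)
  qed
  then show "(\<integral>y. k x y * w y \<partial>measure_pmf s) \<le> 1 / Umin" by (simp add: Umin_def)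
  have "1 / Umax = pmf s y1 * (1 / psi y1)" by (simp add: Umax_def)
  also have "\<dots> \<le> pmf s y1 * k x y1" by (intro mult_left_mono k_ge) simp
  also have "\<dots> = (\<integral>y. (if y = y1 then k x y1 else 0) \<partial>measure_pmf s)"
    using pmf_integral_split_point[where a="k x y1" and b=0 and ?y1.0=y1 and s=s] by simp
  also have "\<dots> \<le> (\<integral>y. k x y * w y \<partial>measure_pmf s)"
  proof (rule integral_mono[OF _ i])
    show "integrable (measure_pmf s) (\<lambda>y. if y = y1 then k x y1 else 0)"
      by (rule pmf_integrable_bound[where g="\<lambda>_. k x y1"]) (use k_pos in \<open>auto intro: less_imp_le\<close>)
    fix y show "(if y = y1 then k x y1 else 0) \<le> k x y * w y"
      using w k_pos[of x y] by (auto intro: mult_nonneg_nonneg less_imp_le)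
  qed
  finally show *: "1 / Umax \<le> (\<integral>y. k x y * w y \<partial>measure_pmf s)" .
  then show "0 < (\<integral>y. k x y * w y \<partial>measure_pmf s)"
    using Umax_pos by (meson divide_pos_pos less_le_trans zero_less_one)
qed

lemma sink_w_y1 [simp]: "sink_w r u y1 = 1" by (simp add: sink_w_def)

lemma sink_u_bounds:
  assumes "admissible r u"
  shows "Umin \<le> sink_u r u x" "sink_u r u x \<le> Umax"
proof -
  have w: "\<And>y. 0 < sink_w r u y \<and> sink_w r u y \<le> psi y" using sink_w_bounds[OF assms] by auto
  note b = int_kw_bounds[OF w sink_w_y1, of x]
  have "1 / (1 / Umin) \<le> sink_u r u x" unfolding sink_u_def
    by (rule divide_left_mono) (use b Umin_pos in auto)
  then show "Umin \<le> sink_u r u x" by simp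
  have "sink_u r u x \<le> 1 / (1 / Umax)" unfolding sink_u_def
    by (rule divide_left_mono) (use b Umax_pos in auto)
  then show "sink_u r u x \<le> Umax" by simp
qed

text \<open>Each half step inverts an integral with positive kernel and so reverses the order; two
  reversals preserve it.\<close>

lemma sink_u_mono:
  assumes "admissible r u" "admissible r v" "\<And>x. u x \<le> v x"
  shows "sink_u r u x \<le> sink_u r v x"
proof -
  have w: "\<And>y. 0 < sink_w r u y \<and> sink_w r u y \<le> psi y" using sink_w_bounds[OF assms(1)] by auto
  have w': "\<And>y. 0 < sink_w r v y \<and> sink_w r v y \<le> psi y" using sink_w_bounds[OF assms(2)] by auto
  have le: "sink_w r v y \<le> sink_w r u y" for y
  proof -
    have "(\<integral>x. k x y * u x \<partial>measure_pmf r) \<le> (\<integral>x. k x y * v x \<partial>measure_pmf r)"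
      by (rule integral_mono)
         (use assms(3) k_pos admissibleD(5)[OF assms(1)] admissibleD(5)[OF assms(2)]
           in \<open>auto intro: mult_left_mono less_imp_le\<close>)
    then show ?thesis
      using int_ku_bounds(3)[OF assms(1), of y] int_ku_bounds(3)[OF assms(2), of y]
      by (auto simp: sink_w_def intro!: divide_left_mono)
  qed
  have "(\<integral>y. k x y * sink_w r v y \<partial>measure_pmf s) \<le> (\<integral>y. k x y * sink_w r u y \<partial>measure_pmf s)"
    by (rule integral_mono) (use le w w' k_pos in \<open>auto intro!: k_w_integrable mult_left_mono intro: less_imp_le\<close>)
  then show ?thesis
    unfolding sink_u_def
    by (rule divide_left_mono)
       (use int_kw_bounds(3)[OF w sink_w_y1] int_kw_bounds(3)[OF w' sink_w_y1] in auto)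
qed

text \<open>By its definition \<open>sink_u\<close> gives every row mass 1; Fubini turns this into a
  statement about the columns.\<close>

lemma sink_total_mass:
  assumes "admissible r u"
  shows "(\<integral>y. sink_w r u y * (\<integral>x. k x y * sink_u r u x \<partial>measure_pmf r) \<partial>measure_pmf s) = 1"
proof -
  have w: "\<And>y. 0 < sink_w r u y \<and> sink_w r u y \<le> psi y" using sink_w_bounds[OF assms] by auto
  have u: "0 < sink_u r u x" "sink_u r u x \<le> Umax" for x
    using sink_u_bounds[OF assms, of x] Umin_pos by auto
  have "(\<integral>y. sink_w r u y * (\<integral>x. k x y * sink_u r u x \<partial>measure_pmf r) \<partial>measure_pmf s)
      = (\<integral>y. (\<integral>x. sink_u r u x * (k x y * sink_w r u y) \<partial>measure_pmf r) \<partial>measure_pmf s)"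
    unfolding integral_mult_right_zero[symmetric] by (simp only: mult_ac)
  also have "\<dots> = (\<integral>x. (\<integral>y. sink_u r u x * (k x y * sink_w r u y) \<partial>measure_pmf s) \<partial>measure_pmf r)"
  proof (rule pmf_fubini[symmetric, where g="\<lambda>_. Umax" and h=psi])
    fix x y
    have "sink_u r u x * (k x y * sink_w r u y) \<le> Umax * psi y"
      by (rule mult_mono) (use k_w_bound[of "sink_w r u" x y] w u Umax_pos k_pos[of x y] in \<open>auto simp: less_imp_le\<close>)
    then show "\<bar>sink_u r u x * (k x y * sink_w r u y)\<bar> \<le> Umax * psi y"
      using u[of x] k_pos[of x y] w[of y] by (simp add: abs_mult)
  qed (auto simp: psi_integrable)
  also have "\<dots> = (\<integral>x. 1 \<partial>measure_pmf r)"
  proof (rule Bochner_Integration.integral_cong[OF refl])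
    fix x
    show "(\<integral>y. sink_u r u x * (k x y * sink_w r u y) \<partial>measure_pmf s) = 1"
      using int_kw_bounds(3)[OF w sink_w_y1, of x] by (simp add: sink_u_def)
  qed
  finally show ?thesis by simp
qed

text \<open>The total mass is 1. If the step decreases \<open>u\<close>, every column other than
  \<open>y1\<close> has mass at most 1, so the column at \<open>y1\<close> must have mass at least
  1, which is the inequality in \<open>admissible\<close>.\<close>

lemma admissible_sink_u:
  assumes "admissible r u" "\<And>x. sink_u r u x \<le> u x"
  shows "admissible r (sink_u r u)"
proof -
  note D = admissibleD[OF assms(1)]
  have w: "\<And>y. 0 < sink_w r u y \<and> sink_w r u y \<le> psi y" using sink_w_bounds[OF assms(1)] by auto
  have u: "0 < sink_u r u x" "sink_u r u x \<le> Umax" for x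
    using sink_u_bounds[OF assms(1), of x] Umin_pos by auto
  define J where "J = (\<lambda>y. \<integral>x. k x y * sink_u r u x \<partial>measure_pmf r)"
  have J: "J y \<le> (\<integral>x. k x y * u x \<partial>measure_pmf r)" for y
    unfolding J_def
    by (rule integral_mono) (use u k_pos assms(2) D(5) in \<open>auto intro!: k_u_integrable mult_left_mono intro: less_imp_le\<close>)
  have J0: "0 \<le> J y" for y
    unfolding J_def using u k_pos by (intro Bochner_Integration.integral_nonneg) (auto intro: less_imp_le)
  have le1: "sink_w r u y * J y \<le> (if y = y1 then J y1 else 1)" for y
  proof (cases "y = y1")
    case False
    have "sink_w r u y * J y \<le> sink_w r u y * (\<integral>x. k x y * u x \<partial>measure_pmf r)"
      using J w by (intro mult_left_mono) (auto intro: less_imp_le)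
    also have "\<dots> = 1" using False int_ku_bounds(3)[OF assms(1), of y] by (simp add: sink_w_def)
    finally show ?thesis using False by simp
  qed simp
  have "1 = (\<integral>y. sink_w r u y * J y \<partial>measure_pmf s)"
    using sink_total_mass[OF assms(1)] by (simp add: J_def)
  also have "\<dots> \<le> (\<integral>y. (if y = y1 then J y1 else 1) \<partial>measure_pmf s)"
  proof (rule integral_mono)
    show i: "integrable (measure_pmf s) (\<lambda>y. if y = y1 then J y1 else 1)"
      by (rule pmf_integrable_bound[where g="\<lambda>_. 1 + \<bar>J y1\<bar>"]) auto
    show "integrable (measure_pmf s) (\<lambda>y. sink_w r u y * J y)"
      by (rule pmf_integrable_bound[OF i]) (use le1 J0 w in \<open>simp add: abs_mult less_imp_le\<close>)
  qed (rule le1)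
  also have "\<dots> = 1 + pmf s y1 * (J y1 - 1)"
    by (rule pmf_integral_split_point)
  finally have "0 \<le> pmf s y1 * (J y1 - 1)" by simp
  then have "1 \<le> J y1" using s1_pos by (simp add: zero_le_mult_iff)
  then show ?thesis
    using sink_u_bounds[OF assms(1)] by (auto simp: admissible_def J_def)
qed

lemma admissible_Umax: "admissible r (\<lambda>_. Umax)"
proof -
  have "1 \<le> Umax * (1 / psi y1)" using s1_pos s1_le1 psi_pos[of y1] by (simp add: Umax_def)
  also have "\<dots> = (\<integral>x. (1 / psi y1) * Umax \<partial>measure_pmf r)" by simp
  also have "\<dots> \<le> (\<integral>x. k x y1 * Umax \<partial>measure_pmf r)"
    using Umax_pos
    by (intro integral_mono k_u_integrable[of "\<lambda>_. Umax"] mult_right_mono k_ge) auto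
  finally show ?thesis using Umin_le1 Umax_ge1 by (auto simp: admissible_def)
qed

text \<open>The iterates from the constant \<open>Umax\<close> decrease pointwise and stay above
  \<open>Umin\<close>. Dominated convergence (with majorants \<open>Umax\<close> and
  \<open>psi\<close>) passes both half steps to the limit, which is thus a fixed point of
  \<open>sink_u\<close>.\<close>

theorem scaling_exists: "\<exists>u w. is_scaling r u w"
proof -
  define un where "un = (\<lambda>n. (sink_u r ^^ n) (\<lambda>_. Umax))"
  have un_Suc: "un (Suc n) = sink_u r (un n)" for n by (simp add: un_def)
  have A: "admissible r (un n) \<and> (\<forall>x. un (Suc n) x \<le> un n x)" for n
  proof (induction n)
    case 0
    show ?case using admissible_Umax sink_u_bounds(2)[OF admissible_Umax] by (simp add: un_def)
  next
    case (Suc n)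
    have a: "admissible r (un (Suc n))" unfolding un_Suc
      by (rule admissible_sink_u) (use Suc in \<open>auto simp: un_Suc[symmetric]\<close>)
    moreover have "un (Suc (Suc n)) x \<le> un (Suc n) x" for x
      unfolding un_Suc
      by (rule sink_u_mono) (use a Suc in \<open>auto simp: un_Suc[symmetric]\<close>)
    ultimately show ?case by blast
  qed
  then have adm: "admissible r (un n)" for n by blast
  have "\<exists>L. (\<lambda>n. un n x) \<longlonglongrightarrow> L" for x
  proof -
    have "decseq (\<lambda>n. un n x)" using A by (intro decseq_SucI) auto
    then show ?thesis using decseq_convergent[of "\<lambda>n. un n x" Umin] admissibleD(1)[OF adm] by metis
  qed
  then obtain u where u: "\<And>x. (\<lambda>n. un n x) \<longlonglongrightarrow> u x" by metis
  have ub: "Umin \<le> u x" "u x \<le> Umax" for x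
    using LIMSEQ_le_const[OF u[of x], of Umin] LIMSEQ_le_const2[OF u[of x], of Umax]
      admissibleD(1,2)[OF adm] by auto
  have ku: "(\<lambda>n. \<integral>x. k x y * un n x \<partial>measure_pmf r) \<longlonglongrightarrow> (\<integral>x. k x y * u x \<partial>measure_pmf r)" for y
  proof (rule integral_dominated_convergence[where w="\<lambda>_. Umax"])
    show "AE x in measure_pmf r. (\<lambda>n. k x y * un n x) \<longlonglongrightarrow> k x y * u x"
      by (intro AE_I2 tendsto_intros u)
    show "AE x in measure_pmf r. norm (k x y * un n x) \<le> Umax" for n
    proof (rule AE_I2)
      fix x
      have "k x y * un n x \<le> 1 * Umax"
        by (intro mult_mono k_le1) (use admissibleD(2,3)[OF adm, of n x] in \<open>auto intro: less_imp_le\<close>)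
      then show "norm (k x y * un n x) \<le> Umax"
        using k_pos[of x y] admissibleD(3)[OF adm, of n x] by simp
    qed
  qed auto
  have "1 \<le> (\<integral>x. k x y1 * u x \<partial>measure_pmf r)"
    using LIMSEQ_le_const[OF ku[of y1], of 1] admissibleD(4)[OF adm] by auto
  then have au: "admissible r u" using ub by (auto simp: admissible_def)
  have w: "\<And>y. 0 < sink_w r u y \<and> sink_w r u y \<le> psi y" using sink_w_bounds[OF au] by auto
  have wl: "(\<lambda>n. sink_w r (un n) y) \<longlonglongrightarrow> sink_w r u y" for y
  proof (cases "y = y1")
    case False
    then show ?thesis unfolding sink_w_def using int_ku_bounds(3)[OF au, of y]
      by (auto intro!: tendsto_intros ku)
  qed simp
  have kw: "(\<lambda>n. \<integral>y. k x y * sink_w r (un n) y \<partial>measure_pmf s)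
      \<longlonglongrightarrow> (\<integral>y. k x y * sink_w r u y \<partial>measure_pmf s)" for x
  proof (rule integral_dominated_convergence[where w=psi])
    show "AE y in measure_pmf s. (\<lambda>n. k x y * sink_w r (un n) y) \<longlonglongrightarrow> k x y * sink_w r u y"
      by (intro AE_I2 tendsto_intros wl)
    show "AE y in measure_pmf s. norm (k x y * sink_w r (un n) y) \<le> psi y" for n
      using k_w_bound[of "sink_w r (un n)" x] sink_w_bounds[OF adm[of n]] by (auto simp: less_imp_le)
  qed (auto simp: psi_integrable)
  have fixpt: "sink_u r u = u"
  proof
    fix x
    have "(\<lambda>n. sink_u r (un n) x) \<longlonglongrightarrow> sink_u r u x"
      unfolding sink_u_def using int_kw_bounds(3)[OF w sink_w_y1, of x]
      by (intro tendsto_intros kw) auto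
    moreover have "(\<lambda>n. sink_u r (un n) x) \<longlonglongrightarrow> u x"
      using LIMSEQ_Suc[OF u[of x]] by (simp add: un_Suc)
    ultimately show "sink_u r u x = u x" by (rule LIMSEQ_unique)
  qed
  define J where "J = (\<lambda>y. \<integral>x. k x y * u x \<partial>measure_pmf r)"
  have wJ: "sink_w r u y * J y = (if y = y1 then J y1 else 1)" for y
    using int_ku_bounds(3)[OF au, of y] by (simp add: sink_w_def J_def)
  \<comment> \<open>Recovers the constraint that the iteration ignored: all columns except
    \<open>y1\<close> have mass 1 and the total is 1, hence \<open>J y1 = 1\<close> because
    \<open>pmf s y1 > 0\<close>.\<close>
  have "1 = (\<integral>y. sink_w r u y * J y \<partial>measure_pmf s)"
    using sink_total_mass[OF au] by (simp add: J_def fixpt)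
  also have "\<dots> = 1 + pmf s y1 * (J y1 - 1)"
    unfolding wJ by (rule pmf_integral_split_point)
  finally have "J y1 = 1" using s1_pos by simp
  then have "sink_w r u y * J y = 1" for y using wJ by auto
  moreover have "u x * (\<integral>y. k x y * sink_w r u y \<partial>measure_pmf s) = 1" for x
    using fun_cong[OF fixpt, of x] int_kw_bounds(3)[OF w sink_w_y1, of x]
    by (auto simp: sink_u_def field_simps)
  ultimately have "is_scaling r u (sink_w r u)"
    using ub w sink_w_bounds(1)[OF au] by (auto simp: is_scaling_def J_def)
  then show ?thesis by blast
qed

end

section \<open>Lipschitz dependence of the scalings on the marginal\<close>

text \<open>Twice the total variation distance.\<close>

definition pmf_dist :: "'a pmf \<Rightarrow> 'a pmf \<Rightarrow> real" where
  "pmf_dist r r' = (\<Sum>\<^sub>\<infinity>x. \<bar>pmf r' x - pmf r x\<bar>)"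

lemma pmf_summable: "pmf p summable_on UNIV"
  using integrable_measure_pmf_iff_summable_on[of p "\<lambda>_. 1"] by simp

lemma infsum_pmf: "(\<Sum>\<^sub>\<infinity>x. pmf p x) = 1"
  using integral_measure_pmf_infsum[of p "\<lambda>_. 1"] by simp

lemma summable_on_real_diff:
  fixes f g :: "'a \<Rightarrow> real"
  assumes "f summable_on A" "g summable_on A"
  shows "(\<lambda>x. f x - g x) summable_on A"
  using summable_on_add[OF assms(1) summable_on_uminus[THEN iffD2, OF assms(2)]] by simp

lemma infsum_real_diff:
  fixes f g :: "'a \<Rightarrow> real"
  assumes "f summable_on A" "g summable_on A"
  shows "(\<Sum>\<^sub>\<infinity>x\<in>A. f x - g x) = infsum f A - infsum g A"
  using infsum_add[OF assms(1) summable_on_uminus[THEN iffD2, OF assms(2)]] by (simp add: infsum_uminus)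

lemma pmf_diff_abs_summable: "(\<lambda>x. \<bar>pmf r' x - pmf r x\<bar>) summable_on UNIV"
  by (intro summable_on_real_abs summable_on_real_diff pmf_summable)

lemma pmf_dist_nonneg: "0 \<le> pmf_dist r r'"
  unfolding pmf_dist_def by (intro infsum_nonneg) auto

lemma pmf_dist_commute: "pmf_dist r r' = pmf_dist r' r"
  unfolding pmf_dist_def by (simp add: abs_minus_commute)

lemma pmf_dist_le_2: "pmf_dist r r' \<le> 2"
proof -
  have "pmf_dist r r' \<le> (\<Sum>\<^sub>\<infinity>x. pmf r' x + pmf r x)"
    unfolding pmf_dist_def
    by (intro infsum_mono pmf_diff_abs_summable summable_on_add pmf_summable)
       (use pmf_nonneg in \<open>auto simp: abs_le_iff intro: order_trans[of _ 0]\<close>)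
  also have "\<dots> = 2" by (simp add: infsum_add pmf_summable infsum_pmf)
  finally show ?thesis .
qed

text \<open>The only way in which a change of marginal enters: replacing \<open>r'\<close> by
  \<open>r\<close> under a bounded integrand produces a sum against the signed mass
  \<open>r' - r\<close>, controlled by the sup norm.\<close>

lemma signed_integral:
  fixes f :: "'a \<Rightarrow> real"
  assumes "\<And>x. \<bar>f x\<bar> \<le> B"
  shows "(\<lambda>x. (pmf r' x - pmf r x) * f x) summable_on UNIV"
    and "(\<integral>x. f x \<partial>measure_pmf r') = (\<integral>x. f x \<partial>measure_pmf r) + (\<Sum>\<^sub>\<infinity>x. (pmf r' x - pmf r x) * f x)"
    and "\<bar>\<Sum>\<^sub>\<infinity>x. (pmf r' x - pmf r x) * f x\<bar> \<le> B * pmf_dist r r'"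
proof -
  have i: "(\<lambda>x. pmf p x * f x) summable_on UNIV" for p
    using pmf_integrable_bound[of p "\<lambda>_. B" f] assms
    by (simp add: integrable_measure_pmf_iff_summable_on)
  show 1: "(\<lambda>x. (pmf r' x - pmf r x) * f x) summable_on UNIV"
    using summable_on_real_diff[OF i i] by (simp add: algebra_simps)
  show "(\<integral>x. f x \<partial>measure_pmf r') = (\<integral>x. f x \<partial>measure_pmf r) + (\<Sum>\<^sub>\<infinity>x. (pmf r' x - pmf r x) * f x)"
    unfolding integral_measure_pmf_infsum
    by (subst infsum_add[OF i 1, symmetric]) (simp add: algebra_simps)
  have "\<bar>\<Sum>\<^sub>\<infinity>x. (pmf r' x - pmf r x) * f x\<bar> \<le> (\<Sum>\<^sub>\<infinity>x. B * \<bar>pmf r' x - pmf r x\<bar>)"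
  proof (rule abs_infsum_le)
    show "(\<lambda>x. B * \<bar>pmf r' x - pmf r x\<bar>) summable_on UNIV"
      by (intro summable_on_cmult_right pmf_diff_abs_summable)
    show "\<bar>(pmf r' x - pmf r x) * f x\<bar> \<le> B * \<bar>pmf r' x - pmf r x\<bar>" for x
      using mult_left_mono[OF assms[of x], of "\<bar>pmf r' x - pmf r x\<bar>"] by (simp add: abs_mult mult.commute)
  qed
  then show "\<bar>\<Sum>\<^sub>\<infinity>x. (pmf r' x - pmf r x) * f x\<bar> \<le> B * pmf_dist r r'"
    by (simp add: pmf_dist_def infsum_cmult_right')
qed

context sinkhorn_kernel
begin

lemma scalingD:
  assumes "is_scaling r u w"
  shows "Umin \<le> u x" "u x \<le> Umax" "0 < u x" "1 / Umax \<le> w y" "w y \<le> psi y" "0 < w y" "w y1 = 1"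
    "u x * (\<integral>y. k x y * w y \<partial>measure_pmf s) = 1" "w y * (\<integral>x. k x y * u x \<partial>measure_pmf r) = 1"
proof -
  show *: "Umin \<le> u x" "u x \<le> Umax" "1 / Umax \<le> w y" "w y \<le> psi y" "w y1 = 1"
    "u x * (\<integral>y. k x y * w y \<partial>measure_pmf s) = 1" "w y * (\<integral>x. k x y * u x \<partial>measure_pmf r) = 1"
    using assms by (auto simp: is_scaling_def)
  show "0 < u x" using * Umin_pos by linarith
  show "0 < w y" using * Umax_pos by (meson divide_pos_pos less_le_trans zero_less_one)
qed

definition psi_moment :: "nat \<Rightarrow> real" where "psi_moment j = (\<integral>y. psi y ^ j \<partial>measure_pmf s)"

lemma psi_moment_nonneg: "0 \<le> psi_moment j"
  unfolding psi_moment_def using psi_pos by (intro Bochner_Integration.integral_nonneg) (auto intro: less_imp_le)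

lemma density_bounds:
  assumes "is_scaling r u w"
  shows "0 < u x * k x y * w y" "u x * k x y * w y \<le> Umax * psi y"
    "Umin / psi y1 \<le> u x * k x y1 * w y1"
proof -
  note S = scalingD[OF assms]
  show "0 < u x * k x y * w y" using S(3,6) k_pos by simp
  have "u x * k x y * w y \<le> (Umax * 1) * psi y"
    by (intro mult_mono S k_le1) (use S(3,6) k_pos Umax_pos in \<open>auto intro: less_imp_le\<close>)
  then show "u x * k x y * w y \<le> Umax * psi y" by simp
  have "Umin * (1 / psi y1) \<le> u x * k x y1"
    by (intro mult_mono S k_ge) (use S(3)[of x] psi_pos in \<open>auto intro: less_imp_le\<close>)
  then show "Umin / psi y1 \<le> u x * k x y1 * w y1" using S(7) by simp
qed

lemma density_integrable:
  assumes "is_scaling r u w"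
  shows "integrable (measure_pmf s) (\<lambda>y. u x * k x y * w y)"
    "(\<integral>y. u x * k x y * w y \<partial>measure_pmf s) = 1"
    "integrable (measure_pmf r) (\<lambda>x. u x * k x y * w y)"
    "(\<integral>x. u x * k x y * w y \<partial>measure_pmf r) = 1"
proof -
  note D = density_bounds[OF assms] and S = scalingD[OF assms]
  show "integrable (measure_pmf s) (\<lambda>y. u x * k x y * w y)"
    by (rule pmf_integrable_bound[where g="\<lambda>y. Umax * psi y"])
       (use D psi_integrable in \<open>auto simp: less_imp_le abs_of_pos\<close>)
  show "integrable (measure_pmf r) (\<lambda>x. u x * k x y * w y)"
    by (rule pmf_integrable_bound[where g="\<lambda>_. Umax * psi y"]) (use D in \<open>auto simp: less_imp_le abs_of_pos\<close>)
  show "(\<integral>y. u x * k x y * w y \<partial>measure_pmf s) = 1"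
    using S(8)[of x] by (simp add: mult.assoc)
  have "(\<integral>x. u x * k x y * w y \<partial>measure_pmf r) = (\<integral>x. w y * (k x y * u x) \<partial>measure_pmf r)"
    by (simp only: mult_ac)
  then show "(\<integral>x. u x * k x y * w y \<partial>measure_pmf r) = 1"
    using S(9)[of y] by simp
qed

text \<open>The density bound \<open>Umax * psi y\<close> uses up one power of \<open>psi\<close>,
  hence the moment of order \<open>Suc j\<close>.\<close>

lemma density_psi_power:
  assumes "is_scaling r u w" "j \<le> 3"
  shows "integrable (measure_pmf s) (\<lambda>y. u x * k x y * w y * psi y ^ j)"
    "(\<integral>y. u x * k x y * w y * psi y ^ j \<partial>measure_pmf s) \<le> Umax * psi_moment (Suc j)"
proof -
  have i: "integrable (measure_pmf s) (\<lambda>y. Umax * psi y ^ Suc j)"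
    by (intro integrable_mult_right psi_power_integrable) (use assms in simp)
  have b: "\<bar>u x * k x y * w y * psi y ^ j\<bar> \<le> Umax * psi y ^ Suc j" for y
    using mult_right_mono[OF density_bounds(2)[OF assms(1), of x y], of "psi y ^ j"]
      density_bounds(1)[OF assms(1), of x y] psi_pos[of y]
    by (simp add: abs_mult mult_ac less_imp_le abs_of_pos)
  show "integrable (measure_pmf s) (\<lambda>y. u x * k x y * w y * psi y ^ j)"
    by (rule pmf_integrable_bound[OF i b])
  show "(\<integral>y. u x * k x y * w y * psi y ^ j \<partial>measure_pmf s) \<le> Umax * psi_moment (Suc j)"
    using pmf_abs_integral_le[OF i b] by (simp add: psi_moment_def)
qed

text \<open>Dropping \<open>y1\<close> costs every row of the density at least the mass \<open>eps\<close>.\<close>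

lemma row_gap:
  assumes "is_scaling r u w" "0 \<le> T"
  shows "integrable (measure_pmf s) (\<lambda>y. if y = y1 then 0 else u x * k x y * w y * T)"
    "(\<integral>y. (if y = y1 then 0 else u x * k x y * w y * T) \<partial>measure_pmf s) \<le> T - eps * T"
proof -
  let ?p = "\<lambda>y. u x * k x y * w y"
  have i: "integrable (measure_pmf s) (\<lambda>y. ?p y * T)"
    using density_integrable(1)[OF assms(1)] by simp
  have i1: "integrable (measure_pmf s) (\<lambda>y. if y = y1 then ?p y1 * T else 0)"
    by (rule pmf_integrable_bound[where g="\<lambda>_. \<bar>?p y1 * T\<bar>"]) auto
  have e: "(\<lambda>y. if y = y1 then 0 else ?p y * T) = (\<lambda>y. ?p y * T - (if y = y1 then ?p y1 * T else 0))"
    by auto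
  show "integrable (measure_pmf s) (\<lambda>y. if y = y1 then 0 else u x * k x y * w y * T)"
    unfolding e using i i1 by (rule Bochner_Integration.integrable_diff)
  have "(\<integral>y. (if y = y1 then 0 else ?p y * T) \<partial>measure_pmf s) = T - pmf s y1 * (?p y1 * T)"
    unfolding e Bochner_Integration.integral_diff[OF i i1] pmf_integral_split_point
    using density_integrable(2)[OF assms(1)] by simp
  moreover have "eps * T \<le> pmf s y1 * ?p y1 * T"
    using density_bounds(3)[OF assms(1), of x] assms(2) s1_pos
      mult_left_mono[of "Umin / psi y1" "?p y1" "pmf s y1"]
    by (intro mult_right_mono) (auto simp: eps_def)
  ultimately show "(\<integral>y. (if y = y1 then 0 else ?p y * T) \<partial>measure_pmf s) \<le> T - eps * T"
    by simp
qed

text \<open>Origins: \<open>C1\<close> is the one-sided and \<open>C2\<close> the two-sided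
  Lipschitz constant of the \<open>u\<close> ratio, \<open>C3\<close> that of the \<open>w\<close>
  ratio. \<open>C4\<close> is the quadratic error of the column equation, \<open>C5\<close> the
  quadratic error of the \<open>u\<close> ratio after inverting the linear system (division by
  \<open>eps\<close>), and \<open>C6\<close> collects everything for the density.\<close>

definition "C1 = Umax ^ 3 * psi_moment 2 / (Umin * eps)"
definition "C2 = Umax / Umin * C1"
definition "C3 = Umax * C2 + Umax"
definition "C4 = C3 * (C2 + Umax\<^sup>2 / Umin) + Umax * C2"
definition "C5 = (C2 * (Umax * C3 * psi_moment 2) + Umax * C4 * psi_moment 3) / eps"
definition "C6 = Umax * (2 * C5 + C4 + C2 * C3) + Umax * (C2 + C3 + 2 * C2 * C3)"

lemma C_nonneg: "0 \<le> C1" "0 \<le> C2" "0 \<le> C3" "0 \<le> C4" "0 \<le> C5" "0 \<le> C6"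
proof -
  note [simp] = Umax_pos Umin_pos eps_pos psi_moment_nonneg less_imp_le[OF Umax_pos] less_imp_le[OF Umin_pos] less_imp_le[OF eps_pos]
  show 1: "0 \<le> C1" by (simp add: C1_def)
  show 2: "0 \<le> C2" using 1 by (simp add: C2_def)
  show 3: "0 \<le> C3" using 2 by (simp add: C3_def)
  show 4: "0 \<le> C4" using 2 3 by (simp add: C4_def)
  show 5: "0 \<le> C5" using 2 3 4 by (simp add: C5_def)
  show 6: "0 \<le> C6" using 2 3 4 5 by (simp add: C6_def)
qed

lemma ku_bound:
  assumes "is_scaling r u w"
  shows "\<bar>k x y * u x\<bar> \<le> Umax"
proof -
  note S = scalingD[OF assms]
  have "k x y * u x \<le> 1 * Umax"
    by (intro mult_mono S k_le1) (use S(3) Umax_pos in \<open>auto intro: less_imp_le\<close>)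
  then show ?thesis using k_pos[of x y] S(3)[of x] by simp
qed

text \<open>A maximum principle for \<open>R\<close>, the supremum of \<open>u / u'\<close>. The
  column equations turn \<open>u \<le> R * u'\<close> into \<open>w' \<le> R * w\<close> up to an
  error in \<open>N\<close>. Inserted into the row equation this returns
  \<open>u / u' \<le> R - eps * (R - 1) + K * N\<close>, because at \<open>y1\<close> both weights
  are 1 and the factor \<open>R\<close> is absent there. Taking the supremum leaves
  \<open>eps * (R - 1) \<le> K * N\<close>.\<close>

lemma scaling_ratio_le:
  assumes S: "is_scaling r u w" and S': "is_scaling r' u' w'"
  shows "u x / u' x \<le> 1 + C1 * pmf_dist r r'"
proof -
  define N where "N = pmf_dist r r'"
  have N0: "0 \<le> N" unfolding N_def by (rule pmf_dist_nonneg)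
  note D = scalingD[OF S] and D' = scalingD[OF S']
  define R where "R = (SUP x. u x / u' x)"
  have ub: "u x / u' x \<le> Umax / Umin" for x
    by (intro frac_le) (use D(1-3)[of x] D'(1-3)[of x] Umin_pos in auto)
  have bdd: "bdd_above (range (\<lambda>x. u x / u' x))" using ub by (intro bdd_aboveI[where M="Umax/Umin"]) auto
  have leR: "u x / u' x \<le> R" for x unfolding R_def by (rule cSUP_upper[OF _ bdd]) simp
  have R_le: "R \<le> Umax / Umin" unfolding R_def by (rule cSUP_least) (use ub in auto)
  have R0: "0 < R" using leR[of undefined] D(3) D'(3) by (meson divide_pos_pos less_le_trans)
  show ?thesis
  proof (cases "1 \<le> R")
    case False
    then have "u x / u' x \<le> 1" using leR[of x] by linarith
    then show ?thesis using C_nonneg(1) pmf_dist_nonneg[of r r']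
      by (simp add: add_increasing2)
  next
    case True
    define K where "K = Umax ^ 3 * psi_moment 2 / Umin"
    \<comment> \<open>The weights are inverse column integrals, so the bound on \<open>u\<close>
      reverses into one on \<open>w'\<close>. The summand \<open>Umax * N\<close> pays for replacing
      \<open>r\<close> by \<open>r'\<close>, and \<open>w' y \<le> psi y\<close> accounts for the
      factor \<open>psi y\<close>.\<close>
    have wle: "w' y \<le> R * w y * (1 + Umax * N * psi y)" for y
    proof -
      have "(\<integral>x. k x y * u x \<partial>measure_pmf r) \<le> (\<integral>x. R * (k x y * u' x) \<partial>measure_pmf r)"
      proof (rule integral_mono)
        fix x
        have "u x \<le> R * u' x" using leR[of x] D'(3)[of x] by (simp add: field_simps)
        then show "k x y * u x \<le> R * (k x y * u' x)"
          using mult_left_mono[of "u x" "R * u' x" "k x y"] k_pos[of x y] by (simp add: mult_ac)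
      qed (use D D' in \<open>auto intro!: k_u_integrable intro: less_imp_le\<close>)
      also have "\<dots> = R * (\<integral>x. k x y * u' x \<partial>measure_pmf r)" by simp
      also have "\<dots> \<le> R * ((\<integral>x. k x y * u' x \<partial>measure_pmf r') + Umax * N)"
      proof (rule mult_left_mono)
        have b: "\<bar>k x y * u' x\<bar> \<le> Umax" for x by (rule ku_bound[OF S'])
        show "(\<integral>x. k x y * u' x \<partial>measure_pmf r) \<le> (\<integral>x. k x y * u' x \<partial>measure_pmf r') + Umax * N"
          using signed_integral(2)[where f="\<lambda>x. k x y * u' x", OF b, of r' r]
            signed_integral(3)[where f="\<lambda>x. k x y * u' x", OF b, of r' r] by (simp add: N_def)
      qed (use R0 in simp)
      finally have "w' y * w y * (\<integral>x. k x y * u x \<partial>measure_pmf r)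
          \<le> w' y * w y * (R * ((\<integral>x. k x y * u' x \<partial>measure_pmf r') + Umax * N))"
        by (rule mult_left_mono) (use D(6)[of y] D'(6)[of y] in auto)
      moreover have "w' y * w y * (\<integral>x. k x y * u x \<partial>measure_pmf r) = w' y"
        using D(9)[of y] by (simp add: mult.assoc)
      moreover have "w' y * w y * (R * ((\<integral>x. k x y * u' x \<partial>measure_pmf r') + Umax * N))
          = R * w y * (w' y * (\<integral>x. k x y * u' x \<partial>measure_pmf r') + Umax * N * w' y)"
        by (simp add: algebra_simps)
      moreover have "\<dots> \<le> R * w y * (1 + Umax * N * psi y)"
        using R0 D(6)[of y] N0 Umax_pos D'(5)[of y] unfolding D'(9)[of y]
        by (intro mult_left_mono add_left_mono) auto
      ultimately show ?thesis by linarith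
    qed
    have step: "u x / u' x \<le> R + K * N - eps * (R - 1)" for x
    proof -
      let ?p = "\<lambda>y. u x * k x y * w y"
      have ip: "integrable (measure_pmf s) (\<lambda>y. ?p y * psi y ^ 1)"
        and ipl: "(\<integral>y. ?p y * psi y ^ 1 \<partial>measure_pmf s) \<le> Umax * psi_moment (Suc 1)"
        using density_psi_power[OF S, of 1 x] by auto
      \<comment> \<open>The excess \<open>R - 1\<close> over the density is charged only off
        \<open>y1\<close>; \<open>row_gap\<close> then returns a strict fraction of it.\<close>
      have gi: "integrable (measure_pmf s) (\<lambda>y. if y = y1 then 0 else ?p y * (R - 1))"
        and gl: "(\<integral>y. (if y = y1 then 0 else ?p y * (R - 1)) \<partial>measure_pmf s) \<le> (R - 1) - eps * (R - 1)"
        using row_gap[OF S, of "R - 1" x] True by auto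
      have ri: "integrable (measure_pmf s) (\<lambda>y. ?p y + (if y = y1 then 0 else ?p y * (R - 1))
          + R * Umax * N * (?p y * psi y ^ 1))"
        by (intro Bochner_Integration.integrable_add integrable_mult_right ip gi density_integrable[OF S])
      have "u x / u' x = u x * (\<integral>y. k x y * w' y \<partial>measure_pmf s)"
        using D'(8)[of x] D'(3)[of x] by (simp add: field_simps)
      also have "\<dots> = (\<integral>y. u x * (k x y * w' y) \<partial>measure_pmf s)" by simp
      also have "\<dots> \<le> (\<integral>y. ?p y + (if y = y1 then 0 else ?p y * (R - 1))
          + R * Umax * N * (?p y * psi y ^ 1) \<partial>measure_pmf s)"
      proof (rule integral_mono[OF _ ri])
        show "integrable (measure_pmf s) (\<lambda>y. u x * (k x y * w' y))"
          by (intro integrable_mult_right k_w_integrable) (use D' in \<open>auto intro: less_imp_le\<close>)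
        fix y
        have p0: "0 < ?p y" by (rule density_bounds(1)[OF S])
        have "0 \<le> R * Umax * N * (?p y * psi y ^ 1)"
          using R0 Umax_pos N0 p0 psi_pos[of y]
          by (intro mult_nonneg_nonneg[of "R * Umax * N"] mult_nonneg_nonneg[of "?p y"]) auto
        moreover have "u x * (k x y * w' y) \<le> u x * k x y * (R * w y * (1 + Umax * N * psi y))"
          using mult_left_mono[OF wle[of y], of "u x * k x y"] D(3)[of x] k_pos[of x y]
          by (simp add: mult.assoc)
        ultimately show "u x * (k x y * w' y) \<le> ?p y + (if y = y1 then 0 else ?p y * (R - 1))
          + R * Umax * N * (?p y * psi y ^ 1)"
          using D(7) D'(7) by (auto simp: algebra_simps)
      qed
      also have "\<dots> = 1 + (\<integral>y. (if y = y1 then 0 else ?p y * (R - 1)) \<partial>measure_pmf s)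
          + R * Umax * N * (\<integral>y. ?p y * psi y ^ 1 \<partial>measure_pmf s)"
        using density_integrable(1,2)[OF S, of x] gi ip
        by (simp only: Bochner_Integration.integral_add Bochner_Integration.integrable_add
              integrable_mult_right integral_mult_right_zero)
      also have "\<dots> \<le> 1 + ((R - 1) - eps * (R - 1)) + (Umax / Umin) * Umax * N * (Umax * psi_moment 2)"
        using gl ipl R_le R0 Umax_pos N0 psi_moment_nonneg[of 2] D(3) D(6) k_pos psi_pos
        by (intro add_mono mult_mono mult_right_mono mult_nonneg_nonneg Bochner_Integration.integral_nonneg)
           (auto simp: numeral_2_eq_2 less_imp_le)
      also have "\<dots> = R + K * N - eps * (R - 1)"
        by (simp add: K_def power3_eq_cube algebra_simps)
      finally show ?thesis .
    qed
    have "R \<le> R + K * N - eps * (R - 1)"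
      unfolding R_def[symmetric] by (subst (1) R_def, rule cSUP_least) (use step in auto)
    then have "R - 1 \<le> K * N / eps"
      using eps_pos by (simp add: pos_le_divide_eq mult.commute)
    also have "K * N / eps = C1 * N" by (simp add: C1_def K_def)
    finally have "R - 1 \<le> C1 * N" .
    then show ?thesis using leR[of x] by (simp add: N_def)
  qed
qed

text \<open>Exchanging the roles of the two scalings gives the opposite one-sided bound, and
  \<open>1 - u'/u = (u'/u) * (u/u' - 1)\<close> the missing lower estimate. For \<open>w\<close>,
  the difference of the inverses is \<open>- w' y * Q\<close>, where \<open>Q\<close> is the
  difference of the column integrals; the factor \<open>w' y \<le> psi y\<close> explains the
  weight.\<close>

lemma scaling_lipschitz:
  assumes S: "is_scaling r u w" and S': "is_scaling r' u' w'"
  shows "\<bar>u' x / u x - 1\<bar> \<le> C2 * pmf_dist r r'"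
    and "\<bar>w' y / w y - 1\<bar> \<le> C3 * psi y * pmf_dist r r'"
proof -
  define N where "N = pmf_dist r r'"
  have N0: "0 \<le> N" unfolding N_def by (rule pmf_dist_nonneg)
  note D = scalingD[OF S] and D' = scalingD[OF S']
  have q1: "1 \<le> Umax / Umin" using Umin_pos Umin_le1 Umax_ge1 by simp
  show A: "\<bar>u' x / u x - 1\<bar> \<le> C2 * pmf_dist r r'" for x
  proof -
    have a: "u x / u' x \<le> 1 + C1 * N" "u' x / u x \<le> 1 + C1 * N"
      using scaling_ratio_le[OF S S'] scaling_ratio_le[OF S' S] by (auto simp: N_def pmf_dist_commute)
    have C1N: "0 \<le> C1 * N" using C_nonneg N0 by simp
    have "C1 * N \<le> C2 * N" using mult_right_mono[OF q1 C1N] by (simp add: C2_def mult.assoc)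
    moreover have "1 - u' x / u x \<le> C2 * N"
    proof -
      have "1 - u' x / u x = (u' x / u x) * (u x / u' x - 1)"
        using D(3)[of x] D'(3)[of x] by (simp add: field_simps)
      also have "\<dots> \<le> (u' x / u x) * (C1 * N)"
        using a D(3)[of x] D'(3)[of x] by (intro mult_left_mono) auto
      also have "\<dots> \<le> (Umax / Umin) * (C1 * N)"
        by (intro mult_right_mono frac_le) (use D(1,3)[of x] D'(2,3)[of x] Umin_pos Umax_pos C1N in auto)
      finally show ?thesis by (simp add: C2_def mult.assoc)
    qed
    ultimately show ?thesis using a by (simp add: N_def abs_le_iff)
  qed
  have b': "\<bar>k x y * u' x\<bar> \<le> Umax" for x by (rule ku_bound[OF S'])
  have iu: "integrable (measure_pmf p) (\<lambda>x. k x y * u x)" for p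
    by (rule k_u_integrable) (use D in \<open>auto intro: less_imp_le\<close>)
  have iu': "integrable (measure_pmf p) (\<lambda>x. k x y * u' x)" for p
    by (rule k_u_integrable) (use D' in \<open>auto intro: less_imp_le\<close>)
  define Q where "Q = (\<integral>x. k x y * u' x \<partial>measure_pmf r') - (\<integral>x. k x y * u x \<partial>measure_pmf r)"
  have "Q = (\<integral>x. k x y * u' x - k x y * u x \<partial>measure_pmf r) + (\<Sum>\<^sub>\<infinity>x. (pmf r' x - pmf r x) * (k x y * u' x))"
    unfolding Q_def using signed_integral(2)[where f="\<lambda>x. k x y * u' x", OF b', of r' r]
    by (simp add: Bochner_Integration.integral_diff iu iu')
  moreover have "\<bar>\<integral>x. k x y * u' x - k x y * u x \<partial>measure_pmf r\<bar> \<le> (\<integral>x. Umax * (C2 * N) \<partial>measure_pmf r)"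
  proof (rule pmf_abs_integral_le)
    fix x
    have "k x y * u' x - k x y * u x = k x y * u x * (u' x / u x - 1)"
      using D(3)[of x] by (simp add: field_simps)
    also have "\<bar>\<dots>\<bar> \<le> Umax * (C2 * N)"
      unfolding abs_mult[of "k x y * u x"] using ku_bound[OF S, of x y] A[of x] Umax_pos
      by (intro mult_mono) (auto simp: N_def)
    finally show "\<bar>k x y * u' x - k x y * u x\<bar> \<le> Umax * (C2 * N)" .
  qed simp
  moreover have "\<bar>\<Sum>\<^sub>\<infinity>x. (pmf r' x - pmf r x) * (k x y * u' x)\<bar> \<le> Umax * N"
    unfolding N_def by (rule signed_integral(3)) (rule b')
  ultimately have Q: "\<bar>Q\<bar> \<le> C3 * N" by (simp add: C3_def algebra_simps)
  have "w' y / w y - 1 = - w' y * Q"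
  proof -
    have "1 / w y = (\<integral>x. k x y * u x \<partial>measure_pmf r)" "w' y * (\<integral>x. k x y * u' x \<partial>measure_pmf r') = 1"
      using D(9)[of y] D(6)[of y] D'(9)[of y] by (auto simp: field_simps)
    moreover have "w' y / w y = w' y * (1 / w y)" by simp
    ultimately show ?thesis unfolding Q_def by (simp only: right_diff_distrib)
  qed
  also have "\<bar>\<dots>\<bar> = w' y * \<bar>Q\<bar>" using D'(6)[of y] by (simp add: abs_mult)
  also have "\<dots> \<le> psi y * (C3 * N)"
    by (intro mult_mono Q D') (use psi_pos[of y] D'(6)[of y] in auto)
  finally show "\<bar>w' y / w y - 1\<bar> \<le> C3 * psi y * pmf_dist r r'" by (simp add: N_def mult_ac)
qed

end

section \<open>Second order expansion of the scalings\<close>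

context sinkhorn_kernel
begin

text \<open>The scaling equations are exact products: \<open>(1 + A x) * (1 + I) = 1\<close> with
  \<open>I\<close> the row integral of \<open>B\<close>, hence the linear part
  \<open>A x + I\<close> equals \<open>- A x * I\<close>, a product of two first order terms. The
  column equation has the same form, with an additional first order term from the change of
  marginal.\<close>

lemma scaling_remainder:
  assumes S: "is_scaling r u w" and S': "is_scaling r' u' w'"
  defines "N \<equiv> pmf_dist r r'"
  defines "p \<equiv> \<lambda>x y. u x * k x y * w y"
  defines "A \<equiv> \<lambda>x. u' x / u x - 1" and "B \<equiv> \<lambda>y. w' y / w y - 1"
  shows "\<bar>A x + (\<integral>y. p x y * B y \<partial>measure_pmf s)\<bar> \<le> C2 * (Umax * C3 * psi_moment 2) * N\<^sup>2"
    and "\<bar>B y + (\<integral>x. p x y * A x \<partial>measure_pmf r) + (\<Sum>\<^sub>\<infinity>x. (pmf r' x - pmf r x) * p x y)\<bar>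
      \<le> C4 * psi y ^ 2 * N\<^sup>2"
proof -
  have N0: "0 \<le> N" unfolding N_def by (rule pmf_dist_nonneg)
  note D = scalingD[OF S] and D' = scalingD[OF S']
  have p0: "0 < p x y" and pU: "p x y \<le> Umax * psi y" for x y
    using density_bounds(1,2)[OF S] by (auto simp: p_def)
  have Ab: "\<bar>A x\<bar> \<le> C2 * N" for x using scaling_lipschitz(1)[OF S S'] by (simp add: A_def N_def)
  have Bb: "\<bar>B y\<bar> \<le> C3 * psi y * N" for y using scaling_lipschitz(2)[OF S S'] by (simp add: B_def N_def)
  have C2N: "0 \<le> C2 * N" and C3N: "0 \<le> C3 * N" using C_nonneg N0 by auto
  {
    fix x
    define I where "I = (\<integral>y. p x y * B y \<partial>measure_pmf s)"
    have gi: "integrable (measure_pmf s) (\<lambda>y. C3 * N * (p x y * psi y ^ 1))"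
      using density_psi_power[OF S, of 1 x] by (intro integrable_mult_right) (auto simp: p_def)
    have gb: "\<bar>p x y * B y\<bar> \<le> C3 * N * (p x y * psi y ^ 1)" for y
      using mult_left_mono[OF Bb[of y], of "p x y"] p0[of x y] by (simp add: abs_mult mult_ac)
    have iB: "integrable (measure_pmf s) (\<lambda>y. p x y * B y)" by (rule pmf_integrable_bound[OF gi gb])
    have "\<bar>I\<bar> \<le> C3 * N * (\<integral>y. p x y * psi y ^ 1 \<partial>measure_pmf s)"
      unfolding I_def using pmf_abs_integral_le[OF gi gb] by simp
    also have "\<dots> \<le> C3 * N * (Umax * psi_moment (Suc 1))"
      using density_psi_power(2)[OF S, of 1 x] by (intro mult_left_mono C3N) (auto simp: p_def)
    finally have I: "\<bar>I\<bar> \<le> C3 * N * (Umax * psi_moment 2)" by (simp add: numeral_2_eq_2)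
    have "u x / u' x = u x * (\<integral>y. k x y * w' y \<partial>measure_pmf s)"
      using D'(8)[of x] D'(3)[of x] by (simp add: field_simps)
    also have "\<dots> = (\<integral>y. u x * (k x y * w' y) \<partial>measure_pmf s)" by simp
    also have "\<dots> = (\<integral>y. p x y + p x y * B y \<partial>measure_pmf s)"
      using less_imp_neq[OF D(6)] by (intro Bochner_Integration.integral_cong) (auto simp: p_def B_def field_simps)
    also have "\<dots> = 1 + I"
      unfolding I_def using density_integrable(1,2)[OF S, of x] iB
      by (subst Bochner_Integration.integral_add) (auto simp: p_def)
    finally have "u x / u' x = 1 + I" .
    then have "(1 + A x) * (1 + I) = 1" using D(3)[of x] D'(3)[of x] by (simp add: A_def field_simps)
    then have "A x + I = - A x * I" by (simp add: algebra_simps)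
    then have "\<bar>A x + I\<bar> = \<bar>A x\<bar> * \<bar>I\<bar>" by (simp add: abs_mult)
    also have "\<dots> \<le> (C2 * N) * (C3 * N * (Umax * psi_moment 2))"
      by (intro mult_mono Ab I) (use C2N in auto)
    finally show "\<bar>A x + (\<integral>y. p x y * B y \<partial>measure_pmf s)\<bar> \<le> C2 * (Umax * C3 * psi_moment 2) * N\<^sup>2"
      by (simp add: I_def power2_eq_square mult_ac)
  }
  {
    let ?h = "\<lambda>x. pmf r' x - pmf r x"
    have pb: "\<bar>p x y\<bar> \<le> Umax * psi y" for x using p0[of x y] pU[of x y] by simp
    have pAb: "\<bar>p x y * A x\<bar> \<le> Umax * psi y * (C2 * N)" for x
      unfolding abs_mult by (intro mult_mono pb Ab) (use Umax_pos psi_pos[of y] in auto)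
    have pA1b: "\<bar>p x y * (1 + A x)\<bar> \<le> Umax * psi y * (Umax / Umin)" for x
    proof -
      have "1 + A x = u' x / u x" by (simp add: A_def)
      also have "\<bar>\<dots>\<bar> \<le> Umax / Umin"
        using D(3)[of x] D'(3)[of x] by (simp, intro frac_le) (use D(1,2)[of x] D'(2,3)[of x] Umin_pos Umax_pos in auto)
      finally have "\<bar>1 + A x\<bar> \<le> Umax / Umin" .
      then show ?thesis unfolding abs_mult by (intro mult_mono pb) (use Umax_pos psi_pos[of y] in auto)
    qed
    define IA where "IA = (\<integral>x. p x y * A x \<partial>measure_pmf r)"
    define Dp where "Dp = (\<Sum>\<^sub>\<infinity>x. ?h x * p x y)"
    define DA where "DA = (\<Sum>\<^sub>\<infinity>x. ?h x * (p x y * A x))"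
    define D1 where "D1 = (\<Sum>\<^sub>\<infinity>x. ?h x * (p x y * (1 + A x)))"
    have D1: "D1 = Dp + DA"
      unfolding D1_def Dp_def DA_def
      using infsum_add[OF signed_integral(1)[where f="\<lambda>x. p x y" and r=r and r'=r', OF pb]
          signed_integral(1)[where f="\<lambda>x. p x y * A x" and r=r and r'=r', OF pAb]]
      by (simp only: distrib_left mult_1_right)
    have DAb: "\<bar>DA\<bar> \<le> Umax * psi y * (C2 * N) * N"
      unfolding DA_def N_def by (rule signed_integral(3)) (use pAb in \<open>simp add: N_def\<close>)
    have D1b: "\<bar>D1\<bar> \<le> Umax * psi y * (Umax / Umin) * N"
      unfolding D1_def N_def by (rule signed_integral(3)) (rule pA1b)
    have gi: "integrable (measure_pmf r) (\<lambda>x. C2 * N * p x y)"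
      using density_integrable(3)[OF S, of y] by (intro integrable_mult_right) (simp add: p_def)
    have gb: "\<bar>p x y * A x\<bar> \<le> C2 * N * p x y" for x
      using mult_left_mono[OF Ab[of x], of "p x y"] p0[of x y] by (simp add: abs_mult mult_ac)
    have iA: "integrable (measure_pmf r) (\<lambda>x. p x y * A x)" by (rule pmf_integrable_bound[OF gi gb])
    have IAb: "\<bar>IA\<bar> \<le> C2 * N"
      unfolding IA_def using pmf_abs_integral_le[OF gi gb] density_integrable(4)[OF S, of y] by (simp add: p_def)
    have "w y / w' y = w y * (\<integral>x. k x y * u' x \<partial>measure_pmf r')"
      using D'(9)[of y] D'(6)[of y] by (simp add: field_simps)
    also have "\<dots> = (\<integral>x. w y * (k x y * u' x) \<partial>measure_pmf r')" by simp
    also have "\<dots> = (\<integral>x. p x y * (1 + A x) \<partial>measure_pmf r')"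
      using less_imp_neq[OF D(3)] by (intro Bochner_Integration.integral_cong) (auto simp: p_def A_def field_simps)
    also have "\<dots> = (\<integral>x. p x y * (1 + A x) \<partial>measure_pmf r) + D1"
      unfolding D1_def by (rule signed_integral(2)[OF pA1b])
    also have "(\<integral>x. p x y * (1 + A x) \<partial>measure_pmf r) = 1 + IA"
      unfolding IA_def distrib_left
      using density_integrable(3,4)[OF S, of y] iA
      by (subst Bochner_Integration.integral_add) (auto simp: p_def)
    finally have q: "w y / w' y = 1 + (IA + D1)" by simp
    define Q where "Q = IA + D1"
    have "(1 + B y) * (1 + Q) = 1"
      using D(6)[of y] D'(6)[of y] q by (simp add: B_def Q_def[symmetric]) (simp add: field_simps)
    \<comment> \<open>Apart from the product \<open>B y * Q\<close>, the only second order term is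
      \<open>DA\<close>, the signed mass paired with the change \<open>A\<close> of the
      scaling.\<close>
    then have "B y + IA + Dp = - B y * Q - DA" by (simp add: Q_def D1 algebra_simps)
    then have "\<bar>B y + IA + Dp\<bar> \<le> \<bar>B y * Q\<bar> + \<bar>DA\<bar>" by linarith
    also have "\<dots> \<le> (C3 * psi y * N) * (C2 * N + Umax * psi y * (Umax / Umin) * N) + Umax * psi y * (C2 * N) * N"
      unfolding abs_mult[of "B y"]
      by (intro add_mono mult_mono Bb DAb order_trans[OF abs_triangle_ineq] IAb D1b[unfolded mult.assoc])
         (use IAb D1b C_nonneg psi_pos[of y] N0 in \<open>auto simp: Q_def mult.assoc intro: order_trans[OF abs_triangle_ineq]\<close>)
    also have "\<dots> \<le> C4 * psi y ^ 2 * N\<^sup>2"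
    proof -
      have ps: "psi y \<le> psi y ^ 2" using psi_ge1[of y] by (simp add: power2_eq_square)
      have c: "0 \<le> C3 * C2 * N\<^sup>2" "0 \<le> Umax * C2 * N\<^sup>2" using C_nonneg Umax_pos by auto
      have "(C3 * psi y * N) * (C2 * N + Umax * psi y * (Umax / Umin) * N) + Umax * psi y * (C2 * N) * N
         = (C3 * C2 * N\<^sup>2) * psi y + (C3 * (Umax\<^sup>2 / Umin)) * N\<^sup>2 * psi y ^ 2 + (Umax * C2 * N\<^sup>2) * psi y"
        by (simp add: power2_eq_square algebra_simps)
      also have "\<dots> \<le> (C3 * C2 * N\<^sup>2) * psi y ^ 2 + (C3 * (Umax\<^sup>2 / Umin)) * N\<^sup>2 * psi y ^ 2 + (Umax * C2 * N\<^sup>2) * psi y ^ 2"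
        by (intro add_mono mult_left_mono[OF ps] c order_refl)
      also have "\<dots> = C4 * psi y ^ 2 * N\<^sup>2" by (simp add: C4_def algebra_simps)
      finally show ?thesis .
    qed
    finally show "\<bar>B y + (\<integral>x. p x y * A x \<partial>measure_pmf r) + (\<Sum>\<^sub>\<infinity>x. ?h x * p x y)\<bar> \<le> C4 * psi y ^ 2 * N\<^sup>2"
      by (simp add: IA_def Dp_def)
  }
qed

text \<open>The errors \<open>A - al\<close> and \<open>B - be\<close> solve the same linear system
  with a right-hand side that is quadratically small by \<open>scaling_remainder\<close>. Since
  \<open>B - be\<close> vanishes at \<open>y1\<close>, the system contracts by
  \<open>1 - eps\<close>, so the errors are themselves quadratic. The claim follows on expanding
  \<open>p' = p * (1 + A) * (1 + B)\<close>.\<close>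

theorem scaling_expansion:
  assumes S: "is_scaling r u w" and S': "is_scaling r' u' w'"
  defines "N \<equiv> pmf_dist r r'"
  defines "p \<equiv> \<lambda>x y. u x * k x y * w y" and "p' \<equiv> \<lambda>x y. u' x * k x y * w' y"
  defines "h \<equiv> \<lambda>x. pmf r' x - pmf r x"
  assumes al_bdd: "\<And>x. x \<in> set_pmf r \<Longrightarrow> \<bar>al x\<bar> \<le> Ba"
    and al: "\<And>x. x \<in> set_pmf r \<Longrightarrow> al x = - (\<integral>y. p x y * be y \<partial>measure_pmf s)"
    and be1: "be y1 = 0"
    and be: "\<And>y. y \<in> set_pmf s \<Longrightarrow> y \<noteq> y1 \<Longrightarrow>
      be y = - (\<integral>x. p x y * al x \<partial>measure_pmf r) - (\<Sum>\<^sub>\<infinity>x. h x * p x y)"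
    and x: "x \<in> set_pmf r" and y: "y \<in> set_pmf s"
  shows "\<bar>pmf r' x * p' x y - pmf r x * p x y - (h x * p x y + pmf r x * p x y * (al x + be y))\<bar>
    \<le> C6 * psi y ^ 3 * (pmf r x * N\<^sup>2 + \<bar>h x\<bar> * N)"
proof -
  define A where "A = (\<lambda>x. u' x / u x - 1)"
  define B where "B = (\<lambda>y. w' y / w y - 1)"
  have N0: "0 \<le> N" and N2: "N \<le> 2" unfolding N_def by (rule pmf_dist_nonneg pmf_dist_le_2)+
  note D = scalingD[OF S] and D' = scalingD[OF S']
  have p0: "0 < p x y" and pU: "p x y \<le> Umax * psi y" for x y
    using density_bounds(1,2)[OF S] by (auto simp: p_def)
  have Ab: "\<bar>A x\<bar> \<le> C2 * N" for x using scaling_lipschitz(1)[OF S S'] by (simp add: A_def N_def)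
  have Bb: "\<bar>B y\<bar> \<le> C3 * psi y * N" for y using scaling_lipschitz(2)[OF S S'] by (simp add: B_def N_def)
  define E1 where "E1 = C2 * (Umax * C3 * psi_moment 2)"
  have E10: "0 \<le> E1" unfolding E1_def using C_nonneg Umax_pos psi_moment_nonneg by simp
  have eA: "\<bar>A x + (\<integral>y. p x y * B y \<partial>measure_pmf s)\<bar> \<le> E1 * N\<^sup>2" for x
    using scaling_remainder(1)[OF S S'] by (simp add: A_def B_def N_def p_def E1_def)
  have eB: "\<bar>B y + (\<integral>x. p x y * A x \<partial>measure_pmf r) + (\<Sum>\<^sub>\<infinity>x. h x * p x y)\<bar> \<le> C4 * psi y ^ 2 * N\<^sup>2" for y
    using scaling_remainder(2)[OF S S'] by (simp add: A_def B_def N_def p_def h_def)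
  define a' where "a' = (\<lambda>x. A x - al x)"
  define b' where "b' = (\<lambda>y. B y - be y)"
  have a'b: "\<bar>a' x\<bar> \<le> C2 * N + Ba" if "x \<in> set_pmf r" for x
    using Ab[of x] al_bdd[OF that] by (simp add: a'_def)
  \<comment> \<open>The a priori bound \<open>Ba\<close> serves to make this supremum finite; it
    does not enter the final estimate.\<close>
  define T where "T = (SUP x\<in>set_pmf r. \<bar>a' x\<bar>)"
  have bdd: "bdd_above ((\<lambda>x. \<bar>a' x\<bar>) ` set_pmf r)"
    using a'b by (intro bdd_aboveI[where M="C2 * N + Ba"]) auto
  have leT: "\<bar>a' x\<bar> \<le> T" if "x \<in> set_pmf r" for x
    unfolding T_def by (rule cSUP_upper[OF that bdd])
  have T0: "0 \<le> T" using leT[OF x] by linarith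
  have pi: "integrable (measure_pmf r) (\<lambda>x. c * p x y)" "(\<integral>x. c * p x y \<partial>measure_pmf r) = c" for c y
    using density_integrable(3,4)[OF S, of y] by (auto simp: p_def)
  have pAi: "integrable (measure_pmf r) (\<lambda>x. p x y * A x)" for y
    by (rule pmf_integrable_bound[OF pi(1)[where c="C2 * N" and y=y]])
       (use Ab p0 in \<open>auto simp: abs_mult abs_of_pos mult.commute[of "p _ y"] intro!: mult_right_mono less_imp_le[OF p0]\<close>)
  have pali: "integrable (measure_pmf r) (\<lambda>x. p x y * al x)" for y
    by (rule pmf_integrable_bound[OF pi(1)[where c="Ba" and y=y]])
       (use al_bdd p0 in \<open>auto simp: abs_mult abs_of_pos mult.commute[of "p _ y"] intro!: mult_right_mono less_imp_le[OF p0]\<close>)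
  have b'b: "\<bar>b' y\<bar> \<le> (if y = y1 then 0 else C4 * psi y ^ 2 * N\<^sup>2 + T)" if y: "y \<in> set_pmf s" for y
  proof (cases "y = y1")
    case True
    then show ?thesis using D(7) D'(7) be1 by (simp add: b'_def B_def)
  next
    case False
    have "b' y = (B y + (\<integral>x. p x y * A x \<partial>measure_pmf r) + (\<Sum>\<^sub>\<infinity>x. h x * p x y))
        - (\<integral>x. p x y * a' x \<partial>measure_pmf r)"
      unfolding b'_def be[OF y False] a'_def right_diff_distrib
      by (simp add: Bochner_Integration.integral_diff pAi pali)
    moreover have "\<bar>\<integral>x. p x y * a' x \<partial>measure_pmf r\<bar> \<le> (\<integral>x. T * p x y \<partial>measure_pmf r)"
      by (rule pmf_abs_integral_le[OF pi(1)])
         (use leT p0 in \<open>auto simp: abs_mult abs_of_pos mult.commute[of "p _ y"] intro!: mult_right_mono less_imp_le[OF p0]\<close>)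
    ultimately show ?thesis using eB[of y] False unfolding pi(2) by simp
  qed
  have a'T: "\<bar>a' x\<bar> \<le> (E1 + Umax * C4 * psi_moment 3) * N\<^sup>2 + (T - eps * T)" if x: "x \<in> set_pmf r" for x
  proof -
    have Bi: "integrable (measure_pmf s) (\<lambda>y. p x y * B y)"
    proof (rule pmf_integrable_bound)
      show "integrable (measure_pmf s) (\<lambda>y. C3 * N * (p x y * psi y ^ 1))"
        using density_psi_power[OF S, of 1 x] by (intro integrable_mult_right) (auto simp: p_def)
      show "\<bar>p x y * B y\<bar> \<le> C3 * N * (p x y * psi y ^ 1)" for y
        using mult_left_mono[OF Bb[of y], of "p x y"] p0[of x y] by (simp add: abs_mult mult_ac)
    qed
    have rg: "integrable (measure_pmf s) (\<lambda>y. if y = y1 then 0 else p x y * T)"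
      "(\<integral>y. (if y = y1 then 0 else p x y * T) \<partial>measure_pmf s) \<le> T - eps * T"
      using row_gap[OF S T0, of x] unfolding p_def by auto
    have gi: "integrable (measure_pmf s) (\<lambda>y. C4 * N\<^sup>2 * (p x y * psi y ^ 2) + (if y = y1 then 0 else p x y * T))"
      using density_psi_power(1)[OF S, of 2 x] rg(1)
      by (intro Bochner_Integration.integrable_add integrable_mult_right) (auto simp: p_def)
    have gb: "\<bar>p x y * b' y\<bar> \<le> C4 * N\<^sup>2 * (p x y * psi y ^ 2) + (if y = y1 then 0 else p x y * T)"
      if "y \<in> set_pmf s" for y
    proof -
      have "\<bar>p x y * b' y\<bar> \<le> p x y * (if y = y1 then 0 else C4 * psi y ^ 2 * N\<^sup>2 + T)"
        using mult_left_mono[OF b'b[OF that], of "p x y"] p0[of x y] by (simp add: abs_mult)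
      also have "\<dots> \<le> C4 * N\<^sup>2 * (p x y * psi y ^ 2) + (if y = y1 then 0 else p x y * T)"
        using C_nonneg p0[of x y] by (auto simp: algebra_simps less_imp_le)
      finally show ?thesis .
    qed
    have b'i: "integrable (measure_pmf s) (\<lambda>y. p x y * b' y)"
      by (rule pmf_integrable_bound[OF gi gb])
    have "\<bar>\<integral>y. p x y * b' y \<partial>measure_pmf s\<bar>
        \<le> C4 * N\<^sup>2 * (\<integral>y. p x y * psi y ^ 2 \<partial>measure_pmf s) + (\<integral>y. (if y = y1 then 0 else p x y * T) \<partial>measure_pmf s)"
      using pmf_abs_integral_le[OF gi gb] density_psi_power(1)[OF S, of 2 x] rg(1)
      by (simp add: p_def)
    also have "\<dots> \<le> C4 * N\<^sup>2 * (Umax * psi_moment 3) + (T - eps * T)"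
      using density_psi_power(2)[OF S, of 2 x] rg(2) C_nonneg
      by (intro add_mono mult_left_mono) (auto simp: p_def)
    finally have Ib: "\<bar>\<integral>y. p x y * b' y \<partial>measure_pmf s\<bar> \<le> C4 * N\<^sup>2 * (Umax * psi_moment 3) + (T - eps * T)" .
    have "(\<integral>y. p x y * be y \<partial>measure_pmf s) = (\<integral>y. p x y * B y - p x y * b' y \<partial>measure_pmf s)"
      by (simp add: b'_def algebra_simps)
    also have "\<dots> = (\<integral>y. p x y * B y \<partial>measure_pmf s) - (\<integral>y. p x y * b' y \<partial>measure_pmf s)"
      by (rule Bochner_Integration.integral_diff[OF Bi b'i])
    finally have "a' x = (A x + (\<integral>y. p x y * B y \<partial>measure_pmf s)) - (\<integral>y. p x y * b' y \<partial>measure_pmf s)"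
      unfolding a'_def al[OF x] by simp
    then have "\<bar>a' x\<bar> \<le> E1 * N\<^sup>2 + (C4 * N\<^sup>2 * (Umax * psi_moment 3) + (T - eps * T))"
      using eA[of x] Ib by linarith
    then show ?thesis by (simp add: algebra_simps)
  qed
  \<comment> \<open>The term \<open>T - eps * T\<close> on the right is absorbed into the left side,
    which explains the division by \<open>eps\<close> in \<open>C5\<close>.\<close>
  have "T \<le> (E1 + Umax * C4 * psi_moment 3) * N\<^sup>2 + (T - eps * T)"
    by (subst (1) T_def, rule cSUP_least) (use a'T x in auto)
  then have T5: "T \<le> C5 * N\<^sup>2"
    using eps_pos by (simp add: C5_def E1_def field_simps)
  have ps: "1 \<le> psi y" "psi y \<le> psi y ^ 2" "1 \<le> psi y ^ 2"
    using psi_ge1[of y] by (auto simp: power2_eq_square mult_ge1_I)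
  have cc: "0 \<le> C5 * N\<^sup>2" "0 \<le> C2 * C3 * N\<^sup>2" "0 \<le> C2 * N" "0 \<le> C3 * N" "0 \<le> 2 * C2 * C3 * N"
    using C_nonneg N0 by auto
  have AB: "\<bar>A x * B y\<bar> \<le> C2 * C3 * N\<^sup>2 * psi y"
    unfolding abs_mult using mult_mono[OF Ab[of x] Bb[of y]] cc by (simp add: power2_eq_square mult_ac)
  have "\<bar>a' x + b' y + A x * B y\<bar> \<le> T + (C4 * psi y ^ 2 * N\<^sup>2 + T) + C2 * C3 * N\<^sup>2 * psi y"
  proof -
    have "\<bar>b' y\<bar> \<le> C4 * psi y ^ 2 * N\<^sup>2 + T"
      using b'b[OF y] T0 C_nonneg by (auto split: if_splits)
    then show ?thesis using leT[OF x] AB by linarith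
  qed
  also have "\<dots> \<le> C5 * N\<^sup>2 * psi y ^ 2 + (C4 * psi y ^ 2 * N\<^sup>2 + C5 * N\<^sup>2 * psi y ^ 2) + C2 * C3 * N\<^sup>2 * psi y ^ 2"
    using mult_left_mono[OF ps(3) cc(1)] T5 C_nonneg by (intro add_mono mult_left_mono ps cc) auto
  finally have R1: "\<bar>a' x + b' y + A x * B y\<bar> \<le> (2 * C5 + C4 + C2 * C3) * psi y ^ 2 * N\<^sup>2"
    by (simp add: algebra_simps)
  have "\<bar>A x + B y + A x * B y\<bar> \<le> C2 * N + C3 * psi y * N + C2 * C3 * N\<^sup>2 * psi y"
    using Ab[of x] Bb[of y] AB by linarith
  also have "C2 * C3 * N\<^sup>2 * psi y \<le> 2 * C2 * C3 * N * psi y"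
    using mult_left_mono[OF N2, of "C2 * C3 * N * psi y"] C_nonneg N0 psi_pos[of y]
    by (simp add: power2_eq_square mult_ac)
  also have "C2 * N + C3 * psi y * N + 2 * C2 * C3 * N * psi y
      \<le> C2 * N * psi y ^ 2 + C3 * N * psi y ^ 2 + 2 * C2 * C3 * N * psi y ^ 2"
    using mult_left_mono[OF ps(3) cc(3)] mult_left_mono[OF ps(2) cc(4)] mult_left_mono[OF ps(2) cc(5)]
    by (simp add: mult_ac)
  finally have R2: "\<bar>A x + B y + A x * B y\<bar> \<le> (C2 + C3 + 2 * C2 * C3) * psi y ^ 2 * N"
    by (simp add: algebra_simps)
  have pp: "p' x y = p x y * ((1 + A x) * (1 + B y))"
    using D(3)[of x] D(6)[of y] by (simp add: p'_def p_def A_def B_def field_simps)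
  have "pmf r' x * p' x y - pmf r x * p x y - (h x * p x y + pmf r x * p x y * (al x + be y))
      = pmf r x * (p x y * (a' x + b' y + A x * B y)) + h x * (p x y * (A x + B y + A x * B y))"
    unfolding pp a'_def b'_def h_def by (simp add: algebra_simps)
  also have "\<bar>\<dots>\<bar> \<le> pmf r x * (p x y * \<bar>a' x + b' y + A x * B y\<bar>) + \<bar>h x\<bar> * (p x y * \<bar>A x + B y + A x * B y\<bar>)"
    using p0[of x y] by (intro order_trans[OF abs_triangle_ineq]) (simp add: abs_mult)
  also have "\<dots> \<le> pmf r x * ((Umax * psi y) * ((2 * C5 + C4 + C2 * C3) * psi y ^ 2 * N\<^sup>2))
      + \<bar>h x\<bar> * ((Umax * psi y) * ((C2 + C3 + 2 * C2 * C3) * psi y ^ 2 * N))"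
    using pU[of x y] p0[of x y] Umax_pos psi_pos[of y]
    by (intro add_mono mult_left_mono mult_mono R1 R2) auto
  also have "\<dots> = psi y ^ 3 * (Umax * (2 * C5 + C4 + C2 * C3) * (pmf r x * N\<^sup>2)
      + Umax * (C2 + C3 + 2 * C2 * C3) * (\<bar>h x\<bar> * N))"
    by (simp add: power2_eq_square power3_eq_cube algebra_simps)
  also have "\<dots> \<le> psi y ^ 3 * (C6 * (pmf r x * N\<^sup>2) + C6 * (\<bar>h x\<bar> * N))"
    using C_nonneg Umax_pos N0 psi_pos[of y]
    by (intro mult_left_mono add_mono mult_right_mono) (auto simp: C6_def)
  finally show ?thesis by (simp add: algebra_simps)
qed

end

section \<open>The entropic plan is the scaled plan\<close>

lemma infsum_pair_coord:
  fixes f :: "'a \<times> 'b \<Rightarrow> real"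
  assumes "f summable_on UNIV"
  shows "(\<lambda>y. f (x, y)) summable_on UNIV" "(\<lambda>x. \<Sum>\<^sub>\<infinity>y. f (x, y)) summable_on UNIV"
    "infsum f UNIV = (\<Sum>\<^sub>\<infinity>x. \<Sum>\<^sub>\<infinity>y. f (x, y))"
    "(\<lambda>x. f (x, y)) summable_on UNIV"
    "infsum f UNIV = (\<Sum>\<^sub>\<infinity>y. \<Sum>\<^sub>\<infinity>x. f (x, y))"
proof -
  have 1: "(\<lambda>(x, y). f (x, y)) summable_on Sigma UNIV (\<lambda>_. UNIV)" using assms by simp
  have inj: "inj (Pair x)" for x :: 'a by (auto intro: injI)
  have inj': "inj (\<lambda>x. (x, y))" for y :: 'b by (auto intro: injI)
  have sub: "f summable_on A" for A using summable_on_subset_banach[OF assms] by blast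
  show "(\<lambda>y. f (x, y)) summable_on UNIV"
    using summable_on_reindex[OF inj[of x], of f] sub by (simp add: o_def)
  show "(\<lambda>x. f (x, y)) summable_on UNIV"
    using summable_on_reindex[OF inj'[of y], of f] sub by (simp add: o_def)
  show "(\<lambda>x. \<Sum>\<^sub>\<infinity>y. f (x, y)) summable_on UNIV"
    by (rule summable_on_Sigma_banach[OF 1])
  show 2: "infsum f UNIV = (\<Sum>\<^sub>\<infinity>x. \<Sum>\<^sub>\<infinity>y. f (x, y))"
    using infsum_Sigma'_banach[OF 1] by simp
  show "infsum f UNIV = (\<Sum>\<^sub>\<infinity>y. \<Sum>\<^sub>\<infinity>x. f (x, y))"
    unfolding 2 by (rule infsum_swap_banach) (use 1 in simp)
qed

lemma pmf_map_fst_infsum: "pmf (map_pmf fst p) x = (\<Sum>\<^sub>\<infinity>y. pmf p (x, y))"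
proof -
  have "pmf (map_pmf fst p) x = (\<integral>z. indicator {z. fst z = x} z \<partial>measure_pmf p)"
    by (simp add: pmf_map vimage_def)
  also have "\<dots> = (\<Sum>\<^sub>\<infinity>z. if fst z = x then pmf p z else 0)"
    unfolding integral_measure_pmf_infsum by (rule infsum_cong) (auto simp: indicator_def)
  also have "\<dots> = (\<Sum>\<^sub>\<infinity>z\<in>Pair x ` UNIV. pmf p z)"
    by (rule infsum_cong_neutral) (auto simp: image_iff)
  also have "\<dots> = (\<Sum>\<^sub>\<infinity>y. pmf p (x, y))"
    by (subst infsum_reindex) (auto intro: injI simp: o_def)
  finally show ?thesis .
qed

lemma pmf_map_snd_infsum: "pmf (map_pmf snd p) y = (\<Sum>\<^sub>\<infinity>x. pmf p (x, y))"
proof -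
  have "pmf (map_pmf snd p) y = (\<integral>z. indicator {z. snd z = y} z \<partial>measure_pmf p)"
    by (simp add: pmf_map vimage_def)
  also have "\<dots> = (\<Sum>\<^sub>\<infinity>z. if snd z = y then pmf p z else 0)"
    unfolding integral_measure_pmf_infsum by (rule infsum_cong) (auto simp: indicator_def)
  also have "\<dots> = (\<Sum>\<^sub>\<infinity>z\<in>(\<lambda>x. (x, y)) ` UNIV. pmf p z)"
    by (rule infsum_cong_neutral) (auto simp: image_iff)
  also have "\<dots> = (\<Sum>\<^sub>\<infinity>x. pmf p (x, y))"
    by (subst infsum_reindex) (auto intro: injI simp: o_def)
  finally show ?thesis .
qed

lemma pmf_embed_infsum:
  fixes f :: "'a \<Rightarrow> real"
  assumes "\<And>x. 0 \<le> f x" "f summable_on UNIV" "infsum f UNIV = 1"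
  shows "pmf (embed_pmf f) x = f x"
proof (rule pmf_embed_pmf)
  have "(\<integral>\<^sup>+x. ennreal (f x) \<partial>count_space UNIV) = ennreal (\<integral>x. f x \<partial>count_space UNIV)"
    by (rule nn_integral_eq_integral) (use assms in \<open>auto simp: summable_on_iff_integrable_count_space\<close>)
  then show "(\<integral>\<^sup>+x. ennreal (f x) \<partial>count_space UNIV) = 1"
    using assms(3) by (simp add: infsum_eq_integral_count_space)
qed (use assms in auto)

text \<open>This is \<open>ln t \<le> t - 1\<close> at \<open>t = q / p\<close>, with its equality
  case \<open>t = 1\<close>. Working termwise avoids comparing possibly divergent sums, and
  \<open>p = 0\<close> is covered since the left-hand side is then \<open>- q\<close>.\<close>

lemma gibbs_term:
  fixes p q :: real
  assumes "0 \<le> p" "0 < q"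
  shows "p - q \<le> p * ln (p / q)" "p * ln (p / q) = p - q \<Longrightarrow> p = q"
proof -
  show "p - q \<le> p * ln (p / q)"
  proof (cases "p = 0")
    case False
    then have p: "0 < p" using assms by simp
    have "ln (q / p) \<le> q / p - 1" using p assms by (intro ln_le_minus_one) simp
    then have "p * ln (q / p) \<le> p * (q / p - 1)" using p by (intro mult_left_mono) auto
    moreover have "ln (q / p) = - ln (p / q)" using p assms by (simp add: ln_div)
    ultimately show ?thesis using p by (simp add: right_diff_distrib)
  qed (use assms in simp)
  assume e: "p * ln (p / q) = p - q"
  show "p = q"
  proof (cases "p = 0")
    case False
    then have p: "0 < p" using assms by simp
    have "ln (q / p) = - ln (p / q)" using p assms by (simp add: ln_div)
    then have "p * ln (q / p) = p * (q / p - 1)" using e p by (simp add: right_diff_distrib)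
    then have "ln (q / p) = q / p - 1" using p by simp
    then have "q / p = 1" using p assms by (intro ln_eq_minus_one) auto
    then show ?thesis using p by simp
  qed (use e assms in simp)
qed

lemma pmf_le_pmf_map: "pmf p z \<le> pmf (map_pmf f p) (f z)"
proof -
  have "measure (measure_pmf p) {z} \<le> measure (measure_pmf p) (f -` {f z})"
    by (rule measure_pmf.finite_measure_mono) auto
  then show ?thesis by (simp add: pmf_map measure_pmf_single)
qed

section \<open>The Gibbs kernel of the cost and optimality of its scaled plan\<close>

locale erot_problem =
  fixes c :: "'x::countable \<times> 'y::countable \<Rightarrow> real" and cXm cXp :: "'x \<Rightarrow> real" and cYm cYp :: "'y \<Rightarrow> real"
    and lam :: real and s :: "'y pmf" and y1 :: 'y and Kx :: real
  assumes lam_pos: "lam > 0"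
    and dom: "dominating c cXm cXp cYm cYp"
    and Kx: "\<And>x. cXp x - cXm x \<le> Kx"
    and s_moment: "(\<lambda>y. cost_weight cYm cYp y * exp_weight lam cYm cYp y ^ 4 * pmf s y) summable_on UNIV"
    and y1_supp: "y1 \<in> set_pmf s"
begin

abbreviation "wX \<equiv> cost_weight cXm cXp"
abbreviation "wY \<equiv> cost_weight cYm cYp"
abbreviation "phi \<equiv> exp_weight lam cYm cYp"
text \<open>The shift by the lower dominating functions makes the kernel at most 1 and is undone in
  the potentials. The upper dominating functions bound it below by the inverse of
  \<open>psi y\<close>, where \<open>Kx\<close> replaces the dependence on \<open>x\<close> by a
  constant.\<close>

definition "kern x y = exp (- (c (x, y) - cXm x - cYm y) / lam)"
definition "psi y = exp (Kx / lam) * phi y"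

lemma domD: "cXm x \<le> cXp x" "cYm y \<le> cYp y" "cXm x + cYm y \<le> c (x, y)" "c (x, y) \<le> cXp x + cYp y"
  using dom by (auto simp: dominating_def)

lemma wX_ge1: "1 \<le> wX x" and wY_ge1: "1 \<le> wY y" by (auto simp: cost_weight_def)

lemma abs_c_le: "\<bar>c z\<bar> \<le> wX (fst z) + wY (snd z)"
  using domD(3,4)[of "fst z" "snd z"] by (auto simp: cost_weight_def abs_le_iff)

lemma Kx_nonneg: "0 \<le> Kx" using Kx[of undefined] domD(1)[of undefined] by linarith

lemma phi_ge1: "1 \<le> phi y" using domD(2) lam_pos by (simp add: exp_weight_def)

lemma psi_ge_phi: "phi y \<le> psi y"
  using phi_ge1[of y] Kx_nonneg lam_pos mult_right_mono[of 1 "exp (Kx / lam)" "phi y"] by (simp add: psi_def)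

lemma wY_psi4: "integrable (measure_pmf s) (\<lambda>y. wY y * psi y ^ 4)"
  using summable_on_cmult_right[OF s_moment, of "exp (Kx / lam) ^ 4"]
  by (simp add: integrable_measure_pmf_iff_summable_on psi_def power_mult_distrib mult_ac)

lemma kernel_props: "kern x y \<le> 1" "1 / psi y \<le> kern x y"
proof -
  show "kern x y \<le> 1" using domD(3)[of x y] lam_pos by (simp add: kern_def divide_nonpos_pos)
  have "psi y = exp ((Kx + (cYp y - cYm y)) / lam)"
    by (simp add: psi_def exp_weight_def exp_add[symmetric] add_divide_distrib)
  then have "1 / psi y = exp (- (Kx + (cYp y - cYm y)) / lam)"
    unfolding minus_divide_left[symmetric] exp_minus by (simp add: divide_inverse)
  also have "\<dots> \<le> kern x y"
    unfolding kern_def using domD(4)[of x y] Kx[of x] lam_pos by (simp add: divide_right_mono)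
  finally show "1 / psi y \<le> kern x y" .
qed

sublocale sinkhorn_kernel kern s psi y1
proof
  show "1 \<le> psi y" for y using phi_ge1[of y] psi_ge_phi[of y] by linarith
  then have p4: "0 \<le> psi y ^ 4" for y by (metis zero_le_power order_trans zero_le_one)
  show "integrable (measure_pmf s) (\<lambda>y. psi y ^ 4)"
  proof (rule pmf_integrable_bound[OF wY_psi4])
    fix y show "\<bar>psi y ^ 4\<bar> \<le> wY y * psi y ^ 4"
      using p4[of y] wY_ge1[of y] mult_right_mono[of 1 "wY y" "psi y ^ 4"] by simp
  qed
qed (use kernel_props y1_supp in auto)

lemma wY_psi_power:
  assumes "j \<le> 4"
  shows "integrable (measure_pmf s) (\<lambda>y. wY y * psi y ^ j)"
proof (rule pmf_integrable_bound[OF wY_psi4])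
  fix y
  have "psi y ^ j \<le> psi y ^ 4" by (rule power_increasing[OF assms psi_ge1])
  then show "\<bar>wY y * psi y ^ j\<bar> \<le> wY y * psi y ^ 4"
    using wY_ge1[of y] psi_pos[of y] by (simp add: abs_mult)
qed

lemma coupling_le:
  assumes "(p :: ('x \<times> 'y) pmf) \<in> couplings r s"
  shows "pmf p (x, y) \<le> pmf r x" "pmf p (x, y) \<le> pmf s y"
proof -
  have m: "map_pmf fst p = r" "map_pmf snd p = s" using assms by (auto simp: couplings_def)
  show "pmf p (x, y) \<le> pmf r x" "pmf p (x, y) \<le> pmf s y"
    using pmf_le_pmf_map[of p "(x, y)" fst] pmf_le_pmf_map[of p "(x, y)" snd] m by auto
qed

lemma coupling_integrable:
  fixes F :: "'x \<Rightarrow> real" and H :: "'y \<Rightarrow> real"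
  assumes "p \<in> couplings r s" "integrable (measure_pmf r) F" "integrable (measure_pmf s) H"
  shows "integrable (measure_pmf p) (\<lambda>z. F (fst z) + H (snd z))"
    "(\<integral>z. F (fst z) + H (snd z) \<partial>measure_pmf p) = (\<integral>x. F x \<partial>measure_pmf r) + (\<integral>y. H y \<partial>measure_pmf s)"
proof -
  have m: "r = map_pmf fst p" "s = map_pmf snd p" using assms by (auto simp: couplings_def)
  have i: "integrable (measure_pmf p) (\<lambda>z. F (fst z))" "integrable (measure_pmf p) (\<lambda>z. H (snd z))"
    using assms(2,3) unfolding m by simp_all
  then show "integrable (measure_pmf p) (\<lambda>z. F (fst z) + H (snd z))" by simp
  show "(\<integral>z. F (fst z) + H (snd z) \<partial>measure_pmf p) = (\<integral>x. F x \<partial>measure_pmf r) + (\<integral>y. H y \<partial>measure_pmf s)"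
    using Bochner_Integration.integral_add[OF i] unfolding m by simp
qed

lemma wY_integrable: "integrable (measure_pmf s) wY"
  using wY_psi_power[of 0] by simp

definition dens :: "('x \<Rightarrow> real) \<Rightarrow> ('y \<Rightarrow> real) \<Rightarrow> 'x \<times> 'y \<Rightarrow> real" where
  "dens u w = (\<lambda>(x, y). u x * kern x y * w y)"

definition scaled_plan :: "'x pmf \<Rightarrow> ('x \<Rightarrow> real) \<Rightarrow> ('y \<Rightarrow> real) \<Rightarrow> ('x \<times> 'y) pmf" where
  "scaled_plan r u w = embed_pmf (\<lambda>(x, y). pmf r x * pmf s y * dens u w (x, y))"

lemma scaled_plan:
  assumes S: "is_scaling r u w"
  shows "pmf (scaled_plan r u w) (x, y) = pmf r x * pmf s y * dens u w (x, y)"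
    and "scaled_plan r u w \<in> couplings r s"
proof -
  let ?f = "\<lambda>(x, y). pmf r x * pmf s y * dens u w (x, y)"
  have p0: "0 < dens u w (x, y)" "dens u w (x, y) \<le> Umax * psi y" for x y
    using density_bounds(1,2)[OF S, of x y] by (auto simp: dens_def)
  have sm: "?f summable_on UNIV"
  proof (rule summable_on_real_bound)
    show "(\<lambda>(x, y). pmf r x * (Umax * (pmf s y * psi y))) summable_on UNIV"
      using psi_integrable
      by (intro summable_on_times pmf_summable summable_on_cmult_right)
         (simp add: integrable_measure_pmf_iff_summable_on)
    show "\<bar>?f z\<bar> \<le> (case z of (x, y) \<Rightarrow> pmf r x * (Umax * (pmf s y * psi y)))" for z
    proof (cases z)
      case (Pair x y)
      have "pmf r x * pmf s y * dens u w (x, y) \<le> pmf r x * pmf s y * (Umax * psi y)"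
        by (intro mult_left_mono p0) auto
      then show ?thesis using Pair p0(1)[of x y] by (simp add: mult_ac abs_mult)
    qed
  qed
  have row: "(\<Sum>\<^sub>\<infinity>y. ?f (x, y)) = pmf r x" for x
  proof -
    have "(\<Sum>\<^sub>\<infinity>y. pmf s y * dens u w (x, y)) = 1"
      using density_integrable(2)[OF S, of x] by (simp only: integral_measure_pmf_infsum dens_def split_conv)
    then show ?thesis by (simp add: infsum_cmult_right' mult.assoc)
  qed
  have col: "(\<Sum>\<^sub>\<infinity>x. ?f (x, y)) = pmf s y" for y
  proof -
    have "(\<Sum>\<^sub>\<infinity>x. ?f (x, y)) = (\<Sum>\<^sub>\<infinity>x. pmf s y * (pmf r x * dens u w (x, y)))"
      by (simp add: mult_ac)
    moreover have "(\<Sum>\<^sub>\<infinity>x. pmf r x * dens u w (x, y)) = 1"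
      using density_integrable(4)[OF S, of y] by (simp only: integral_measure_pmf_infsum dens_def split_conv)
    ultimately show ?thesis by (simp add: infsum_cmult_right')
  qed
  have "infsum ?f UNIV = 1"
    unfolding infsum_pair_coord(3)[OF sm] row by (rule infsum_pmf)
  then have pm: "pmf (scaled_plan r u w) z = ?f z" for z
    unfolding scaled_plan_def using sm p0(1)
    by (intro pmf_embed_infsum) (auto intro!: mult_nonneg_nonneg less_imp_le[OF p0(1)])
  then show "pmf (scaled_plan r u w) (x, y) = pmf r x * pmf s y * dens u w (x, y)" by simp
  show "scaled_plan r u w \<in> couplings r s"
    unfolding couplings_def using row col
    by (auto intro!: pmf_eqI simp: pmf_map_fst_infsum pmf_map_snd_infsum pm)
qed

text \<open>\<open>F\<close> and \<open>H\<close> are the Schroedinger potentials. The identity for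
  \<open>c\<close> says that the logarithm of the density splits into marginal functions minus
  \<open>c / lam\<close>; as \<open>F\<close> and \<open>H\<close> are integrable for the marginals,
  it is summable against every coupling, with a constant contribution from \<open>F\<close> and
  \<open>H\<close>.\<close>

lemma potentials:
  assumes S: "is_scaling r u w" and r: "integrable (measure_pmf r) wX"
  defines "F \<equiv> \<lambda>x. lam * ln (u x) + cXm x" and "H \<equiv> \<lambda>y. lam * ln (w y) + cYm y"
  shows "integrable (measure_pmf r) F" "integrable (measure_pmf s) H"
    "c (x, y) = F x + H y - lam * ln (dens u w (x, y))"
proof -
  note D = scalingD[OF S]
  show "integrable (measure_pmf r) F"
  proof (rule pmf_integrable_bound)
    show "integrable (measure_pmf r) (\<lambda>x. lam * (\<bar>ln Umin\<bar> + \<bar>ln Umax\<bar>) + wX x)" using r by simp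
    fix x
    have "\<bar>ln (u x)\<bar> \<le> \<bar>ln Umin\<bar> + \<bar>ln Umax\<bar>"
      using ln_le_cancel_iff[of Umin "u x"] ln_le_cancel_iff[of "u x" Umax] D(1-3)[of x] Umin_pos Umax_pos
      by linarith
    then have "lam * \<bar>ln (u x)\<bar> \<le> lam * (\<bar>ln Umin\<bar> + \<bar>ln Umax\<bar>)" using lam_pos by simp
    moreover have "\<bar>F x\<bar> \<le> lam * \<bar>ln (u x)\<bar> + \<bar>cXm x\<bar>"
      unfolding F_def using lam_pos by (intro order_trans[OF abs_triangle_ineq]) (simp add: abs_mult)
    ultimately show "\<bar>F x\<bar> \<le> lam * (\<bar>ln Umin\<bar> + \<bar>ln Umax\<bar>) + wX x"
      using abs_ge_zero[of "cXp x"] unfolding cost_weight_def by linarith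
  qed
  show "integrable (measure_pmf s) H"
  proof (rule pmf_integrable_bound)
    show "integrable (measure_pmf s) (\<lambda>y. lam * \<bar>ln Umax\<bar> + Kx + 2 * wY y)" using wY_integrable by simp
    fix y
    have "ln (psi y) = (Kx + (cYp y - cYm y)) / lam"
      by (simp add: psi_def exp_weight_def ln_mult add_divide_distrib)
    moreover have "\<bar>ln (w y)\<bar> \<le> \<bar>ln Umax\<bar> + \<bar>ln (psi y)\<bar>"
    proof -
      have "ln (1 / Umax) \<le> ln (w y)" "ln (w y) \<le> ln (psi y)"
        using D(4-6)[of y] Umax_pos psi_pos[of y] by (auto intro!: ln_mono)
      moreover have "ln (1 / Umax) = - ln Umax" using Umax_pos by (simp add: ln_div)
      ultimately show ?thesis by linarith
    qed
    ultimately have "lam * \<bar>ln (w y)\<bar> \<le> lam * (\<bar>ln Umax\<bar> + (Kx + (cYp y - cYm y)) / lam)"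
      using lam_pos Kx_nonneg domD(2)[of y] by (intro mult_left_mono) auto
    also have "\<dots> = lam * \<bar>ln Umax\<bar> + (Kx + (cYp y - cYm y))"
      using lam_pos nonzero_mult_div_cancel_left[of lam "Kx + (cYp y - cYm y)"]
      unfolding distrib_left[of lam "\<bar>ln Umax\<bar>"] times_divide_eq_right by simp
    finally have "lam * \<bar>ln (w y)\<bar> \<le> lam * \<bar>ln Umax\<bar> + (Kx + (cYp y - cYm y))" .
    moreover have "\<bar>H y\<bar> \<le> lam * \<bar>ln (w y)\<bar> + \<bar>cYm y\<bar>"
      unfolding H_def using lam_pos by (intro order_trans[OF abs_triangle_ineq]) (simp add: abs_mult)
    ultimately have "\<bar>H y\<bar> \<le> lam * \<bar>ln Umax\<bar> + Kx + (2 * 1 + 2 * \<bar>cYp y\<bar> + 2 * \<bar>cYm y\<bar>)"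
      by linarith
    then show "\<bar>H y\<bar> \<le> lam * \<bar>ln Umax\<bar> + Kx + 2 * wY y"
      unfolding cost_weight_def distrib_left .
  qed
  have "ln (dens u w (x, y)) = ln (u x) + ln (w y) - (c (x, y) - cXm x - cYm y) / lam"
    using D(3)[of x] D(6)[of y] by (simp add: dens_def kern_def ln_mult diff_divide_distrib)
  then show "c (x, y) = F x + H y - lam * ln (dens u w (x, y))"
    using lam_pos by (simp add: F_def H_def field_simps)
qed

lemma c_integrable:
  assumes "p \<in> couplings r s" "integrable (measure_pmf r) wX"
  shows "integrable (measure_pmf p) c"
  by (rule pmf_integrable_bound[OF coupling_integrable(1)[OF assms wY_integrable]]) (rule abs_c_le)

lemma transport_cost_integral: "transport_cost c p = (\<integral>z. c z \<partial>measure_pmf p)"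
  by (simp add: transport_cost_def integral_measure_pmf_infsum mult.commute)

text \<open>On couplings the objective is the relative entropy with respect to the scaled plan, up to the
  factor \<open>lam\<close> and an additive constant.\<close>

lemma erot_objective_eq:
  assumes S: "is_scaling r u w" and r: "integrable (measure_pmf r) wX" and p: "p \<in> couplings r s"
  defines "m \<equiv> \<lambda>(x, y). pmf p (x, y) * ln (pmf p (x, y) / (pmf r x * pmf s y))"
  defines "E \<equiv> (\<integral>x. lam * ln (u x) + cXm x \<partial>measure_pmf r) + (\<integral>y. lam * ln (w y) + cYm y \<partial>measure_pmf s)"
  defines "g \<equiv> \<lambda>z. m z - pmf p z * ln (dens u w z)"
  shows "m summable_on UNIV \<Longrightarrow> g summable_on UNIV"
    and "m summable_on UNIV \<Longrightarrow> erot_objective c lam r s p = ereal (E + lam * infsum g UNIV)"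
    and "\<not> m summable_on UNIV \<Longrightarrow> erot_objective c lam r s p = \<infinity>"
    and "pmf p z - pmf (scaled_plan r u w) z \<le> g z"
    and "g z = pmf p z - pmf (scaled_plan r u w) z \<Longrightarrow> pmf p z = pmf (scaled_plan r u w) z"
proof -
  let ?F = "\<lambda>x. lam * ln (u x) + cXm x" and ?H = "\<lambda>y. lam * ln (w y) + cYm y"
  note P = potentials[OF S r]
  have FH: "(\<lambda>z. pmf p z * (?F (fst z) + ?H (snd z))) summable_on UNIV"
    "(\<Sum>\<^sub>\<infinity>z. pmf p z * (?F (fst z) + ?H (snd z))) = E"
    using coupling_integrable[OF p P(1,2)]
    by (auto simp: integrable_measure_pmf_iff_summable_on integral_measure_pmf_infsum E_def)
  have cs: "(\<lambda>z. pmf p z * c z) summable_on UNIV"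
    using c_integrable[OF p r] by (simp add: integrable_measure_pmf_iff_summable_on)
  have ln_eq: "pmf p z * ln (dens u w z) = (pmf p z * (?F (fst z) + ?H (snd z)) - pmf p z * c z) / lam" for z
  proof -
    have "c z = ?F (fst z) + ?H (snd z) - lam * ln (dens u w z)" using P(3)[of "fst z" "snd z"] by simp
    then have "pmf p z * (?F (fst z) + ?H (snd z)) - pmf p z * c z = lam * (pmf p z * ln (dens u w z))"
      by (simp only: right_diff_distrib) (simp add: algebra_simps)
    then show ?thesis using lam_pos by simp
  qed
  have lns: "(\<lambda>z. pmf p z * ln (dens u w z)) summable_on UNIV"
    unfolding ln_eq divide_inverse by (intro summable_on_cmult_left summable_on_real_diff FH cs)
  have lnS: "lam * (\<Sum>\<^sub>\<infinity>z. pmf p z * ln (dens u w z)) = E - (\<Sum>\<^sub>\<infinity>z. pmf p z * c z)"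
    unfolding ln_eq divide_inverse infsum_cmult_left' infsum_real_diff[OF FH(1) cs] FH(2) using lam_pos by simp
  have mi: "mutual_info r s p = (if m summable_on UNIV then ereal (infsum m UNIV) else \<infinity>)"
    by (simp add: mutual_info_def m_def Let_def)
  show gs: "g summable_on UNIV" if "m summable_on UNIV"
    unfolding g_def by (rule summable_on_real_diff[OF that lns])
  show "erot_objective c lam r s p = ereal (E + lam * infsum g UNIV)" if "m summable_on UNIV"
    using that lnS unfolding erot_objective_def mi g_def infsum_real_diff[OF that lns]
    by (simp add: transport_cost_integral integral_measure_pmf_infsum right_diff_distrib)
  show "erot_objective c lam r s p = \<infinity>" if "\<not> m summable_on UNIV"
    using that lam_pos unfolding erot_objective_def mi by simp
  obtain x y where z: "z = (x, y)" by (cases z)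
  have d0: "0 < dens u w (x, y)" using density_bounds(1)[OF S] by (simp add: dens_def)
  have "(g z = pmf p z - pmf (scaled_plan r u w) z \<longrightarrow> pmf p z = pmf (scaled_plan r u w) z)
    \<and> pmf p z - pmf (scaled_plan r u w) z \<le> g z"
  proof (cases "0 < pmf r x * pmf s y")
    case True
    then have "g z = pmf p z * ln (pmf p z / pmf (scaled_plan r u w) z)"
      using d0 unfolding g_def m_def z scaled_plan(1)[OF S]
      by (cases "pmf p (x, y) = 0") (auto simp: ln_div ln_mult less_le algebra_simps)
    moreover have "0 < pmf (scaled_plan r u w) z" using True d0 unfolding z scaled_plan(1)[OF S] by simp
    ultimately show ?thesis using gibbs_term[of "pmf p z" "pmf (scaled_plan r u w) z"] by simp
  next
    \<comment> \<open>Off the product of the supports a coupling has no mass and neither has the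
      scaled plan, so both sides are \<open>0\<close> whatever the default value of the
      logarithm.\<close>
    case False
    then have "pmf r x = 0 \<or> pmf s y = 0" by (metis mult_pos_pos pmf_nonneg less_le)
    then have "pmf p z = 0" "pmf (scaled_plan r u w) z = 0"
      using coupling_le[OF p, of x y] pmf_nonneg[of p z] unfolding z scaled_plan(1)[OF S] by auto
    then show ?thesis by (simp add: g_def m_def z)
  qed
  then show "pmf p z - pmf (scaled_plan r u w) z \<le> g z"
    and "g z = pmf p z - pmf (scaled_plan r u w) z \<Longrightarrow> pmf p z = pmf (scaled_plan r u w) z"
    by blast+
qed

text \<open>Summing the Gibbs inequality over all points, the lower bounds
  \<open>pmf p z - pmf ?q z\<close> cancel to 0, so \<open>?q\<close> minimises. If a competitor
  reaches the minimum, every termwise inequality is an equality and the two pmfs agree; this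
  uniqueness is what the definite description demands.\<close>

theorem erot_plan_eq:
  assumes S: "is_scaling r u w" and r: "integrable (measure_pmf r) wX"
  shows "erot_plan c lam r s = scaled_plan r u w"
proof -
  let ?q = "scaled_plan r u w"
  have q: "?q \<in> couplings r s" by (rule scaled_plan(2)[OF S])
  define E where "E = (\<integral>x. lam * ln (u x) + cXm x \<partial>measure_pmf r) + (\<integral>y. lam * ln (w y) + cYm y \<partial>measure_pmf s)"
  define m where "m p = (\<lambda>(x, y). pmf p (x, y) * ln (pmf p (x, y) / (pmf r x * pmf s y)))" for p
  define g where "g p = (\<lambda>z. m p z - pmf p z * ln (dens u w z))" for p
  note O = erot_objective_eq[OF S r, folded E_def m_def, folded g_def]
  have g0: "g ?q z = 0" for z
    by (cases z) (auto simp: g_def m_def scaled_plan(1)[OF S])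
  have "(\<lambda>z. pmf ?q z * ln (dens u w z)) summable_on UNIV"
  proof -
    let ?F = "\<lambda>x. lam * ln (u x) + cXm x" and ?H = "\<lambda>y. lam * ln (w y) + cYm y"
    have "integrable (measure_pmf ?q) (\<lambda>z. (?F (fst z) + ?H (snd z) - c z) / lam)"
      using coupling_integrable(1)[OF q potentials(1,2)[OF S r]] c_integrable[OF q r] by simp
    also have "(\<lambda>z. (?F (fst z) + ?H (snd z) - c z) / lam) = (\<lambda>z. ln (dens u w z))"
      using potentials(3)[OF S r] lam_pos by (auto simp: field_simps)
    finally show ?thesis by (simp add: integrable_measure_pmf_iff_summable_on)
  qed
  moreover have "m ?q = (\<lambda>z. pmf ?q z * ln (dens u w z))"
    using g0 by (auto simp: g_def)
  ultimately have mq: "m ?q summable_on UNIV" by simp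
  have oq: "erot_objective c lam r s ?q = ereal E"
    using O(2)[OF q mq] g0 by (simp add: infsum_0)
  have ge: "ereal E \<le> erot_objective c lam r s p \<and> (erot_objective c lam r s p \<le> ereal E \<longrightarrow> p = ?q)"
    if p: "p \<in> couplings r s" for p
  proof (cases "m p summable_on UNIV")
    case True
    have gs: "g p summable_on UNIV" by (rule O(1)[OF p True])
    have ds: "(\<lambda>z. pmf p z - pmf ?q z) summable_on UNIV" by (intro summable_on_real_diff pmf_summable)
    have d0: "(\<Sum>\<^sub>\<infinity>z. pmf p z - pmf ?q z) = 0"
      by (simp add: infsum_real_diff pmf_summable infsum_pmf)
    have g4: "pmf p z - pmf ?q z \<le> g p z" for z
      using O(4)[OF p, of z] by (simp add: g_def)
    have g5: "g p z = pmf p z - pmf ?q z \<Longrightarrow> pmf p z = pmf ?q z" for z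
      using O(5)[OF p, of z] by (simp add: g_def)
    have g: "0 \<le> infsum (g p) UNIV"
      using infsum_mono[OF ds gs g4] d0 by simp
    moreover have "p = ?q" if "infsum (g p) UNIV \<le> 0"
    proof (rule pmf_eqI)
      fix z
      have "(\<Sum>\<^sub>\<infinity>z. g p z - (pmf p z - pmf ?q z)) \<le> 0"
        using that by (simp only: infsum_real_diff[OF gs ds] d0)
      then have "g p z - (pmf p z - pmf ?q z) = 0"
        by (rule nonneg_infsum_le_0D[OF _ summable_on_real_diff[OF gs ds]]) (use g4 in auto)
      then show "pmf p z = pmf ?q z" by (intro g5) simp
    qed
    ultimately show ?thesis using O(2)[OF p True] lam_pos by (auto simp: mult_le_0_iff)
  next
    case False
    then show ?thesis using O(3)[OF p False] by simp
  qed
  show ?thesis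
    unfolding erot_plan_def
  proof (rule the_equality)
    show "is_arg_min (erot_objective c lam r s) (\<lambda>\<pi>. \<pi> \<in> couplings r s) ?q"
      unfolding is_arg_min_def oq using q ge by (auto simp: not_less)
    fix p assume "is_arg_min (erot_objective c lam r s) (\<lambda>\<pi>. \<pi> \<in> couplings r s) p"
    then have "p \<in> couplings r s" "\<not> ereal E < erot_objective c lam r s p"
      unfolding is_arg_min_def using q oq by auto
    then show "p = ?q" using ge[of p] by (simp add: not_less)
  qed
qed

lemma sinkhorn_cost_eq:
  assumes S: "is_scaling r u w" and r: "integrable (measure_pmf r) wX"
  shows "(\<lambda>(x, y). c (x, y) * (pmf r x * pmf s y * dens u w (x, y))) summable_on UNIV"
    and "sinkhorn_cost c lam r s = (\<Sum>\<^sub>\<infinity>(x, y). c (x, y) * (pmf r x * pmf s y * dens u w (x, y)))"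
proof -
  have e: "(\<lambda>(x, y). c (x, y) * (pmf r x * pmf s y * dens u w (x, y))) = (\<lambda>z. pmf (scaled_plan r u w) z * c z)"
    by (auto simp: scaled_plan(1)[OF S])
  show "(\<lambda>(x, y). c (x, y) * (pmf r x * pmf s y * dens u w (x, y))) summable_on UNIV"
    unfolding e using c_integrable[OF scaled_plan(2)[OF S] r] by (simp add: integrable_measure_pmf_iff_summable_on)
  show "sinkhorn_cost c lam r s = (\<Sum>\<^sub>\<infinity>(x, y). c (x, y) * (pmf r x * pmf s y * dens u w (x, y)))"
    unfolding e sinkhorn_cost_def erot_plan_eq[OF S r] transport_cost_integral integral_measure_pmf_infsum ..
qed

end

section \<open>The derivative operator\<close>

lemma linfty_iff:
  assumes "\<And>z. 0 < f z"
  shows "b \<in> linfty f Z \<longleftrightarrow> (\<forall>z. z \<notin> Z \<longrightarrow> b z = 0) \<and> (\<exists>B\<ge>0. \<forall>z. \<bar>b z\<bar> \<le> B * f z)"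
proof
  assume "b \<in> linfty f Z"
  then have z: "\<forall>z. z \<notin> Z \<longrightarrow> b z = 0" and "bdd_above ((\<lambda>z. \<bar>b z\<bar> / f z) ` Z)"
    by (auto simp: linfty_def)
  then obtain B where B: "\<And>z. z \<in> Z \<Longrightarrow> \<bar>b z\<bar> / f z \<le> B" by (auto simp: bdd_above_def)
  have "\<bar>b z\<bar> \<le> \<bar>B\<bar> * f z" for z
  proof (cases "z \<in> Z")
    case True
    then have "\<bar>b z\<bar> \<le> B * f z" using B[OF True] assms[of z] by (simp add: field_simps)
    also have "\<dots> \<le> \<bar>B\<bar> * f z" using assms[of z] by (intro mult_right_mono) auto
    finally show ?thesis .
  next
    case False
    then show ?thesis using z assms[of z] by simp
  qed
  then show "(\<forall>z. z \<notin> Z \<longrightarrow> b z = 0) \<and> (\<exists>B\<ge>0. \<forall>z. \<bar>b z\<bar> \<le> B * f z)"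
    using z by (intro conjI exI[of _ "\<bar>B\<bar>"]) auto
next
  assume "(\<forall>z. z \<notin> Z \<longrightarrow> b z = 0) \<and> (\<exists>B\<ge>0. \<forall>z. \<bar>b z\<bar> \<le> B * f z)"
  then obtain B where "\<forall>z. z \<notin> Z \<longrightarrow> b z = 0" "\<forall>z. \<bar>b z\<bar> \<le> B * f z" by blast
  then show "b \<in> linfty f Z"
    using assms unfolding linfty_def by (auto intro!: bdd_aboveI[where M=B] simp: divide_le_eq)
qed

text \<open>The Neumann series in elementary form: Picard iterates of
  \<open>f \<mapsto> v + T f\<close> from 0 have geometrically decreasing increments, converge
  uniformly by the Weierstrass test, and the contraction bound makes \<open>T\<close> continuous
  along them.\<close>

lemma Id_minus_contraction_surj:
  fixes T :: "('a \<Rightarrow> real) \<Rightarrow> 'a \<Rightarrow> real" and Z :: "'a set"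
  defines "V \<equiv> linfty (\<lambda>_. 1) Z"
  assumes zero: "\<And>f x. x \<notin> Z \<Longrightarrow> T f x = 0"
    and diff: "\<And>f g x. f \<in> V \<Longrightarrow> g \<in> V \<Longrightarrow> T (\<lambda>x. f x - g x) x = T f x - T g x"
    and contr: "\<And>f B x. f \<in> V \<Longrightarrow> (\<And>x. \<bar>f x\<bar> \<le> B) \<Longrightarrow> \<bar>T f x\<bar> \<le> q * B"
    and q: "0 \<le> q" "q < 1" and v: "v \<in> V" "\<And>x. \<bar>v x\<bar> \<le> B"
  shows "\<exists>a\<in>V. (\<forall>x. a x - T a x = v x) \<and> (\<forall>x. \<bar>a x\<bar> \<le> B / (1 - q))"
proof -
  have V: "f \<in> V \<longleftrightarrow> (\<forall>z. z \<notin> Z \<longrightarrow> f z = 0) \<and> (\<exists>B\<ge>0. \<forall>z. \<bar>f z\<bar> \<le> B)" for f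
    unfolding V_def by (subst linfty_iff) auto
  have VI: "f \<in> V" if "\<And>z. z \<notin> Z \<Longrightarrow> f z = 0" "\<And>z. \<bar>f z\<bar> \<le> B'" for f B'
    unfolding V using that order_trans[OF abs_ge_zero that(2)] by blast
  have vz: "v x = 0" if "x \<notin> Z" for x using v(1) that by (simp add: V)
  \<comment> \<open>Chosen so that \<open>B + q * C = C\<close>: the ball of radius \<open>C\<close>
    is mapped into itself by the iteration.\<close>
  define C where "C = B / (1 - q)"
  have C: "B + q * C = C" using q by (simp add: C_def field_simps)
  have B0: "0 \<le> B" using order_trans[OF abs_ge_zero v(2)] by blast
  have C0: "0 \<le> C" using B0 q by (simp add: C_def)
  define F where "F = rec_nat (\<lambda>_. 0) (\<lambda>_ f x. v x + T f x)"
  have F0: "F 0 = (\<lambda>_. 0)" and FS: "F (Suc n) = (\<lambda>x. v x + T (F n) x)" for n by (auto simp: F_def)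
  have FV: "F n \<in> V \<and> (\<forall>x. \<bar>F n x\<bar> \<le> C)" for n
  proof (induction n)
    case 0
    show ?case using VI[of "\<lambda>_. 0" 0] C0 by (simp add: F0)
  next
    case (Suc n)
    have "\<bar>F (Suc n) x\<bar> \<le> C" for x
      using contr[of "F n" C x] Suc v(2)[of x] C by (auto simp: FS abs_le_iff)
    moreover have "F (Suc n) x = 0" if "x \<notin> Z" for x using that zero vz by (simp add: FS)
    ultimately show ?case using VI by blast
  qed
  have step: "\<bar>F (Suc n) x - F n x\<bar> \<le> q ^ n * B" for n x
  proof (induction n arbitrary: x)
    case 0
    have "\<bar>T (\<lambda>_. 0) x\<bar> \<le> q * 0" by (rule contr) (auto intro: VI[where B'=0])
    then show ?case using v(2)[of x] by (simp add: F0 FS)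
  next
    case (Suc n)
    have "F (Suc (Suc n)) x - F (Suc n) x = T (F (Suc n)) x - T (F n) x"
      by (simp add: FS[of "Suc n"]) (simp add: FS[of n])
    also have "\<dots> = T (\<lambda>x. F (Suc n) x - F n x) x"
      by (rule diff[symmetric]) (use FV in auto)
    also have "\<bar>\<dots>\<bar> \<le> q * (q ^ n * B)"
      by (rule contr[OF VI[where B'="q ^ n * B"]]) (use Suc FV in \<open>auto simp: V\<close>)
    finally show ?case by simp
  qed
  define a where "a x = (\<Sum>i. F (Suc i) x - F i x)" for x
  have "uniform_limit UNIV (\<lambda>n x. \<Sum>i<n. F (Suc i) x - F i x) a sequentially"
    unfolding a_def
    by (rule Weierstrass_m_test[where M="\<lambda>n. q ^ n * B"])
       (use step q in \<open>auto intro!: summable_mult2 summable_geometric\<close>)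
  moreover have "(\<lambda>n x. \<Sum>i<n. F (Suc i) x - F i x) = F"
    using sum_lessThan_telescope[of "\<lambda>i. F i x" n for n x] by (simp add: F0 fun_eq_iff)
  ultimately have ul: "uniform_limit UNIV F a sequentially" by simp
  then have lim: "(\<lambda>n. F n x) \<longlonglongrightarrow> a x" for x
    by (rule tendsto_uniform_limitI) simp
  have aC: "\<bar>a x\<bar> \<le> C" for x
    by (rule LIMSEQ_le_const2[OF tendsto_rabs[OF lim]]) (use FV in auto)
  have az: "a x = 0" if "x \<notin> Z" for x
    using LIMSEQ_unique[OF lim[of x], of 0] FV that by (simp add: V)
  have aV: "a \<in> V" using VI aC az by blast
  have "(\<lambda>n. T (F n) x) \<longlonglongrightarrow> T a x" for x
  proof (rule LIMSEQ_I)
    fix e :: real assume e: "0 < e"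
    from uniform_limitD[OF ul this] obtain N where N: "\<And>n x. n \<ge> N \<Longrightarrow> dist (F n x) (a x) < e"
      by (auto simp: eventually_sequentially)
    have "norm (T (F n) x - T a x) < e" if "n \<ge> N" for n
    proof -
      have "T (F n) x - T a x = T (\<lambda>x. F n x - a x) x"
        by (rule diff[symmetric]) (use FV aV in auto)
      also have "\<bar>\<dots>\<bar> \<le> q * e"
        using N[OF that] by (intro contr VI[where B'=e]) (use FV aV in \<open>auto simp: V dist_real_def less_imp_le\<close>)
      also have "\<dots> < e" using q e by simp
      finally show ?thesis by simp
    qed
    then show "\<exists>no. \<forall>n\<ge>no. norm (T (F n) x - T a x) < e" by blast
  qed
  then have "(\<lambda>n. F (Suc n) x) \<longlonglongrightarrow> v x + T a x" for x
    unfolding FS by (intro tendsto_intros)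
  then have "a x = v x + T a x" for x
    using LIMSEQ_unique[OF LIMSEQ_Suc[OF lim]] by blast
  then have "a x - T a x = v x" for x by (metis add_diff_cancel_right')
  then show ?thesis using aV aC by (auto simp: C_def)
qed

text \<open>The supremum \<open>B\<close> of \<open>d\<close> is finite and satisfies
  \<open>B \<le> q * B\<close>, which forces it to be nonpositive.\<close>

lemma contraction_fixpoint_zero:
  fixes T :: "('a \<Rightarrow> real) \<Rightarrow> 'a \<Rightarrow> real"
  assumes d: "d \<in> linfty (\<lambda>_. 1) Z" "\<And>x. d x = T d x"
    and contr: "\<And>B x. (\<And>x. \<bar>d x\<bar> \<le> B) \<Longrightarrow> \<bar>T d x\<bar> \<le> q * B" and q: "q < 1"
  shows "d x = 0"
proof -
  define B where "B = (SUP x. \<bar>d x\<bar>)"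
  obtain B0 where "\<And>x. \<bar>d x\<bar> \<le> B0" using d(1) by (subst (asm) linfty_iff) auto
  then have bdd: "bdd_above (range (\<lambda>x. \<bar>d x\<bar>))" by (intro bdd_aboveI[where M=B0]) auto
  have le: "\<bar>d x\<bar> \<le> B" for x unfolding B_def by (rule cSUP_upper[OF _ bdd]) simp
  have "\<bar>d x\<bar> \<le> q * B" for x using contr[of B x] le d(2)[of x] by simp
  then have "B \<le> q * B" unfolding B_def[symmetric] by (subst (1) B_def, intro cSUP_least) auto
  then have "(1 - q) * B \<le> 0" by (simp add: algebra_simps)
  then have "B \<le> 0" using q by (simp add: mult_le_0_iff)
  then show ?thesis using le[of x] by simp
qed

section \<open>The linearised Sinkhorn system and its unique solution\<close>

locale erot_scaled = erot_problem +
  fixes r u w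
  assumes S: "is_scaling r u w" and rX: "integrable (measure_pmf r) wX"
begin

definition "plan = scaled_plan r u w"
definition "p x y = dens u w (x, y)"
definition "Y1 = set_pmf s - {y1}"
abbreviation "AX \<equiv> op_AX plan r Y1"
abbreviation "AY \<equiv> op_AY plan r s Y1"
abbreviation "BY \<equiv> op_BY plan r s Y1"
abbreviation "VX \<equiv> linfty (\<lambda>_. 1) (set_pmf r)"
abbreviation "VY \<equiv> linfty phi Y1"

lemma p_eq: "p x y = u x * kern x y * w y" by (simp add: p_def dens_def)

lemma plan_eq: "erot_plan c lam r s = plan" unfolding plan_def by (rule erot_plan_eq[OF S rX])

lemma pmf_plan: "pmf plan (x, y) = pmf r x * pmf s y * p x y"
  by (simp add: plan_def p_def scaled_plan(1)[OF S])

lemma p_pos: "0 < p x y" and p_le: "p x y \<le> Umax * psi y"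
  using density_bounds(1,2)[OF S, of x y] by (auto simp: p_eq)

text \<open>Dividing the plan by the mass of \<open>x\<close> leaves the density \<open>p\<close>
  times \<open>pmf s y\<close>, so the operator is an integral with respect to \<open>s\<close>. As
  \<open>b\<close> vanishes off \<open>Y1\<close>, the restricted sum may run over the whole
  type.\<close>

lemma AX_eq:
  assumes "\<And>y. y \<notin> Y1 \<Longrightarrow> b y = 0"
  shows "AX b x = (if x \<in> set_pmf r then \<integral>y. p x y * b y \<partial>measure_pmf s else 0)"
proof (cases "x \<in> set_pmf r")
  case True
  then have "(\<Sum>\<^sub>\<infinity>y\<in>Y1. pmf plan (x, y) / pmf r x * b y) = (\<Sum>\<^sub>\<infinity>y. pmf s y * (p x y * b y))"
    using assms by (intro infsum_cong_neutral) (auto simp: pmf_plan set_pmf_iff)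
  then show ?thesis using True by (simp add: op_AX_def integral_measure_pmf_infsum)
qed (simp add: op_AX_def)

lemma AY_eq: "AY a y = (if y \<in> Y1 then \<integral>x. p x y * a x \<partial>measure_pmf r else 0)"
proof (cases "y \<in> Y1")
  case True
  then have "(\<Sum>\<^sub>\<infinity>x\<in>set_pmf r. pmf plan (x, y) / pmf s y * a x) = (\<Sum>\<^sub>\<infinity>x. pmf r x * (p x y * a x))"
    by (intro infsum_cong_neutral) (auto simp: pmf_plan set_pmf_iff Y1_def)
  then show ?thesis using True by (simp add: op_AY_def integral_measure_pmf_infsum)
qed (simp add: op_AY_def)

lemma BY_eq: "BY h y = (if y \<in> Y1 then \<Sum>\<^sub>\<infinity>x\<in>set_pmf r. p x y * h x else 0)"
proof (cases "y \<in> Y1")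
  case True
  then have "(\<Sum>\<^sub>\<infinity>x\<in>set_pmf r. pmf plan (x, y) / (pmf r x * pmf s y) * h x) = (\<Sum>\<^sub>\<infinity>x\<in>set_pmf r. p x y * h x)"
    by (intro infsum_cong) (auto simp: pmf_plan set_pmf_iff Y1_def)
  then show ?thesis using True by (simp add: op_BY_def)
qed (simp add: op_BY_def)

lemma p_integrable_r: "integrable (measure_pmf r) (\<lambda>x. p x y)" "(\<integral>x. p x y \<partial>measure_pmf r) = 1"
  using density_integrable(3,4)[OF S, of y] by (auto simp: p_eq)

lemma p_mult_integrable_r:
  assumes "\<And>x. \<bar>a x\<bar> \<le> B"
  shows "integrable (measure_pmf r) (\<lambda>x. p x y * a x)" "\<bar>\<integral>x. p x y * a x \<partial>measure_pmf r\<bar> \<le> B"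
proof -
  have i: "integrable (measure_pmf r) (\<lambda>x. p x y * B)" using p_integrable_r by simp
  have b: "\<bar>p x y * a x\<bar> \<le> p x y * B" for x
    using mult_left_mono[OF assms, of "p x y" x] p_pos[of x y] by (simp add: abs_mult)
  show "integrable (measure_pmf r) (\<lambda>x. p x y * a x)" by (rule pmf_integrable_bound[OF i b])
  show "\<bar>\<integral>x. p x y * a x \<partial>measure_pmf r\<bar> \<le> B"
    using pmf_abs_integral_le[OF i b] p_integrable_r(2) by simp
qed

lemma p_mult_integrable_s:
  assumes "\<And>y. \<bar>b y\<bar> \<le> B * psi y"
  shows "integrable (measure_pmf s) (\<lambda>y. p x y * b y)" "\<bar>\<integral>y. p x y * b y \<partial>measure_pmf s\<bar> \<le> B * (Umax * psi_moment 2)"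
proof -
  have i: "integrable (measure_pmf s) (\<lambda>y. B * (p x y * psi y ^ 1))"
    and l: "(\<integral>y. p x y * psi y ^ 1 \<partial>measure_pmf s) \<le> Umax * psi_moment (Suc 1)"
    using density_psi_power[OF S, of 1 x] by (auto simp: p_eq)
  have b: "\<bar>p x y * b y\<bar> \<le> B * (p x y * psi y ^ 1)" for y
    using mult_left_mono[OF assms, of "p x y" y] p_pos[of x y] by (simp add: abs_mult mult_ac)
  have B0: "0 \<le> B" using order_trans[OF abs_ge_zero assms[of undefined]] psi_pos[of undefined]
    by (simp add: zero_le_mult_iff)
  show "integrable (measure_pmf s) (\<lambda>y. p x y * b y)" by (rule pmf_integrable_bound[OF i b])
  have "\<bar>\<integral>y. p x y * b y \<partial>measure_pmf s\<bar> \<le> B * (\<integral>y. p x y * psi y ^ 1 \<partial>measure_pmf s)"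
    using pmf_abs_integral_le[OF i b] by simp
  also have "\<dots> \<le> B * (Umax * psi_moment 2)"
    using l B0 by (intro mult_left_mono) (auto simp: numeral_2_eq_2)
  finally show "\<bar>\<integral>y. p x y * b y \<partial>measure_pmf s\<bar> \<le> B * (Umax * psi_moment 2)" .
qed

lemma VX_iff: "a \<in> VX \<longleftrightarrow> (\<forall>x. x \<notin> set_pmf r \<longrightarrow> a x = 0) \<and> (\<exists>B\<ge>0. \<forall>x. \<bar>a x\<bar> \<le> B)"
  by (subst linfty_iff) auto

lemma phi_pos: "0 < phi y" using phi_ge1[of y] by linarith

text \<open>\<open>psi\<close> is \<open>phi\<close> times the constant
  \<open>exp (Kx / lam)\<close>, so the two weights define the same space; the estimates above are
  available in terms of \<open>psi\<close>.\<close>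

lemma VY_iff: "b \<in> VY \<longleftrightarrow> (\<forall>y. y \<notin> Y1 \<longrightarrow> b y = 0) \<and> (\<exists>B\<ge>0. \<forall>y. \<bar>b y\<bar> \<le> B * psi y)"
proof -
  have "(\<exists>B\<ge>0. \<forall>y. \<bar>b y\<bar> \<le> B * phi y) \<longleftrightarrow> (\<exists>B\<ge>0. \<forall>y. \<bar>b y\<bar> \<le> B * psi y)"
  proof
    assume "\<exists>B\<ge>0. \<forall>y. \<bar>b y\<bar> \<le> B * phi y"
    then show "\<exists>B\<ge>0. \<forall>y. \<bar>b y\<bar> \<le> B * psi y"
      using mult_left_mono[OF psi_ge_phi] order_trans by blast
  next
    assume "\<exists>B\<ge>0. \<forall>y. \<bar>b y\<bar> \<le> B * psi y"
    then obtain B where "0 \<le> B" "\<forall>y. \<bar>b y\<bar> \<le> B * psi y" by blast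
    then show "\<exists>B\<ge>0. \<forall>y. \<bar>b y\<bar> \<le> B * phi y"
      by (intro exI[of _ "B * exp (Kx / lam)"]) (auto simp: psi_def mult.assoc)
  qed
  then show ?thesis by (subst linfty_iff[OF phi_pos]) simp
qed

lemma AY_contr: assumes "\<And>x. \<bar>a x\<bar> \<le> B" shows "\<bar>AY a y\<bar> \<le> B"
  using p_mult_integrable_r(2)[of a B y] assms order_trans[OF abs_ge_zero assms] by (auto simp: AY_eq)

text \<open>A row of the density is a probability density, but a function vanishing at
  \<open>y1\<close> misses mass at least \<open>eps\<close>. The bound concerns bounded
  \<open>b\<close>, which is why the contraction is run for \<open>AX \<circ> AY\<close> on the
  unweighted space \<open>VX\<close>, not on \<open>VY\<close>.\<close>

lemma AX_contr:
  assumes z: "\<And>y. y \<notin> Y1 \<Longrightarrow> b y = 0" and b: "\<And>y. \<bar>b y\<bar> \<le> B"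
  shows "\<bar>AX b x\<bar> \<le> (1 - eps) * B"
proof -
  have B0: "0 \<le> B" using order_trans[OF abs_ge_zero b] .
  have "\<bar>\<integral>y. p x y * b y \<partial>measure_pmf s\<bar>
      \<le> (\<integral>y. (if y = y1 then 0 else u x * kern x y * w y * B) \<partial>measure_pmf s)"
  proof (rule pmf_abs_integral_le[OF row_gap(1)[OF S B0]])
    fix y
    show "\<bar>p x y * b y\<bar> \<le> (if y = y1 then 0 else u x * kern x y * w y * B)"
      using z[of y1] mult_left_mono[OF b[of y], of "p x y"] p_pos[of x y]
      unfolding p_eq[symmetric] by (auto simp: Y1_def abs_mult)
  qed
  also have "\<dots> \<le> (1 - eps) * B" using row_gap(2)[OF S B0, of x] by (simp add: algebra_simps)
  finally show ?thesis using B0 eps_le1 by (auto simp: AX_eq[OF z])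
qed

text \<open>Averaging against the density gains boundedness: a function of growth \<open>psi\<close>
  integrates against \<open>p x \<le> Umax * psi\<close> to at most a second moment of
  \<open>psi\<close>, uniformly in \<open>x\<close>.\<close>

lemma AX_VY:
  assumes "b \<in> VY" "\<And>y. \<bar>b y\<bar> \<le> B * psi y"
  shows "AX b \<in> VX" "\<bar>AX b x\<bar> \<le> B * (Umax * psi_moment 2)"
proof -
  have z: "\<And>y. y \<notin> Y1 \<Longrightarrow> b y = 0" using assms(1) by (simp add: VY_iff)
  have *: "\<bar>AX b x\<bar> \<le> B * (Umax * psi_moment 2)" for x
    using p_mult_integrable_s(2)[of b B x] assms(2)
      order_trans[OF abs_ge_zero p_mult_integrable_s(2)[of b B x]] by (auto simp: AX_eq[OF z])
  then show "\<bar>AX b x\<bar> \<le> B * (Umax * psi_moment 2)" .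
  have "AX b x = 0" if "x \<notin> set_pmf r" for x using that by (simp add: op_AX_def)
  then show "AX b \<in> VX" unfolding VX_iff using * order_trans[OF abs_ge_zero *] by blast
qed

lemma AY_VX:
  assumes "a \<in> VX"
  shows "AY a \<in> VY"
proof -
  obtain B where B: "0 \<le> B" "\<And>x. \<bar>a x\<bar> \<le> B" using assms by (auto simp: VX_iff)
  have "\<bar>AY a y\<bar> \<le> B * psi y" for y
    using AY_contr[of a B y] B mult_left_mono[OF psi_ge1 B(1), of y] by auto
  moreover have "AY a y = 0" if "y \<notin> Y1" for y using that by (simp add: op_AY_def)
  ultimately show ?thesis unfolding VY_iff using B(1) by blast
qed

lemma VX_lin: "a \<in> VX \<Longrightarrow> a' \<in> VX \<Longrightarrow> (\<lambda>x. t * a x + t' * a' x) \<in> VX"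
proof -
  assume "a \<in> VX" "a' \<in> VX"
  then obtain B B' where B: "0 \<le> B" "\<And>x. \<bar>a x\<bar> \<le> B" "0 \<le> B'" "\<And>x. \<bar>a' x\<bar> \<le> B'"
    and z: "\<And>x. x \<notin> set_pmf r \<Longrightarrow> a x = 0 \<and> a' x = 0" by (auto simp: VX_iff)
  have "\<bar>t * a x + t' * a' x\<bar> \<le> \<bar>t\<bar> * B + \<bar>t'\<bar> * B'" for x
    by (intro order_trans[OF abs_triangle_ineq] add_mono) (auto simp: abs_mult intro!: mult_left_mono B)
  then show ?thesis unfolding VX_iff using z B by (auto intro!: exI[of _ "\<bar>t\<bar> * B + \<bar>t'\<bar> * B'"])
qed

lemma VY_lin: "b \<in> VY \<Longrightarrow> b' \<in> VY \<Longrightarrow> (\<lambda>y. t * b y + t' * b' y) \<in> VY"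
proof -
  assume "b \<in> VY" "b' \<in> VY"
  then obtain B B' where B: "0 \<le> B" "\<And>y. \<bar>b y\<bar> \<le> B * psi y" "0 \<le> B'" "\<And>y. \<bar>b' y\<bar> \<le> B' * psi y"
    and z: "\<And>y. y \<notin> Y1 \<Longrightarrow> b y = 0 \<and> b' y = 0" by (auto simp: VY_iff)
  have "\<bar>t * b y + t' * b' y\<bar> \<le> (\<bar>t\<bar> * B + \<bar>t'\<bar> * B') * psi y" for y
    unfolding distrib_right mult.assoc
    by (intro order_trans[OF abs_triangle_ineq] add_mono) (auto simp: abs_mult intro!: mult_left_mono B)
  then show ?thesis unfolding VY_iff using z B by (auto intro!: exI[of _ "\<bar>t\<bar> * B + \<bar>t'\<bar> * B'"])
qed

lemma AY_lin:
  assumes "a \<in> VX" "a' \<in> VX"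
  shows "AY (\<lambda>x. t * a x + t' * a' x) y = t * AY a y + t' * AY a' y"
proof -
  obtain B B' where B: "\<And>x. \<bar>a x\<bar> \<le> B" "\<And>x. \<bar>a' x\<bar> \<le> B'" using assms by (auto simp: VX_iff)
  note i = p_mult_integrable_r(1)[of a B y, OF B(1)] p_mult_integrable_r(1)[of a' B' y, OF B(2)]
  have "(\<integral>x. p x y * (t * a x + t' * a' x) \<partial>measure_pmf r)
      = (\<integral>x. t * (p x y * a x) + t' * (p x y * a' x) \<partial>measure_pmf r)" by (simp add: algebra_simps)
  also have "\<dots> = t * (\<integral>x. p x y * a x \<partial>measure_pmf r) + t' * (\<integral>x. p x y * a' x \<partial>measure_pmf r)"
    using i by (subst Bochner_Integration.integral_add) auto
  finally show ?thesis by (simp add: AY_eq)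
qed

lemma AX_lin:
  assumes "b \<in> VY" "b' \<in> VY"
  shows "AX (\<lambda>y. t * b y + t' * b' y) x = t * AX b x + t' * AX b' x"
proof -
  obtain B B' where B: "\<And>y. \<bar>b y\<bar> \<le> B * psi y" "\<And>y. \<bar>b' y\<bar> \<le> B' * psi y" using assms by (auto simp: VY_iff)
  have z: "\<And>y. y \<notin> Y1 \<Longrightarrow> b y = 0" "\<And>y. y \<notin> Y1 \<Longrightarrow> b' y = 0" using assms by (auto simp: VY_iff)
  note i = p_mult_integrable_s(1)[of b B x, OF B(1)] p_mult_integrable_s(1)[of b' B' x, OF B(2)]
  have "(\<integral>y. p x y * (t * b y + t' * b' y) \<partial>measure_pmf s)
      = (\<integral>y. t * (p x y * b y) + t' * (p x y * b' y) \<partial>measure_pmf s)" by (simp add: algebra_simps)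
  also have "\<dots> = t * (\<integral>y. p x y * b y \<partial>measure_pmf s) + t' * (\<integral>y. p x y * b' y \<partial>measure_pmf s)"
    using i by (subst Bochner_Integration.integral_add) auto
  finally show ?thesis using z by (simp add: AX_eq)
qed

lemma AXAY_contr:
  assumes "\<And>x. \<bar>a x\<bar> \<le> B"
  shows "\<bar>AX (AY a) x\<bar> \<le> (1 - eps) * B"
  by (rule AX_contr) (use AY_contr[OF assms] in \<open>auto simp: op_AY_def\<close>)

lemma AXAY_fixpoint:
  assumes "d \<in> VX" "\<And>x. d x = AX (AY d) x"
  shows "d x = 0"
  by (rule contraction_fixpoint_zero[where T="\<lambda>a. AX (AY a)" and q="1 - eps", OF assms])
     (use AXAY_contr eps_pos in auto)

lemma VX_diff: "a \<in> VX \<Longrightarrow> a' \<in> VX \<Longrightarrow> (\<lambda>x. a x - a' x) \<in> VX"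
  using VX_lin[of a a' 1 "-1"] by simp

lemma VY_diff: "b \<in> VY \<Longrightarrow> b' \<in> VY \<Longrightarrow> (\<lambda>x. b x - b' x) \<in> VY"
  using VY_lin[of b b' 1 "-1"] by simp

lemma VY_bound: "b \<in> VY \<Longrightarrow> \<exists>B\<ge>0. \<forall>y. \<bar>b y\<bar> \<le> B * psi y" by (simp add: VY_iff)

lemma AX_VY': "b \<in> VY \<Longrightarrow> AX b \<in> VX"
  using AX_VY(1) VY_bound by blast

lemma inj_X: "inj_on (\<lambda>a x. a x - (AX \<circ> AY) a x) VX"
proof (rule inj_onI)
  fix a a' assume a: "a \<in> VX" "a' \<in> VX" and e: "(\<lambda>x. a x - (AX \<circ> AY) a x) = (\<lambda>x. a' x - (AX \<circ> AY) a' x)"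
  let ?d = "\<lambda>x. a x - a' x"
  have "?d x = AX (AY ?d) x" for x
  proof -
    have "AY ?d = (\<lambda>y. AY a y - AY a' y)" using AY_lin[OF a, of 1 "-1"] by auto
    then have "AX (AY ?d) x = AX (AY a) x - AX (AY a') x"
      using AX_lin[OF AY_VX[OF a(1)] AY_VX[OF a(2)], of 1 "-1"] by simp
    then show ?thesis using fun_cong[OF e, of x] by simp
  qed
  then have "?d x = 0" for x by (rule AXAY_fixpoint[OF VX_diff[OF a]])
  then show "a = a'" by auto
qed

text \<open>Reduced to the other composition: if \<open>d = AY (AX d)\<close>, then
  \<open>AX d\<close> is a fixed point of \<open>AX \<circ> AY\<close> in \<open>VX\<close> and so
  is 0, and then \<open>d = AY 0 = 0\<close>. No contraction on the weighted space is used.\<close>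

lemma inj_Y: "inj_on (\<lambda>b y. b y - (AY \<circ> AX) b y) VY"
proof (rule inj_onI)
  fix b b' assume b: "b \<in> VY" "b' \<in> VY" and e: "(\<lambda>x. b x - (AY \<circ> AX) b x) = (\<lambda>x. b' x - (AY \<circ> AX) b' x)"
  let ?d = "\<lambda>x. b x - b' x"
  have d: "?d = AY (AX ?d)"
  proof
    fix y
    have "AX ?d = (\<lambda>y. AX b y - AX b' y)" using AX_lin[OF b, of 1 "-1"] by auto
    then have "AY (AX ?d) y = AY (AX b) y - AY (AX b') y"
      using AY_lin[OF AX_VY'[OF b(1)] AX_VY'[OF b(2)], of 1 "-1"] by simp
    then show "?d y = AY (AX ?d) y" using fun_cong[OF e, of y] by simp
  qed
  have "AX ?d x = 0" for x
    by (rule AXAY_fixpoint) (use AX_VY'[OF VY_diff[OF b]] d in auto)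
  then have "AX ?d = (\<lambda>_. 0)" by auto
  then have "?d y = 0" for y using fun_cong[OF d, of y] by (simp add: AY_eq)
  then show "b = b'" by auto
qed

abbreviation "nX \<equiv> ell1_norm wX"

lemma ell1_abs_summable:
  assumes "h \<in> ell1 wX"
  shows "(\<lambda>x. \<bar>h x\<bar>) summable_on UNIV" "(\<Sum>\<^sub>\<infinity>x. \<bar>h x\<bar>) \<le> nX h"
proof -
  have s: "(\<lambda>x. wX x * \<bar>h x\<bar>) summable_on UNIV" using assms by (simp add: ell1_def)
  have le: "\<bar>h x\<bar> \<le> wX x * \<bar>h x\<bar>" for x
    using mult_right_mono[OF wX_ge1, of "\<bar>h x\<bar>" x] by simp
  show 1: "(\<lambda>x. \<bar>h x\<bar>) summable_on UNIV" by (rule summable_on_real_bound[OF s]) (use le in auto)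
  show "(\<Sum>\<^sub>\<infinity>x. \<bar>h x\<bar>) \<le> nX h" unfolding ell1_norm_def by (rule infsum_mono[OF 1 s le])
qed

lemma nX_nonneg: "0 \<le> nX h"
proof -
  have "0 \<le> wX x" for x using wX_ge1[of x] by linarith
  then show ?thesis unfolding ell1_norm_def by (intro infsum_nonneg mult_nonneg_nonneg) auto
qed

lemma ph_summable:
  assumes "h \<in> ell1 wX"
  shows "(\<lambda>x. p x y * h x) summable_on A"
proof -
  have "(\<lambda>x. (Umax * psi y) * \<bar>h x\<bar>) summable_on UNIV"
    by (intro summable_on_cmult_right ell1_abs_summable assms)
  then have "(\<lambda>x. p x y * h x) summable_on UNIV"
    by (rule summable_on_real_bound) (use p_le p_pos in \<open>auto simp: abs_mult abs_of_pos intro!: mult_right_mono\<close>)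
  then show ?thesis by (rule summable_on_subset_banach) simp
qed

lemma BY_bound:
  assumes "h \<in> ell1 wX"
  shows "\<bar>BY h y\<bar> \<le> Umax * nX h * psi y"
proof -
  have "\<bar>\<Sum>\<^sub>\<infinity>x\<in>set_pmf r. p x y * h x\<bar> \<le> (\<Sum>\<^sub>\<infinity>x\<in>set_pmf r. (Umax * psi y) * \<bar>h x\<bar>)"
  proof (rule abs_infsum_le)
    show "(\<lambda>x. (Umax * psi y) * \<bar>h x\<bar>) summable_on set_pmf r"
      by (intro summable_on_cmult_right summable_on_subset_banach[OF ell1_abs_summable(1)[OF assms]]) auto
  qed (use p_le p_pos in \<open>auto simp: abs_mult abs_of_pos intro!: mult_right_mono\<close>)
  also have "\<dots> = (Umax * psi y) * (\<Sum>\<^sub>\<infinity>x\<in>set_pmf r. \<bar>h x\<bar>)" by (rule infsum_cmult_right')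
  also have "\<dots> \<le> (Umax * psi y) * nX h"
  proof (rule mult_left_mono)
    have "(\<Sum>\<^sub>\<infinity>x\<in>set_pmf r. \<bar>h x\<bar>) \<le> (\<Sum>\<^sub>\<infinity>x. \<bar>h x\<bar>)"
      by (rule infsum_mono2) (use ell1_abs_summable[OF assms] summable_on_subset_banach in auto)
    then show "(\<Sum>\<^sub>\<infinity>x\<in>set_pmf r. \<bar>h x\<bar>) \<le> nX h" using ell1_abs_summable(2)[OF assms] by linarith
  qed (use Umax_pos psi_pos in \<open>auto intro!: mult_nonneg_nonneg less_imp_le\<close>)
  finally show ?thesis using Umax_pos psi_pos[of y] nX_nonneg by (auto simp: BY_eq mult_ac)
qed

lemma BY_VY: assumes "h \<in> ell1 wX" shows "BY h \<in> VY"
proof -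
  have "BY h y = 0" if "y \<notin> Y1" for y using that by (simp add: op_BY_def)
  moreover have "0 \<le> Umax * nX h" using Umax_pos nX_nonneg by simp
  ultimately show ?thesis unfolding VY_iff using BY_bound[OF assms] by blast
qed

text \<open>The bound \<open>Umax * nX h * (Umax * psi_moment 2)\<close> of
  \<open>AX (BY h)\<close>, divided by the gap \<open>eps\<close> of the contraction.\<close>

definition "CA = Umax * (Umax * psi_moment 2) / eps"

text \<open>\<open>lin_sol h a b\<close> is the linearised system; \<open>a\<close> is the negative of the \<open>a\<close> in \<open>erot_deriv\<close>.\<close>

definition lin_sol :: "('a \<Rightarrow> real) \<Rightarrow> ('a \<Rightarrow> real) \<Rightarrow> ('b \<Rightarrow> real) \<Rightarrow> bool" where
  "lin_sol h a b \<longleftrightarrow> a \<in> VX \<and> b \<in> VY \<and> a = AX b \<and> b = (\<lambda>y. BY h y + AY a y)"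

text \<open>Eliminating one unknown from the coupled system gives
  \<open>(Id - AX AY) a = AX (BY h)\<close> and \<open>(Id - AY AX) b = BY h\<close>. By injectivity
  on \<open>VX\<close> and \<open>VY\<close> the two \<open>inv_into\<close> expressions return
  exactly this \<open>a\<close> and this \<open>b\<close>.\<close>

lemma lin_sol_erot_deriv:
  assumes h: "h \<in> ell1 wX" and L: "lin_sol h a b"
  shows "erot_deriv plan r s phi y1 h (x, y) =
    (if x \<in> set_pmf r \<and> y \<in> set_pmf s then pmf s y * p x y * h x + pmf r x * pmf s y * p x y * (a x - b y) else 0)"
proof -
  have V: "a \<in> VX" "b \<in> VY" and a: "a = AX b" and b: "b = (\<lambda>y. BY h y + AY a y)"
    using L unfolding lin_sol_def by blast+
  have ea: "(\<lambda>x. a x - (AX \<circ> AY) a x) = AX (BY h)"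
  proof
    fix x
    have "BY h y = 1 * b y + (-1) * AY a y" for y using fun_cong[OF b, of y] by simp
    then have "BY h = (\<lambda>y. 1 * b y + (-1) * AY a y)" by blast
    then have "AX (BY h) x = 1 * AX b x + (-1) * AX (AY a) x"
      using AX_lin[OF V(2) AY_VX[OF V(1)], of 1 "-1" x] by simp
    then show "a x - (AX \<circ> AY) a x = AX (BY h) x" using fun_cong[OF a, of x] by simp
  qed
  have eb: "(\<lambda>y. b y - (AY \<circ> AX) b y) = BY h"
  proof
    fix y show "b y - (AY \<circ> AX) b y = BY h y"
      using fun_cong[OF b, of y] unfolding comp_apply a[symmetric] by simp
  qed
  have ia: "inv_Id_minus VX (AX \<circ> AY) (AX (BY h)) = a"
    unfolding inv_Id_minus_def ea[symmetric] by (rule inv_into_f_f[OF inj_X V(1)])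
  have ib: "inv_Id_minus VY (AY \<circ> AX) (BY h) = b"
    unfolding inv_Id_minus_def by (subst eb[symmetric]) (rule inv_into_f_f[OF inj_Y V(2)])
  have Y1: "set_pmf s - {y1} = Y1" by (simp add: Y1_def)
  show ?thesis
    unfolding erot_deriv_def Let_def Y1 ia ib
    by (auto simp: pmf_plan set_pmf_iff algebra_simps)
qed

text \<open>Only the equation for \<open>a\<close> needs the Neumann series; \<open>b\<close> is
  then read off as \<open>BY h + AY a\<close>, and \<open>a = AX b\<close> is the equation for
  \<open>a\<close> rewritten.\<close>

lemma lin_sol_exists:
  assumes h: "h \<in> ell1 wX"
  shows "\<exists>a b. lin_sol h a b \<and> (\<forall>x. \<bar>a x\<bar> \<le> CA * nX h) \<and> (\<forall>y. \<bar>b y\<bar> \<le> (Umax + CA) * nX h * psi y)"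
proof -
  have AB: "AX (BY h) \<in> VX" "\<bar>AX (BY h) x\<bar> \<le> Umax * nX h * (Umax * psi_moment 2)" for x
    using AX_VY[OF BY_VY[OF h] BY_bound[OF h]] by auto
  have "\<exists>a\<in>VX. (\<forall>x. a x - (AX (AY a)) x = AX (BY h) x)
      \<and> (\<forall>x. \<bar>a x\<bar> \<le> Umax * nX h * (Umax * psi_moment 2) / (1 - (1 - eps)))"
  proof (rule Id_minus_contraction_surj)
    show "AX (AY f) x = 0" if "x \<notin> set_pmf r" for f x using that by (simp add: op_AX_def)
    show "AX (AY (\<lambda>x. f x - g x)) x = AX (AY f) x - AX (AY g) x" if fg: "f \<in> VX" "g \<in> VX" for f g x
    proof -
      have "AY (\<lambda>x. f x - g x) = (\<lambda>y. AY f y - AY g y)" using AY_lin[OF fg, of 1 "-1"] by auto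
      then show ?thesis using AX_lin[OF AY_VX[OF fg(1)] AY_VX[OF fg(2)], of 1 "-1"] by simp
    qed
    show "\<bar>AX (AY f) x\<bar> \<le> (1 - eps) * B" if "\<And>x. \<bar>f x\<bar> \<le> B" for f B x by (rule AXAY_contr[OF that])
  qed (use AB eps_pos eps_le1 in auto)
  then obtain a where a: "a \<in> VX" "\<And>x. a x - (AX (AY a)) x = AX (BY h) x"
    "\<And>x. \<bar>a x\<bar> \<le> Umax * nX h * (Umax * psi_moment 2) / (1 - (1 - eps))" by blast
  have aC: "\<bar>a x\<bar> \<le> CA * nX h" for x using a(3)[of x] by (simp add: CA_def mult_ac)
  define b where "b = (\<lambda>y. BY h y + AY a y)"
  have bV: "b \<in> VY" unfolding b_def using VY_lin[OF BY_VY[OF h] AY_VX[OF a(1)], of 1 1] by simp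
  have "a = AX b"
  proof
    fix x
    have "AX b x = AX (BY h) x + AX (AY a) x"
      unfolding b_def using AX_lin[OF BY_VY[OF h] AY_VX[OF a(1)], of 1 1] by simp
    then show "a x = AX b x" using a(2)[of x] by simp
  qed
  then have "lin_sol h a b" using a(1) bV b_def unfolding lin_sol_def by blast
  moreover have "\<bar>b y\<bar> \<le> (Umax + CA) * nX h * psi y" for y
  proof -
    have "\<bar>b y\<bar> \<le> Umax * nX h * psi y + CA * nX h"
      unfolding b_def by (intro order_trans[OF abs_triangle_ineq] add_mono BY_bound[OF h] AY_contr aC)
    also have "\<dots> \<le> Umax * nX h * psi y + CA * nX h * psi y"
      using mult_left_mono[OF psi_ge1, of "CA * nX h" y] order_trans[OF abs_ge_zero aC] by simp
    finally show ?thesis by (simp add: algebra_simps)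
  qed
  ultimately show ?thesis using aC by blast
qed

abbreviation "Dp \<equiv> erot_deriv plan r s phi y1"

text \<open>A linear combination of solutions solves the system for the combined right-hand side,
  and \<open>lin_sol_erot_deriv\<close> holds for any solution, so linearity of the inverses need
  not be treated separately.\<close>

lemma Dp_lin:
  assumes h: "h \<in> ell1 wX" "h' \<in> ell1 wX" and hh: "(\<lambda>x. t * h x + t' * h' x) \<in> ell1 wX"
  shows "Dp (\<lambda>x. t * h x + t' * h' x) z = t * Dp h z + t' * Dp h' z"
proof -
  obtain a b where L: "lin_sol h a b" using lin_sol_exists[OF h(1)] by blast
  obtain a' b' where L': "lin_sol h' a' b'" using lin_sol_exists[OF h(2)] by blast
  have BY: "BY (\<lambda>x. t * h x + t' * h' x) y = t * BY h y + t' * BY h' y" for y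
  proof -
    have "(\<Sum>\<^sub>\<infinity>x\<in>set_pmf r. p x y * (t * h x + t' * h' x))
        = (\<Sum>\<^sub>\<infinity>x\<in>set_pmf r. t * (p x y * h x) + t' * (p x y * h' x))" by (simp add: algebra_simps)
    also have "\<dots> = t * (\<Sum>\<^sub>\<infinity>x\<in>set_pmf r. p x y * h x) + t' * (\<Sum>\<^sub>\<infinity>x\<in>set_pmf r. p x y * h' x)"
      by (subst infsum_add) (auto intro!: summable_on_cmult_right ph_summable h simp: infsum_cmult_right')
    finally show ?thesis by (simp add: BY_eq)
  qed
  have l: "a \<in> VX" "b \<in> VY" "a = AX b" "\<And>y. b y = BY h y + AY a y" using L unfolding lin_sol_def by metis+
  have l': "a' \<in> VX" "b' \<in> VY" "a' = AX b'" "\<And>y. b' y = BY h' y + AY a' y" using L' unfolding lin_sol_def by metis+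
  have "lin_sol (\<lambda>x. t * h x + t' * h' x) (\<lambda>x. t * a x + t' * a' x) (\<lambda>y. t * b y + t' * b' y)"
    unfolding lin_sol_def
  proof (intro conjI ext)
    show "(\<lambda>x. t * a x + t' * a' x) \<in> VX" by (rule VX_lin[OF l(1) l'(1)])
    show "(\<lambda>x. t * b x + t' * b' x) \<in> VY" by (rule VY_lin[OF l(2) l'(2)])
    show "t * a x + t' * a' x = AX (\<lambda>y. t * b y + t' * b' y) x" for x
      unfolding AX_lin[OF l(2) l'(2)] l(3)[symmetric] l'(3)[symmetric] ..
    show "t * b y + t' * b' y = BY (\<lambda>x. t * h x + t' * h' x) y + AY (\<lambda>x. t * a x + t' * a' x) y" for y
      unfolding BY AY_lin[OF l(1) l'(1)] l(4)[of y] l'(4)[of y] by (simp add: algebra_simps)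
  qed
  note E = lin_sol_erot_deriv[OF hh this] lin_sol_erot_deriv[OF h(1) L] lin_sol_erot_deriv[OF h(2) L']
  obtain x y where z: "z = (x, y)" by (cases z)
  show ?thesis unfolding z E by (simp add: algebra_simps)
qed

definition "CD = Umax * (1 + Umax + 2 * CA)"

lemma CA_nonneg: "0 \<le> CA" using Umax_pos eps_pos psi_moment_nonneg[of 2] by (simp add: CA_def)

text \<open>The local term keeps \<open>\<bar>h x\<bar>\<close> and the nonlocal one keeps
  \<open>pmf r x\<close>, because the bound will be summed against \<open>wX\<close>, and both
  sequences are summable with this weight.\<close>

lemma Dp_bound:
  assumes h: "h \<in> ell1 wX"
  shows "\<bar>Dp h (x, y)\<bar> \<le> CD * (pmf s y * psi y ^ 2 * \<bar>h x\<bar> + pmf r x * (pmf s y * psi y ^ 2) * nX h)"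
proof -
  obtain a b where L: "lin_sol h a b" and a: "\<And>x. \<bar>a x\<bar> \<le> CA * nX h"
    and b: "\<And>y. \<bar>b y\<bar> \<le> (Umax + CA) * nX h * psi y" using lin_sol_exists[OF h] by blast
  have ps: "psi y \<le> psi y ^ 2" "0 < psi y" using psi_ge1[of y] psi_pos[of y] by (simp_all add: power2_eq_square)
  have 1: "p x y * \<bar>h x\<bar> \<le> Umax * psi y ^ 2 * \<bar>h x\<bar>"
    using order_trans[OF p_le[of x y] mult_left_mono[OF ps(1), of Umax]] Umax_pos
    by (intro mult_right_mono) auto
  have "CA * nX h \<le> CA * nX h * psi y"
    using mult_left_mono[OF psi_ge1, of "CA * nX h" y] CA_nonneg nX_nonneg by simp
  then have ab: "\<bar>a x - b y\<bar> \<le> (Umax + 2 * CA) * nX h * psi y"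
    using a[of x] b[of y] by (intro order_trans[OF abs_triangle_ineq4]) (simp add: algebra_simps)
  have 2: "p x y * \<bar>a x - b y\<bar> \<le> (Umax * psi y) * ((Umax + 2 * CA) * nX h * psi y)"
    by (intro mult_mono p_le ab) (use Umax_pos ps in auto)
  have "\<bar>Dp h (x, y)\<bar> \<le> pmf s y * (p x y * \<bar>h x\<bar>) + pmf r x * pmf s y * (p x y * \<bar>a x - b y\<bar>)"
  proof (cases "x \<in> set_pmf r \<and> y \<in> set_pmf s")
    case True
    then show ?thesis
      unfolding lin_sol_erot_deriv[OF h L] using p_pos[of x y]
        abs_triangle_ineq[of "pmf s y * p x y * h x" "pmf r x * pmf s y * p x y * (a x - b y)"]
      by (simp add: abs_mult mult.assoc)
  next
    case False
    then show ?thesis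
      unfolding lin_sol_erot_deriv[OF h L] using less_imp_le[OF p_pos[of x y]] by (simp only: if_False) simp
  qed
  also have "\<dots> \<le> pmf s y * (Umax * psi y ^ 2 * \<bar>h x\<bar>)
      + pmf r x * pmf s y * ((Umax * psi y) * ((Umax + 2 * CA) * nX h * psi y))"
    by (intro add_mono mult_left_mono 1 2) auto
  also have "\<dots> = Umax * (pmf s y * psi y ^ 2 * \<bar>h x\<bar>)
      + (Umax * (Umax + 2 * CA)) * (pmf r x * (pmf s y * psi y ^ 2) * nX h)"
    by (simp add: power2_eq_square mult_ac)
  also have "\<dots> \<le> CD * (pmf s y * psi y ^ 2 * \<bar>h x\<bar>) + CD * (pmf r x * (pmf s y * psi y ^ 2) * nX h)"
    using CA_nonneg Umax_pos nX_nonneg[of h]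
    by (intro add_mono mult_right_mono) (auto simp: CD_def intro!: mult_left_mono)
  finally show ?thesis by (simp add: distrib_left)
qed

end

section \<open>Expansion of the Sinkhorn cost\<close>

lemma ell1_lin:
  assumes f: "\<And>x. 0 \<le> f x" and h: "h \<in> ell1 f" "h' \<in> ell1 f"
  shows "(\<lambda>x. t * h x + t' * h' x) \<in> ell1 f"
  unfolding ell1_def mem_Collect_eq
proof (rule summable_on_real_bound)
  show "(\<lambda>x. \<bar>t\<bar> * (f x * \<bar>h x\<bar>) + \<bar>t'\<bar> * (f x * \<bar>h' x\<bar>)) summable_on UNIV"
    using h by (intro summable_on_add summable_on_cmult_right) (auto simp: ell1_def)
  fix x
  have "\<bar>t * h x + t' * h' x\<bar> \<le> \<bar>t\<bar> * \<bar>h x\<bar> + \<bar>t'\<bar> * \<bar>h' x\<bar>"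
    by (rule order_trans[OF abs_triangle_ineq]) (simp add: abs_mult)
  from mult_left_mono[OF this f[of x]] f[of x]
  show "\<bar>f x * \<bar>t * h x + t' * h' x\<bar>\<bar> \<le> \<bar>t\<bar> * (f x * \<bar>h x\<bar>) + \<bar>t'\<bar> * (f x * \<bar>h' x\<bar>)"
    by (simp add: algebra_simps)
qed

lemma ell1_finite_support:
  assumes "finite F"
  shows "(\<lambda>x. if x \<in> F then h x else 0) \<in> ell1 f"
proof -
  have "(\<lambda>x. f x * \<bar>if x \<in> F then h x else 0\<bar>) summable_on F" using assms by simp
  then have "(\<lambda>x. f x * \<bar>if x \<in> F then h x else 0\<bar>) summable_on UNIV"
    by (rule summable_on_cong_neutral[THEN iffD1, rotated -1]) auto
  then show ?thesis by (simp add: ell1_def)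
qed

lemma indicator_ell1: "indicator {x} \<in> ell1 f"
proof -
  have "(indicator {x} :: 'a \<Rightarrow> real) = (\<lambda>z. if z \<in> {x} then 1 else 0)" by (auto simp: indicator_def)
  then show ?thesis using ell1_finite_support[of "{x}" "\<lambda>_. 1" f] by simp
qed

text \<open>Truncations to finite sets converge to \<open>h\<close> in norm, so a bounded linear
  functional is the sum of its values on unit vectors. This represents both the coordinates of the
  derivative and the derivative of the cost.\<close>

lemma ell1_linear_has_sum:
  fixes f :: "'a \<Rightarrow> real" and L :: "('a \<Rightarrow> real) \<Rightarrow> real"
  assumes f: "\<And>x. 0 \<le> f x"
    and lin: "\<And>h h' t t'. h \<in> ell1 f \<Longrightarrow> h' \<in> ell1 f \<Longrightarrow> L (\<lambda>x. t * h x + t' * h' x) = t * L h + t' * L h'"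
    and bound: "\<And>h. h \<in> ell1 f \<Longrightarrow> \<bar>L h\<bar> \<le> C * ell1_norm f h"
    and h: "h \<in> ell1 f"
  shows "((\<lambda>x. h x * L (indicator {x})) has_sum L h) UNIV"
proof -
  let ?e = "\<lambda>x. indicator {x} :: 'a \<Rightarrow> real"
  have e: "?e x \<in> ell1 f" for x
    by (rule indicator_ell1)
  define hF where "hF = (\<lambda>F x. if x \<in> F then h x else 0)"
  have hF: "hF F \<in> ell1 f" if "finite F" for F unfolding hF_def by (rule ell1_finite_support[OF that])
  have L0: "L (\<lambda>_. 0) = 0" using lin[OF h h, of 0 0] by simp
  have LF: "L (hF F) = (\<Sum>x\<in>F. h x * L (?e x))" if "finite F" for F
    using that
  proof (induction F)
    case empty
    then show ?case using L0 by (simp add: hF_def)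
  next
    case (insert y F)
    have "hF (insert y F) = (\<lambda>x. 1 * hF F x + h y * ?e y x)"
      using insert by (auto simp: hF_def indicator_def)
    then have "L (hF (insert y F)) = 1 * L (hF F) + h y * L (?e y)"
      by (simp only:) (rule lin[OF hF[OF insert(1)] e])
    then show ?case using insert by simp
  qed
  have s: "(\<lambda>x. f x * \<bar>h x\<bar>) summable_on UNIV" using h by (simp add: ell1_def)
  \<comment> \<open>The norm of the remainder is the norm of \<open>h\<close> minus a partial sum,
    and therefore tends to 0 along the finite sets.\<close>
  have tail: "ell1_norm f (\<lambda>x. h x - hF F x) = ell1_norm f h - (\<Sum>x\<in>F. f x * \<bar>h x\<bar>)" if "finite F" for F
  proof -
    have "ell1_norm f (\<lambda>x. h x - hF F x) = (\<Sum>\<^sub>\<infinity>x\<in>UNIV - F. f x * \<bar>h x\<bar>)"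
      unfolding ell1_norm_def by (rule infsum_cong_neutral) (auto simp: hF_def)
    also have "\<dots> = ell1_norm f h - (\<Sum>\<^sub>\<infinity>x\<in>F. f x * \<bar>h x\<bar>)"
      unfolding ell1_norm_def using that by (intro infsum_Diff s) auto
    finally show ?thesis using that by simp
  qed
  have "((\<lambda>F. ell1_norm f h - (\<Sum>x\<in>F. f x * \<bar>h x\<bar>)) \<longlongrightarrow> ell1_norm f h - ell1_norm f h) (finite_subsets_at_top UNIV)"
    unfolding ell1_norm_def using has_sum_infsum[OF s] by (intro tendsto_diff tendsto_const) (simp add: has_sum_def)
  then have z: "((\<lambda>F. C * (ell1_norm f h - (\<Sum>x\<in>F. f x * \<bar>h x\<bar>))) \<longlongrightarrow> 0) (finite_subsets_at_top UNIV)"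
    by (intro tendsto_mult_right_zero) simp
  have "((\<lambda>F. (\<Sum>x\<in>F. h x * L (?e x)) - L h) \<longlongrightarrow> 0) (finite_subsets_at_top UNIV)"
  proof (rule Lim_null_comparison[OF _ z])
    show "\<forall>\<^sub>F F in finite_subsets_at_top UNIV. norm ((\<Sum>x\<in>F. h x * L (?e x)) - L h)
        \<le> C * (ell1_norm f h - (\<Sum>x\<in>F. f x * \<bar>h x\<bar>))"
    proof (rule eventually_finite_subsets_at_top_weakI)
      fix F :: "'a set" assume F: "finite F"
      have "\<bar>L (\<lambda>x. h x - hF F x)\<bar> \<le> C * ell1_norm f (\<lambda>x. h x - hF F x)"
        using ell1_lin[OF f h hF[OF F], of 1 "-1"] by (intro bound) simp
      moreover have "L (\<lambda>x. h x - hF F x) = L h - L (hF F)" using lin[OF h hF[OF F], of 1 "-1"] by simp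
      ultimately show "norm ((\<Sum>x\<in>F. h x * L (?e x)) - L h) \<le> C * (ell1_norm f h - (\<Sum>x\<in>F. f x * \<bar>h x\<bar>))"
        using LF[OF F] tail[OF F] by (simp add: abs_minus_commute)
    qed
  qed
  then show ?thesis unfolding has_sum_def using LIM_zero_iff by blast
qed

lemma ell1_norm_indicator: "ell1_norm f (indicator {x}) = f x"
proof -
  have "ell1_norm f (indicator {x}) = (\<Sum>\<^sub>\<infinity>z\<in>{x}. f z)"
    unfolding ell1_norm_def by (rule infsum_cong_neutral) (auto simp: indicator_def)
  then show ?thesis by simp
qed

section \<open>Summing the pointwise expansion against the cost\<close>

context erot_scaled
begin

definition "RX = (\<integral>x. wX x \<partial>measure_pmf r)"
definition "QY j = (\<integral>y. wY y * psi y ^ j \<partial>measure_pmf s)"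

lemma wX_nonneg: "0 \<le> wX x" and wY_nonneg: "0 \<le> wY y"
  using wX_ge1[of x] wY_ge1[of y] by linarith+

lemma RX_nonneg: "0 \<le> RX" unfolding RX_def by (intro Bochner_Integration.integral_nonneg wX_nonneg)

lemma QY_nonneg: "0 \<le> QY j"
  unfolding QY_def using psi_pos wY_nonneg
  by (intro Bochner_Integration.integral_nonneg mult_nonneg_nonneg) (auto intro: less_imp_le)

text \<open>Both weights are at least 1, so a sum of weights is at most twice their product; the
  product form is what lets double sums factorise.\<close>

lemma abs_c_le_prod: "\<bar>c (x, y)\<bar> \<le> 2 * wX x * wY y"
proof -
  have "wX x \<le> wX x * wY y" using mult_left_mono[OF wY_ge1[of y] wX_nonneg[of x]] by simp
  moreover have "wY y \<le> wX x * wY y" using mult_right_mono[OF wX_ge1[of x] wY_nonneg[of y]] by simp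
  ultimately show ?thesis using abs_c_le[of "(x, y)"] by simp
qed

lemma wX_r_summable: "(\<lambda>x. wX x * pmf r x) summable_on UNIV" "(\<Sum>\<^sub>\<infinity>x. wX x * pmf r x) = RX"
  using rX unfolding RX_def by (simp_all add: integrable_measure_pmf_iff_summable_on integral_measure_pmf_infsum mult.commute)

text \<open>The common majorant of all error terms on pairs. The derivative uses
  \<open>j = 2\<close> with coefficients \<open>1\<close> and \<open>nX h\<close>, the quadratic
  remainder \<open>j = 3\<close> with \<open>N\<close> and \<open>N\<^sup>2\<close>.\<close>

lemma product_majorant:
  assumes h: "h \<in> ell1 wX" and j: "j \<le> 4"
  shows "(\<lambda>(x, y). K * ((wX x * (t * \<bar>h x\<bar> + t' * pmf r x)) * (pmf s y * (wY y * psi y ^ j)))) summable_on UNIV"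
    and "(\<Sum>\<^sub>\<infinity>(x, y). K * ((wX x * (t * \<bar>h x\<bar> + t' * pmf r x)) * (pmf s y * (wY y * psi y ^ j))))
      = K * ((t * nX h + t' * RX) * QY j)"
proof -
  have hs: "(\<lambda>x. wX x * \<bar>h x\<bar>) summable_on UNIV" using h by (simp add: ell1_def)
  have e: "(\<lambda>x. wX x * (t * \<bar>h x\<bar> + t' * pmf r x)) = (\<lambda>x. t * (wX x * \<bar>h x\<bar>) + t' * (wX x * pmf r x))"
    by (auto simp: algebra_simps)
  have 1: "(\<lambda>x. wX x * (t * \<bar>h x\<bar> + t' * pmf r x)) summable_on UNIV"
    unfolding e by (intro summable_on_add summable_on_cmult_right hs wX_r_summable)
  have s1: "(\<Sum>\<^sub>\<infinity>x. wX x * (t * \<bar>h x\<bar> + t' * pmf r x)) = t * nX h + t' * RX"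
    unfolding e by (subst infsum_add)
      (auto intro!: summable_on_cmult_right hs wX_r_summable simp: infsum_cmult_right' wX_r_summable ell1_norm_def)
  have 2: "(\<lambda>y. pmf s y * (wY y * psi y ^ j)) summable_on UNIV"
    using wY_psi_power[OF j] by (simp add: integrable_measure_pmf_iff_summable_on)
  have s2: "(\<Sum>\<^sub>\<infinity>y. pmf s y * (wY y * psi y ^ j)) = QY j"
    unfolding QY_def by (simp add: integral_measure_pmf_infsum)
  have 3: "(\<lambda>(x, y). K * ((wX x * (t * \<bar>h x\<bar> + t' * pmf r x)) * (pmf s y * (wY y * psi y ^ j))))
     = (\<lambda>z. K * (case z of (x, y) \<Rightarrow> (wX x * (t * \<bar>h x\<bar> + t' * pmf r x)) * (pmf s y * (wY y * psi y ^ j))))"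
    by auto
  show "(\<lambda>(x, y). K * ((wX x * (t * \<bar>h x\<bar> + t' * pmf r x)) * (pmf s y * (wY y * psi y ^ j)))) summable_on UNIV"
    unfolding 3 by (intro summable_on_cmult_right summable_on_times 1 2)
  show "(\<Sum>\<^sub>\<infinity>(x, y). K * ((wX x * (t * \<bar>h x\<bar> + t' * pmf r x)) * (pmf s y * (wY y * psi y ^ j))))
      = K * ((t * nX h + t' * RX) * QY j)"
    unfolding 3 infsum_cmult_right' infsum_times[OF 1 2] s1 s2 ..
qed

definition "CL = 2 * CD * ((1 + RX) * QY 2)"

lemma CD_nonneg: "0 \<le> CD" using CA_nonneg Umax_pos by (simp add: CD_def)

lemma CL_nonneg: "0 \<le> CL" using CD_nonneg RX_nonneg QY_nonneg by (simp add: CL_def)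

lemma c_Dp_summable:
  assumes h: "h \<in> ell1 wX"
  shows "(\<lambda>z. \<bar>c z * Dp h z\<bar>) summable_on UNIV" "(\<Sum>\<^sub>\<infinity>z. \<bar>c z * Dp h z\<bar>) \<le> CL * nX h"
proof -
  let ?G = "\<lambda>(x, y). 2 * CD * ((wX x * (1 * \<bar>h x\<bar> + nX h * pmf r x)) * (pmf s y * (wY y * psi y ^ 2)))"
  have G: "\<bar>c z * Dp h z\<bar> \<le> ?G z" for z
  proof -
    obtain x y where z: "z = (x, y)" by (cases z)
    have "\<bar>c (x, y)\<bar> * \<bar>Dp h (x, y)\<bar> \<le> (2 * wX x * wY y) *
        (CD * (pmf s y * psi y ^ 2 * \<bar>h x\<bar> + pmf r x * (pmf s y * psi y ^ 2) * nX h))"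
      by (intro mult_mono abs_c_le_prod Dp_bound[OF h]) (auto intro!: mult_nonneg_nonneg wX_nonneg wY_nonneg)
    then show ?thesis by (simp add: z abs_mult algebra_simps)
  qed
  show s: "(\<lambda>z. \<bar>c z * Dp h z\<bar>) summable_on UNIV"
    by (rule summable_on_real_bound[OF product_majorant(1)[OF h, of 2 "2 * CD" 1 "nX h"]]) (use G in auto)
  have "(\<Sum>\<^sub>\<infinity>z. \<bar>c z * Dp h z\<bar>) \<le> infsum ?G UNIV"
    by (rule infsum_mono[OF s product_majorant(1)[OF h, of 2 "2 * CD" 1 "nX h"]]) (use G in auto)
  also have "\<dots> = CL * nX h"
    by (subst product_majorant(2)[OF h]) (auto simp: CL_def algebra_simps)
  finally show "(\<Sum>\<^sub>\<infinity>z. \<bar>c z * Dp h z\<bar>) \<le> CL * nX h" .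
qed

definition "Lc h = (\<Sum>\<^sub>\<infinity>z. c z * Dp h z)"
text \<open>The influence function of the Sinkhorn cost in its first argument: \<open>Lc h\<close>
  is the sum of \<open>h x * vX x\<close> for every \<open>h\<close> of finite norm.\<close>

definition "vX x = Lc (indicator {x})"

lemma c_Dp_summable': "h \<in> ell1 wX \<Longrightarrow> (\<lambda>z. c z * Dp h z) summable_on UNIV"
  by (rule summable_on_real_bound[OF c_Dp_summable(1)]) auto

lemma Lc_bound: "h \<in> ell1 wX \<Longrightarrow> \<bar>Lc h\<bar> \<le> CL * nX h"
  unfolding Lc_def by (rule order_trans[OF abs_infsum_le[OF c_Dp_summable(1)] c_Dp_summable(2)]) auto

lemma Lc_lin:
  assumes h: "h \<in> ell1 wX" "h' \<in> ell1 wX"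
  shows "Lc (\<lambda>x. t * h x + t' * h' x) = t * Lc h + t' * Lc h'"
proof -
  have "Lc (\<lambda>x. t * h x + t' * h' x) = (\<Sum>\<^sub>\<infinity>z. t * (c z * Dp h z) + t' * (c z * Dp h' z))"
    unfolding Lc_def Dp_lin[OF h ell1_lin[OF wX_nonneg h]] by (simp add: algebra_simps)
  also have "\<dots> = t * Lc h + t' * Lc h'"
    unfolding Lc_def
    by (subst infsum_add) (auto intro!: summable_on_cmult_right c_Dp_summable' h simp: infsum_cmult_right')
  finally show ?thesis .
qed

lemma Lc_has_sum: "h \<in> ell1 wX \<Longrightarrow> ((\<lambda>x. h x * vX x) has_sum Lc h) UNIV"
  unfolding vX_def by (rule ell1_linear_has_sum[OF wX_nonneg Lc_lin Lc_bound])

lemma vX_bound: "\<bar>vX x\<bar> \<le> CL * wX x"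
  unfolding vX_def using Lc_bound[OF indicator_ell1[of x]] by (simp add: ell1_norm_indicator)

definition "CE = 2 * C6 * ((RX + 1) * QY 3)"

text \<open>Both plans are scaled plans by \<open>erot_plan_eq\<close>, so the difference of the
  costs is a sum of differences of densities. The pointwise expansion is dominated by a product
  majorant of total mass quadratic in the norm of \<open>r' - r\<close>.\<close>

lemma sinkhorn_expansion:
  assumes r': "integrable (measure_pmf r') wX" "set_pmf r' \<subseteq> set_pmf r"
  shows "\<bar>sinkhorn_cost c lam r' s - sinkhorn_cost c lam r s - (\<Sum>\<^sub>\<infinity>x. (pmf r' x - pmf r x) * vX x)\<bar>
    \<le> CE * (ell1_norm wX (\<lambda>x. pmf r' x - pmf r x))\<^sup>2"
proof -
  obtain u' w' where S': "is_scaling r' u' w'" using scaling_exists by blast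
  define h where "h = (\<lambda>x. pmf r' x - pmf r x)"
  have h: "h \<in> ell1 wX"
  proof -
    have "(\<lambda>x. wX x * pmf r' x) summable_on UNIV"
      using r'(1) by (simp add: integrable_measure_pmf_iff_summable_on mult.commute)
    then have "(\<lambda>x. \<bar>wX x * pmf r' x - wX x * pmf r x\<bar>) summable_on UNIV"
      by (intro summable_on_real_abs summable_on_real_diff wX_r_summable)
    then show ?thesis using wX_nonneg
      by (simp add: ell1_def h_def right_diff_distrib[symmetric] abs_mult)
  qed
  obtain a b where L: "lin_sol h a b" and ab: "\<And>x. \<bar>a x\<bar> \<le> CA * nX h" using lin_sol_exists[OF h] by blast
  have V: "a \<in> VX" "b \<in> VY" "a = AX b" "b = (\<lambda>y. BY h y + AY a y)" using L unfolding lin_sol_def by blast+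
  have bz: "\<And>y. y \<notin> Y1 \<Longrightarrow> b y = 0" using V(2) by (simp add: VY_iff)
  \<comment> \<open>The derivative vanishes outside the support of \<open>r\<close>; the inclusion
    of the supports ensures that the perturbation carries nothing there either.\<close>
  have h0: "h x = 0" "pmf r x = 0" "pmf r' x = 0" if "x \<notin> set_pmf r" for x
    using that r'(2) by (auto simp: h_def set_pmf_iff)
  define N where "N = pmf_dist r r'"
  have N: "0 \<le> N" "N \<le> nX h"
    using pmf_dist_nonneg[of r r'] ell1_abs_summable(2)[OF h] by (auto simp: N_def pmf_dist_def h_def)
  define p' where "p' = (\<lambda>x y. u' x * kern x y * w' y)"
  have exp: "\<bar>pmf r' x * p' x y - pmf r x * p x y - (h x * p x y + pmf r x * p x y * (a x + - b y))\<bar>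
    \<le> C6 * psi y ^ 3 * (pmf r x * N\<^sup>2 + \<bar>h x\<bar> * N)" if xy: "x \<in> set_pmf r" "y \<in> set_pmf s" for x y
    unfolding p'_def p_eq N_def h_def
  \<comment> \<open>Instantiated with \<open>al = a\<close> and \<open>be = - b\<close>: in
    \<open>lin_sol\<close> the second unknown has the opposite sign.\<close>
  proof (rule scaling_expansion[OF S S' _ _ _ _ xy, where Ba="CA * nX h"])
    show "a x = - (\<integral>y. u x * kern x y * w y * - b y \<partial>measure_pmf s)" if "x \<in> set_pmf r" for x
    proof -
      have "a x = AX b x" using fun_cong[OF V(3)] .
      also have "\<dots> = (\<integral>y. p x y * b y \<partial>measure_pmf s)" using AX_eq[where b=b and x=x, OF bz] that by simp
      finally show ?thesis by (simp add: p_eq)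
    qed
    show "- b y1 = 0" using bz by (simp add: Y1_def)
    show "- b y = - (\<integral>x. u x * kern x y * w y * a x \<partial>measure_pmf r)
        - (\<Sum>\<^sub>\<infinity>x. (pmf r' x - pmf r x) * (u x * kern x y * w y))" if "y \<in> set_pmf s" "y \<noteq> y1" for y
    proof -
      have y: "y \<in> Y1" using that by (simp add: Y1_def)
      have "(\<Sum>\<^sub>\<infinity>x. (pmf r' x - pmf r x) * (u x * kern x y * w y)) = (\<Sum>\<^sub>\<infinity>x\<in>set_pmf r. p x y * h x)"
        by (rule infsum_cong_neutral) (use h0 in \<open>auto simp: h_def p_eq\<close>)
      then show ?thesis using fun_cong[OF V(4), of y] y unfolding AY_eq BY_eq by (simp add: p_eq)
    qed
  qed (rule ab)
  let ?E = "\<lambda>(x, y). c (x, y) * (pmf r' x * pmf s y * dens u' w' (x, y)) - c (x, y) * (pmf r x * pmf s y * dens u w (x, y))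
      - c (x, y) * Dp h (x, y)"
  let ?G = "\<lambda>(x, y). 2 * C6 * ((wX x * (N * \<bar>h x\<bar> + N\<^sup>2 * pmf r x)) * (pmf s y * (wY y * psi y ^ 3)))"
  have EG: "\<bar>?E z\<bar> \<le> ?G z" for z
  proof -
    obtain x y where z: "z = (x, y)" by (cases z)
    have G0: "0 \<le> ?G (x, y)"
      unfolding split_conv using C_nonneg N psi_pos[of y]
      by (intro mult_nonneg_nonneg add_nonneg_nonneg wX_nonneg wY_nonneg zero_le_power) (auto intro: less_imp_le)
    show ?thesis
    proof (cases "x \<in> set_pmf r \<and> y \<in> set_pmf s")
      case True
      define dd where "dd = pmf r' x * p' x y - pmf r x * p x y - (h x * p x y + pmf r x * p x y * (a x + - b y))"
      have "?E (x, y) = c (x, y) * (pmf s y * dd)"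
        using True unfolding lin_sol_erot_deriv[OF h L] dd_def
        by (simp add: p'_def p_def dens_def algebra_simps)
      then have "\<bar>?E (x, y)\<bar> = \<bar>c (x, y)\<bar> * (pmf s y * \<bar>dd\<bar>)"
        by (simp only: abs_mult abs_of_nonneg[OF pmf_nonneg])
      also have "\<dots> \<le> (2 * wX x * wY y) * (pmf s y * (C6 * psi y ^ 3 * (pmf r x * N\<^sup>2 + \<bar>h x\<bar> * N)))"
      proof (rule mult_mono[OF abs_c_le_prod mult_left_mono])
        show "\<bar>dd\<bar> \<le> C6 * psi y ^ 3 * (pmf r x * N\<^sup>2 + \<bar>h x\<bar> * N)"
          unfolding dd_def using True by (intro exp) auto
        show "0 \<le> 2 * wX x * wY y" using wX_nonneg wY_nonneg by simp
      qed (intro pmf_nonneg mult_nonneg_nonneg abs_ge_zero)+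
      also have "\<dots> = 2 * C6 * ((wX x * (N * \<bar>h x\<bar> + N\<^sup>2 * pmf r x)) * (pmf s y * (wY y * psi y ^ 3)))"
      proof -
        have "(2 * A * B) * (q * (C * P * (ra * M + H * N))) = 2 * C * ((A * (N * H + M * ra)) * (q * (B * P)))"
          for A B q C P ra M H N :: real
          by algebra
        then show ?thesis .
      qed
      finally show ?thesis unfolding z split_conv .
    next
      case False
      then have "?E (x, y) = 0"
        unfolding lin_sol_erot_deriv[OF h L] by (auto simp: h0 set_pmf_iff)
      then show ?thesis using G0 by (simp add: z)
    qed
  qed
  note c' = sinkhorn_cost_eq[OF S' r'(1)] and c0 = sinkhorn_cost_eq[OF S rX]
  note cD = c_Dp_summable'[OF h]
  have "?E = (\<lambda>z. ((\<lambda>(x, y). c (x, y) * (pmf r' x * pmf s y * dens u' w' (x, y))) z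
      - (\<lambda>(x, y). c (x, y) * (pmf r x * pmf s y * dens u w (x, y))) z) - c z * Dp h z)"
    by (rule ext) (simp only: case_prod_unfold prod.collapse)
  then have "infsum ?E UNIV = sinkhorn_cost c lam r' s - sinkhorn_cost c lam r s - Lc h"
    unfolding c'(2) c0(2) Lc_def
    by (simp only: infsum_real_diff[OF summable_on_real_diff[OF c'(1) c0(1)] cD] infsum_real_diff[OF c'(1) c0(1)])
  moreover have "\<bar>infsum ?E UNIV\<bar> \<le> infsum ?G UNIV"
    by (rule abs_infsum_le[OF product_majorant(1)[OF h, of 3 "2 * C6" N "N\<^sup>2"]]) (use EG in auto)
  moreover have "infsum ?G UNIV = 2 * C6 * ((N * nX h + N\<^sup>2 * RX) * QY 3)"
    by (rule product_majorant(2)[OF h]) simp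
  moreover have "2 * C6 * ((N * nX h + N\<^sup>2 * RX) * QY 3) \<le> 2 * C6 * ((nX h * nX h + (nX h)\<^sup>2 * RX) * QY 3)"
    using C_nonneg N nX_nonneg[of h] RX_nonneg QY_nonneg[of 3]
    by (intro mult_left_mono mult_right_mono add_mono power_mono) auto
  moreover have "\<dots> = CE * (nX h)\<^sup>2" by (simp add: CE_def power2_eq_square algebra_simps)
  moreover have "Lc h = (\<Sum>\<^sub>\<infinity>x. (pmf r' x - pmf r x) * vX x)"
    using infsumI[OF Lc_has_sum[OF h]] by (simp add: h_def)
  ultimately show ?thesis by (simp add: h_def)
qed

end

section \<open>The limiting variance\<close>

text \<open>Fubini for the product of a counting measure and \<open>M\<close>; countability of the
  index type gives joint measurability and sigma-finiteness. The third clause yields almost sure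
  convergence of random series.\<close>

lemma expectation_infsum:
  fixes f :: "'i::countable \<Rightarrow> 'w \<Rightarrow> real"
  assumes M: "sigma_finite_measure M" and f: "\<And>i. integrable M (f i)"
    and s: "(\<lambda>i. \<integral>w. \<bar>f i w\<bar> \<partial>M) summable_on UNIV"
  shows "integrable M (\<lambda>w. \<Sum>\<^sub>\<infinity>i. f i w)"
    and "(\<integral>w. (\<Sum>\<^sub>\<infinity>i. f i w) \<partial>M) = (\<Sum>\<^sub>\<infinity>i. \<integral>w. f i w \<partial>M)"
    and "AE w in M. (\<lambda>i. f i w) summable_on UNIV"
proof -
  interpret C: sigma_finite_measure "count_space (UNIV :: 'i set)"
    by (rule sigma_finite_measure_count_space)
  interpret M: sigma_finite_measure M by fact
  interpret pair_sigma_finite "count_space (UNIV :: 'i set)" M ..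
  have m: "(\<lambda>(i, w). f i w) \<in> borel_measurable (count_space UNIV \<Otimes>\<^sub>M M)"
    by (rule measurable_pair_measure_countable1) (use f in \<open>auto intro: borel_measurable_integrable\<close>)
  have i: "integrable (count_space UNIV \<Otimes>\<^sub>M M) (\<lambda>(i, w). f i w)"
    by (rule Fubini_integrable[OF m])
       (use s f in \<open>auto simp: summable_on_iff_integrable_count_space\<close>)
  show "integrable M (\<lambda>w. \<Sum>\<^sub>\<infinity>i. f i w)"
    unfolding infsum_eq_integral_count_space using integrable_snd[OF i] .
  show "(\<integral>w. (\<Sum>\<^sub>\<infinity>i. f i w) \<partial>M) = (\<Sum>\<^sub>\<infinity>i. \<integral>w. f i w \<partial>M)"
    unfolding infsum_eq_integral_count_space by (rule Fubini_integral[OF i])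
  show "AE w in M. (\<lambda>i. f i w) summable_on UNIV"
    unfolding summable_on_iff_integrable_count_space using AE_integrable_snd[OF i] .
qed

text \<open>The Cauchy-Schwarz inequality, obtained from the weighted inequality
  \<open>2 * \<bar>f * g\<bar> \<le> t * f\<^sup>2 + g\<^sup>2 / t\<close>. Taking
  \<open>g = 1\<close> gives first moments from second ones.\<close>

lemma expectation_abs_mult_le:
  fixes f g :: "'w \<Rightarrow> real"
  assumes [measurable]: "f \<in> borel_measurable M" "g \<in> borel_measurable M"
    and f: "integrable M (\<lambda>w. (f w)\<^sup>2)" "(\<integral>w. (f w)\<^sup>2 \<partial>M) \<le> a\<^sup>2" and a: "0 \<le> a"
    and g: "integrable M (\<lambda>w. (g w)\<^sup>2)" "(\<integral>w. (g w)\<^sup>2 \<partial>M) \<le> b\<^sup>2" and b: "0 \<le> b"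
  shows "integrable M (\<lambda>w. f w * g w)" "(\<integral>w. \<bar>f w * g w\<bar> \<partial>M) \<le> a * b"
proof -
  have i: "integrable M (\<lambda>w. ((f w)\<^sup>2 + (g w)\<^sup>2) / 2)" using f g by simp
  have am: "\<bar>f w * g w\<bar> \<le> ((f w)\<^sup>2 + (g w)\<^sup>2) / 2" for w
  proof -
    have "0 \<le> (\<bar>f w\<bar> - \<bar>g w\<bar>)\<^sup>2" by simp
    then show ?thesis by (simp add: power2_diff abs_mult)
  qed
  show fg: "integrable M (\<lambda>w. f w * g w)"
    by (rule Bochner_Integration.integrable_bound[OF i]) (use am in auto)
  have *: "(\<integral>w. \<bar>f w * g w\<bar> \<partial>M) \<le> (a + e) * (b + e)" if e: "0 < e" for e
  proof -
    \<comment> \<open>The optimal weight is \<open>b / a\<close>; the shift by \<open>e\<close>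
      keeps it positive and finite when \<open>a\<close> or \<open>b\<close> is 0, and
      \<open>e\<close> tends to 0 afterwards.\<close>
    define t where "t = (b + e) / (a + e)"
    have t: "0 < t" using a b e by (simp add: t_def)
    have "\<bar>f w * g w\<bar> \<le> (t * (f w)\<^sup>2 + (g w)\<^sup>2 / t) / 2" for w
    proof -
      have "0 \<le> (sqrt t * \<bar>f w\<bar> - \<bar>g w\<bar> / sqrt t)\<^sup>2" by simp
      then show ?thesis using t by (simp add: power2_diff abs_mult power_mult_distrib power_divide)
    qed
    then have "(\<integral>w. \<bar>f w * g w\<bar> \<partial>M) \<le> (\<integral>w. (t * (f w)\<^sup>2 + (g w)\<^sup>2 / t) / 2 \<partial>M)"
      by (intro integral_mono) (use fg f g in auto)
    also have "\<dots> = (t * (\<integral>w. (f w)\<^sup>2 \<partial>M) + (\<integral>w. (g w)\<^sup>2 \<partial>M) / t) / 2" using f g by simp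
    also have "\<dots> \<le> (t * (a + e)\<^sup>2 + (b + e)\<^sup>2 / t) / 2"
    proof -
      have "a\<^sup>2 \<le> (a + e)\<^sup>2" "b\<^sup>2 \<le> (b + e)\<^sup>2" using a b e by (auto intro!: power_mono)
      then show ?thesis using t f(2) g(2)
        by (intro divide_right_mono add_mono mult_left_mono) (auto intro: divide_right_mono)
    qed
    also have "\<dots> = (a + e) * (b + e)"
    proof -
      have "B / A * A\<^sup>2 = A * B" "B\<^sup>2 / (B / A) = A * B" if "0 < A" "0 < B" for A B :: real
        using that by (simp_all add: power2_eq_square)
      from this[of "a + e" "b + e"] show ?thesis using a b e by (simp add: t_def)
    qed
    finally show ?thesis .
  qed
  have "((\<lambda>e. (a + e) * (b + e)) \<longlongrightarrow> (a + 0) * (b + 0)) (at_right 0)"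
    by (intro tendsto_intros)
  then show "(\<integral>w. \<bar>f w * g w\<bar> \<partial>M) \<le> a * b"
    using * by (intro tendsto_lowerbound[of _ "a * b" "at_right 0"]) (auto intro!: eventually_at_rightI[of 0 1])
qed

lemma summable_on_square:
  fixes a :: "'a \<Rightarrow> real"
  assumes "a summable_on UNIV"
  shows "(\<lambda>x. (a x)\<^sup>2) summable_on UNIV"
proof (rule summable_on_real_bound)
  show "(\<lambda>x. (\<Sum>\<^sub>\<infinity>z. \<bar>a z\<bar>) * \<bar>a x\<bar>) summable_on UNIV"
    by (intro summable_on_cmult_right summable_on_real_abs assms)
  fix x
  have "\<bar>a x\<bar> = (\<Sum>\<^sub>\<infinity>z\<in>{x}. \<bar>a z\<bar>)" by simp
  also have "\<dots> \<le> (\<Sum>\<^sub>\<infinity>z. \<bar>a z\<bar>)"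
    by (rule infsum_mono2) (use summable_on_real_abs[OF assms] in auto)
  finally show "\<bar>(a x)\<^sup>2\<bar> \<le> (\<Sum>\<^sub>\<infinity>z. \<bar>a z\<bar>) * \<bar>a x\<bar>"
    using mult_right_mono[of "\<bar>a x\<bar>" "(\<Sum>\<^sub>\<infinity>z. \<bar>a z\<bar>)" "\<bar>a x\<bar>"] by (simp add: power2_eq_square)
qed

text \<open>By Cauchy-Schwarz the mixed absolute moment of two coordinates is at most
  \<open>q x * q x'\<close>, so the family of products is dominated by a summable product and the
  expectation may be taken term by term.\<close>

lemma second_moment_infsum:
  fixes G :: "'x::countable \<Rightarrow> 'w \<Rightarrow> real" and q a b :: "'x \<Rightarrow> real"
  assumes P: "prob_space P" and [measurable]: "\<And>x. G x \<in> borel_measurable P"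
    and G: "\<And>x. integrable P (\<lambda>w. (G x w)\<^sup>2)" "\<And>x. (\<integral>w. (G x w)\<^sup>2 \<partial>P) \<le> (q x)\<^sup>2" and q: "\<And>x. 0 \<le> q x"
    and a: "(\<lambda>x. \<bar>a x\<bar> * q x) summable_on UNIV" and b: "(\<lambda>x. \<bar>b x\<bar> * q x) summable_on UNIV"
    and sa: "\<And>w. w \<in> space P \<Longrightarrow> (\<lambda>x. G x w * a x) summable_on UNIV"
    and sb: "\<And>w. w \<in> space P \<Longrightarrow> (\<lambda>x. G x w * b x) summable_on UNIV"
  shows "(\<integral>w. (\<Sum>\<^sub>\<infinity>x. G x w * a x) * (\<Sum>\<^sub>\<infinity>x. G x w * b x) \<partial>P)
      = (\<Sum>\<^sub>\<infinity>(x, x'). a x * b x' * (\<integral>w. G x w * G x' w \<partial>P))"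
    and "(\<integral>w. (\<Sum>\<^sub>\<infinity>x. G x w * a x) \<partial>P) = (\<Sum>\<^sub>\<infinity>x. a x * (\<integral>w. G x w \<partial>P))"
proof -
  interpret prob_space P by fact
  note CS = expectation_abs_mult_le[OF _ _ G(1) G(2) q G(1) G(2) q]
  have one: "integrable P (\<lambda>w. 1\<^sup>2 :: real)" "(\<integral>w. 1\<^sup>2 \<partial>P) \<le> (1::real)\<^sup>2" by (auto simp: prob_space)
  have G1: "integrable P (G x)" "(\<integral>w. \<bar>G x w\<bar> \<partial>P) \<le> q x" for x
    using expectation_abs_mult_le[OF _ _ G(1) G(2) q one, of x] by auto
  define F where "F = (\<lambda>z w. (G (fst z) w * a (fst z)) * (G (snd z) w * b (snd z)))"
  have Fi: "integrable P (F z)" for z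
  proof -
    have "integrable P (\<lambda>w. (a (fst z) * b (snd z)) * (G (fst z) w * G (snd z) w))"
      by (intro integrable_mult_right CS(1)) auto
    then show ?thesis by (simp add: F_def mult_ac)
  qed
  have Fb: "(\<integral>w. \<bar>F z w\<bar> \<partial>P) \<le> (\<bar>a (fst z)\<bar> * q (fst z)) * (\<bar>b (snd z)\<bar> * q (snd z))" for z
  proof -
    have "(\<integral>w. \<bar>F z w\<bar> \<partial>P) = (\<integral>w. (\<bar>a (fst z)\<bar> * \<bar>b (snd z)\<bar>) * \<bar>G (fst z) w * G (snd z) w\<bar> \<partial>P)"
      by (simp add: F_def abs_mult mult_ac)
    also have "\<dots> = (\<bar>a (fst z)\<bar> * \<bar>b (snd z)\<bar>) * (\<integral>w. \<bar>G (fst z) w * G (snd z) w\<bar> \<partial>P)" by simp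
    also have "\<dots> \<le> (\<bar>a (fst z)\<bar> * \<bar>b (snd z)\<bar>) * (q (fst z) * q (snd z))"
      by (intro mult_left_mono CS(2)) auto
    finally show ?thesis by (simp add: mult_ac)
  qed
  have Fs: "(\<lambda>z. \<integral>w. \<bar>F z w\<bar> \<partial>P) summable_on UNIV"
    by (rule summable_on_real_bound[OF summable_on_times[OF a b]])
       (use Fb in \<open>auto simp: case_prod_unfold\<close>)
  have "(\<integral>w. (\<Sum>\<^sub>\<infinity>x. G x w * a x) * (\<Sum>\<^sub>\<infinity>x. G x w * b x) \<partial>P) = (\<integral>w. (\<Sum>\<^sub>\<infinity>z. F z w) \<partial>P)"
  proof (rule Bochner_Integration.integral_cong[OF refl])
    fix w assume "w \<in> space P"
    then show "(\<Sum>\<^sub>\<infinity>x. G x w * a x) * (\<Sum>\<^sub>\<infinity>x. G x w * b x) = (\<Sum>\<^sub>\<infinity>z. F z w)"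
      using infsum_times[OF sa sb, of w w] by (simp add: F_def case_prod_unfold)
  qed
  also have "\<dots> = (\<Sum>\<^sub>\<infinity>z. \<integral>w. F z w \<partial>P)"
    by (rule expectation_infsum(2)[OF _ Fi Fs]) unfold_locales
  also have "\<dots> = (\<Sum>\<^sub>\<infinity>(x, x'). a x * b x' * (\<integral>w. G x w * G x' w \<partial>P))"
  proof (rule infsum_cong)
    fix z :: "'x \<times> 'x"
    have "(\<integral>w. F z w \<partial>P) = (\<integral>w. (a (fst z) * b (snd z)) * (G (fst z) w * G (snd z) w) \<partial>P)"
      by (simp add: F_def mult_ac)
    then show "(\<integral>w. F z w \<partial>P) = (case z of (x, x') \<Rightarrow> a x * b x' * (\<integral>w. G x w * G x' w \<partial>P))"
      by (simp add: case_prod_unfold)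
  qed
  finally show "(\<integral>w. (\<Sum>\<^sub>\<infinity>x. G x w * a x) * (\<Sum>\<^sub>\<infinity>x. G x w * b x) \<partial>P)
      = (\<Sum>\<^sub>\<infinity>(x, x'). a x * b x' * (\<integral>w. G x w * G x' w \<partial>P))" .
  have "(\<integral>w. (\<Sum>\<^sub>\<infinity>x. G x w * a x) \<partial>P) = (\<Sum>\<^sub>\<infinity>x. \<integral>w. G x w * a x \<partial>P)"
  proof (rule expectation_infsum(2))
    show "(\<lambda>x. \<integral>w. \<bar>G x w * a x\<bar> \<partial>P) summable_on UNIV"
      by (rule summable_on_real_bound[OF a])
         (auto simp: abs_mult mult.commute[of _ "\<bar>a _\<bar>"] intro!: mult_left_mono G1)
  qed (use G1 in \<open>auto intro: sigma_finite_measure_axioms\<close>)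
  then show "(\<integral>w. (\<Sum>\<^sub>\<infinity>x. G x w * a x) \<partial>P) = (\<Sum>\<^sub>\<infinity>x. a x * (\<integral>w. G x w \<partial>P))"
    by (simp add: mult.commute)
qed

lemma summable_on_diagonal:
  fixes f :: "'a \<Rightarrow> real"
  assumes "f summable_on UNIV"
  shows "(\<lambda>(x, x'). if x = x' then f x else 0) summable_on UNIV"
    and "(\<Sum>\<^sub>\<infinity>(x, x'). if x = x' then f x else 0) = infsum f UNIV"
proof -
  have inj: "inj (\<lambda>x. (x, x))" by (auto intro: injI)
  have "((\<lambda>(x, x'). if x = x' then f x else 0) has_sum infsum f UNIV) (range (\<lambda>x. (x, x)))"
    using has_sum_reindex[OF inj, of "\<lambda>(x, x'). if x = x' then f x else 0" "infsum f UNIV"]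
      has_sum_infsum[OF assms] by (simp add: o_def)
  then have "((\<lambda>(x, x'). if x = x' then f x else 0) has_sum infsum f UNIV) UNIV"
    by (rule has_sum_cong_neutral[THEN iffD1, rotated -1]) auto
  then show "(\<lambda>(x, x'). if x = x' then f x else 0) summable_on UNIV"
    "(\<Sum>\<^sub>\<infinity>(x, x'). if x = x' then f x else 0) = infsum f UNIV"
    by (auto simp: summable_on_def dest: infsumI)
qed

lemma multinomial_cov_eq: "multinomial_cov r x x' = (if x = x' then pmf r x else 0) - pmf r x * pmf r x'"
  by (simp add: multinomial_cov_def algebra_simps)

text \<open>The covariance is a diagonal minus the rank one term \<open>pmf r x * pmf r x'\<close>.
  The diagonal contributes the second moment and the rank one term the squared mean: the form is the
  variance of \<open>v\<close> under \<open>r\<close>.\<close>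

lemma multinomial_cov_quadratic:
  fixes v :: "'x \<Rightarrow> real"
  assumes "integrable (measure_pmf r) v" "integrable (measure_pmf r) (\<lambda>x. (v x)\<^sup>2)"
  shows "(\<lambda>(x, x'). v x * v x' * multinomial_cov r x x') summable_on UNIV"
    and "(\<Sum>\<^sub>\<infinity>(x, x'). v x * v x' * multinomial_cov r x x')
      = (\<integral>x. (v x)\<^sup>2 \<partial>measure_pmf r) - (\<integral>x. v x \<partial>measure_pmf r)\<^sup>2"
proof -
  have 1: "(\<lambda>x. pmf r x * (v x)\<^sup>2) summable_on UNIV" and 2: "(\<lambda>x. pmf r x * v x) summable_on UNIV"
    using assms by (simp_all add: integrable_measure_pmf_iff_summable_on)
  have e: "(\<lambda>(x, x'). v x * v x' * multinomial_cov r x x') = (\<lambda>z. (\<lambda>(x, x'). if x = x' then pmf r x * (v x)\<^sup>2 else 0) z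
      - (\<lambda>(x, x'). (pmf r x * v x) * (pmf r x' * v x')) z)"
    by (auto simp: multinomial_cov_eq power2_eq_square algebra_simps)
  show "(\<lambda>(x, x'). v x * v x' * multinomial_cov r x x') summable_on UNIV"
    unfolding e by (rule summable_on_real_diff[OF summable_on_diagonal(1)[OF 1] summable_on_times[OF 2 2]])
  show "(\<Sum>\<^sub>\<infinity>(x, x'). v x * v x' * multinomial_cov r x x')
      = (\<integral>x. (v x)\<^sup>2 \<partial>measure_pmf r) - (\<integral>x. v x \<partial>measure_pmf r)\<^sup>2"
    unfolding e infsum_real_diff[OF summable_on_diagonal(1)[OF 1] summable_on_times[OF 2 2]]
      summable_on_diagonal(2)[OF 1] infsum_times[OF 2 2]
    by (simp add: integral_measure_pmf_infsum power2_eq_square)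
qed

section \<open>Centred normal laws and coordinates of random sequences\<close>

lemma normal_law_moments:
  assumes v: "0 \<le> v"
  shows "real_distribution (normal_law 0 v)"
    "integrable (normal_law 0 v) (\<lambda>x. x)" "(\<integral>x. x \<partial>normal_law 0 v) = 0"
    "integrable (normal_law 0 v) (\<lambda>x. x\<^sup>2)" "(\<integral>x. x\<^sup>2 \<partial>normal_law 0 v) = v"
    "char (normal_law 0 v) t = complex_of_real (exp (- (v * t\<^sup>2) / 2))"
proof -
  interpret N: real_distribution std_normal_distribution by (rule real_dist_normal_dist)
  have m: "(\<lambda>z. sqrt v * z) \<in> borel_measurable std_normal_distribution" by simp
  have e: "normal_law 0 v = distr std_normal_distribution borel (\<lambda>z. sqrt v * z)" by (simp add: normal_law_def)
  show "real_distribution (normal_law 0 v)" unfolding e by (rule N.real_distribution_distr[OF m])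
  have i: "integrable std_normal_distribution (\<lambda>x. x)" "integrable std_normal_distribution (\<lambda>x. x\<^sup>2)"
    using integrable_std_normal_distribution_moment[of 1] integrable_std_normal_distribution_moment[of 2] by auto
  show "integrable (normal_law 0 v) (\<lambda>x. x)"
    unfolding e by (subst integrable_distr_eq[OF m]) (simp, rule integrable_mult_right[OF i(1)])
  show "integrable (normal_law 0 v) (\<lambda>x. x\<^sup>2)"
    unfolding e by (subst integrable_distr_eq[OF m])
      (simp, unfold power_mult_distrib, rule integrable_mult_right[OF i(2)])
  show "(\<integral>x. x \<partial>normal_law 0 v) = 0"
    unfolding e by (subst integral_distr[OF m]) (use integral_std_normal_distribution_moment_odd[of 1] in auto)
  show "(\<integral>x. x\<^sup>2 \<partial>normal_law 0 v) = v"
    unfolding e by (subst integral_distr[OF m])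
      (use std_normal_distribution_even_moments(1)[of 1] v in \<open>auto simp: power_mult_distrib\<close>)
  have "char (normal_law 0 v) t = char std_normal_distribution (t * sqrt v)"
    unfolding e char_def by (subst integral_distr[OF m]) (simp_all add: mult_ac)
  then show "char (normal_law 0 v) t = complex_of_real (exp (- (v * t\<^sup>2) / 2))"
    using v by (simp add: char_std_normal_distribution power_mult_distrib mult.commute)
qed

lemma ell1_coordinate_le:
  assumes "h \<in> ell1 f" "\<And>x. 0 \<le> f x"
  shows "f x * \<bar>h x\<bar> \<le> ell1_norm f h"
proof -
  have s: "(\<lambda>x. f x * \<bar>h x\<bar>) summable_on UNIV" using assms(1) by (simp add: ell1_def)
  have "f x * \<bar>h x\<bar> = (\<Sum>\<^sub>\<infinity>x\<in>{x}. f x * \<bar>h x\<bar>)" by simp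
  also have "\<dots> \<le> ell1_norm f h"
    unfolding ell1_norm_def by (rule infsum_mono2) (use s assms(2) in auto)
  finally show ?thesis .
qed

lemma space_ell1_borel: "space (ell1_borel f) = ell1 f"
  by (simp add: ell1_borel_def space_measure_of_conv)

lemma sets_ell1_borelI:
  assumes f: "\<And>x. 0 < f x" and U: "openin (ell1_topology f) U"
  shows "U \<in> sets (ell1_borel f)"
proof -
  interpret Metric_space "ell1 f" "\<lambda>a b. ell1_norm f (\<lambda>z. a z - b z)" by (rule Metric_space_ell1[OF f])
  have "{U. openin (ell1_topology f) U} \<subseteq> Pow (ell1 f)"
    unfolding ell1_topology_def using openin_subset by fastforce
  then show ?thesis using U by (simp add: ell1_borel_def sets_measure_of)
qed

text \<open>Evaluation at \<open>x\<close> is continuous, since \<open>f x * \<bar>h x\<bar>\<close>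
  is at most the norm of \<open>h\<close>; the half spaces are therefore open.\<close>

lemma ell1_coordinate_measurable:
  assumes f: "\<And>x. 0 < f x"
  shows "(\<lambda>g. g x) \<in> borel_measurable (ell1_borel f)"
  unfolding borel_measurable_iff_less space_ell1_borel
proof
  fix a :: real
  interpret Metric_space "ell1 f" "\<lambda>a b. ell1_norm f (\<lambda>z. a z - b z)" by (rule Metric_space_ell1[OF f])
  have "openin (ell1_topology f) {g \<in> ell1 f. g x < a}"
    unfolding ell1_topology_def openin_mtopology
  proof (intro conjI allI impI)
    fix g assume g: "g \<in> {g \<in> ell1 f. g x < a}"
    show "\<exists>e>0. mball g e \<subseteq> {g \<in> ell1 f. g x < a}"
    proof (intro exI[of _ "f x * (a - g x)"] conjI subsetI)
      show "0 < f x * (a - g x)" using f[of x] g by simp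
      fix g' assume g': "g' \<in> mball g (f x * (a - g x))"
      have "(\<lambda>z. g z - g' z) \<in> ell1 f"
        using ell1_lin[where f=f and h=g and h'=g' and t=1 and t'="-1"] less_imp_le[OF f] g g' by simp
      then have "f x * \<bar>g x - g' x\<bar> < f x * (a - g x)"
        using ell1_coordinate_le[where h="\<lambda>z. g z - g' z" and f=f and x=x] less_imp_le[OF f] g' by simp
      then have "\<bar>g x - g' x\<bar> < a - g x" using f[of x] by simp
      then show "g' \<in> {g \<in> ell1 f. g x < a}" using g' by auto
    qed
  qed auto
  then show "{g \<in> ell1 f. g x < a} \<in> sets (ell1_borel f)" by (rule sets_ell1_borelI[OF f])
qed

lemma gaussian_space:
  assumes "tight_centered_gaussian f P"
  shows "space P = ell1 f"
  using assms sets_eq_imp_space_eq[of P "ell1_borel f"] by (simp add: tight_centered_gaussian_def space_ell1_borel)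

lemma gaussian_coordinate:
  assumes f: "\<And>x. 0 < f x" and P: "tight_centered_gaussian f P"
  shows "(\<lambda>g. g x) \<in> borel_measurable P" "integrable P (\<lambda>g. (g x)\<^sup>2)" "(\<integral>g. g x \<partial>P) = 0"
proof -
  have s: "sets P = sets (ell1_borel f)" using P by (simp add: tight_centered_gaussian_def)
  show m: "(\<lambda>g. g x) \<in> borel_measurable P"
    unfolding measurable_cong_sets[OF s refl] by (rule ell1_coordinate_measurable[OF f])
  obtain v where v: "0 \<le> v" "distr P borel (\<lambda>g. \<Sum>x\<in>{x}. 1 * g x) = normal_law 0 v"
  proof -
    have "\<forall>F t. finite F \<longrightarrow> (\<exists>v\<ge>0. distr P borel (\<lambda>g. \<Sum>x\<in>F. t x * g x) = normal_law 0 v)"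
      using P unfolding tight_centered_gaussian_def by blast
    from this[rule_format, of "{x}" "\<lambda>_. 1"] show ?thesis using that by auto
  qed
  then have d: "distr P borel (\<lambda>g. g x) = normal_law 0 v" by simp
  note N = normal_law_moments[OF v(1)]
  show "integrable P (\<lambda>g. (g x)\<^sup>2)"
    using N(4) unfolding d[symmetric] by (subst (asm) integrable_distr_eq[OF m]) auto
  show "(\<integral>g. g x \<partial>P) = 0"
    using N(3) unfolding d[symmetric] by (subst (asm) integral_distr[OF m]) auto
qed

section \<open>Covariances of the derivative and the variance of the influence function\<close>

context erot_scaled
begin

lemma Dp_bound_norm:
  assumes h: "h \<in> ell1 wX"
  shows "\<bar>Dp h (x, y)\<bar> \<le> (CD * (pmf s y * psi y ^ 2 + pmf r x * (pmf s y * psi y ^ 2))) * nX h"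
proof -
  have "\<bar>h x\<bar> = (\<Sum>\<^sub>\<infinity>z\<in>{x}. \<bar>h z\<bar>)" by simp
  also have "\<dots> \<le> (\<Sum>\<^sub>\<infinity>z. \<bar>h z\<bar>)"
    by (rule infsum_mono2) (use ell1_abs_summable(1)[OF h] in auto)
  also have "\<dots> \<le> nX h" by (rule ell1_abs_summable(2)[OF h])
  finally have "pmf s y * psi y ^ 2 * \<bar>h x\<bar> \<le> pmf s y * psi y ^ 2 * nX h"
    using psi_pos by (intro mult_left_mono) auto
  then have "CD * (pmf s y * psi y ^ 2 * \<bar>h x\<bar> + pmf r x * (pmf s y * psi y ^ 2) * nX h)
     \<le> CD * (pmf s y * psi y ^ 2 * nX h + pmf r x * (pmf s y * psi y ^ 2) * nX h)"
    using CD_nonneg by (intro mult_left_mono) auto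
  then show ?thesis using Dp_bound[OF h, of x y] by (simp add: algebra_simps)
qed

text \<open>Expresses the random derivative as a series in the coordinates of the Gaussian sequence,
  whose covariances are prescribed.\<close>

lemma Dp_has_sum:
  assumes h: "h \<in> ell1 wX"
  shows "((\<lambda>x. h x * Dp (indicator {x}) z) has_sum Dp h z) UNIV"
proof (cases z)
  case (Pair x y)
  show ?thesis
    by (rule ell1_linear_has_sum[OF wX_nonneg Dp_lin[OF _ _ ell1_lin[OF wX_nonneg]] Dp_bound_norm[of _ x y, folded Pair] h])
qed

lemma Dp_indicator_bound: "\<exists>K. \<forall>x. \<bar>Dp (indicator {x}) z\<bar> \<le> K * wX x"
  using Dp_bound_norm[OF indicator_ell1] by (cases z) (auto simp: ell1_norm_indicator)

lemma c_Dp_indicator_summable: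
  "(\<lambda>z. \<bar>c z * Dp (indicator {x}) z\<bar>) summable_on UNIV" "(\<Sum>\<^sub>\<infinity>z. \<bar>c z * Dp (indicator {x}) z\<bar>) \<le> CL * wX x"
  using c_Dp_summable[OF indicator_ell1[of x]] by (simp_all add: ell1_norm_indicator)

text \<open>\<open>vX\<close> is at most \<open>CL * wX\<close>. A summable sequence is square
  summable, and the square of \<open>wX x * sqrt (pmf r x)\<close> is the \<open>r\<close>-weighted
  square of \<open>wX\<close>, so the assumption on square roots yields a finite second
  moment.\<close>

lemma vX_integrable:
  assumes sq: "(\<lambda>x. wX x * sqrt (pmf r x)) summable_on UNIV"
  shows "integrable (measure_pmf r) vX" "integrable (measure_pmf r) (\<lambda>x. (vX x)\<^sup>2)"
proof -
  show "integrable (measure_pmf r) vX"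
    by (rule pmf_integrable_bound[where g="\<lambda>x. CL * wX x"]) (use rX vX_bound in auto)
  have 1: "(\<lambda>x. CL\<^sup>2 * (wX x * sqrt (pmf r x))\<^sup>2) summable_on UNIV"
    by (intro summable_on_cmult_right summable_on_square sq)
  have "(\<lambda>x. pmf r x * (vX x)\<^sup>2) summable_on UNIV"
  proof (rule summable_on_real_bound[OF 1])
    fix x
    have "(vX x)\<^sup>2 \<le> (CL * wX x)\<^sup>2" using power_mono[OF vX_bound, of x 2] by simp
    then show "\<bar>pmf r x * (vX x)\<^sup>2\<bar> \<le> CL\<^sup>2 * (wX x * sqrt (pmf r x))\<^sup>2"
      using mult_left_mono[of "(vX x)\<^sup>2" "(CL * wX x)\<^sup>2" "pmf r x"]
      by (simp add: abs_mult power_mult_distrib mult_ac)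
  qed
  then show "integrable (measure_pmf r) (\<lambda>x. (vX x)\<^sup>2)" by (simp add: integrable_measure_pmf_iff_summable_on)
qed

text \<open>Each \<open>plan_cov\<close> is a double sum over \<open>(x, x')\<close> with
  coefficients \<open>d z x * d z' x'\<close>. After exchanging it with the double sum over
  \<open>(z, z')\<close>, the cost sums factorise into \<open>vX x * vX x'\<close>; what remains is
  the quadratic form of \<open>multinomial_cov\<close>, that is, the variance of \<open>vX\<close>
  under \<open>r\<close>.\<close>

lemma sinkhorn_var_eq:
  assumes sq: "(\<lambda>x. wX x * sqrt (pmf r x)) summable_on UNIV"
    and P: "tight_centered_gaussian wX (law_G wX r)"
    and cov: "\<And>x x'. covar (law_G wX r) (\<lambda>g. g x) (\<lambda>g. g x') = multinomial_cov r x x'"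
  shows "sinkhorn_var c wX phi plan r s y1 = (\<integral>x. (vX x)\<^sup>2 \<partial>measure_pmf r) - (\<integral>x. vX x \<partial>measure_pmf r)\<^sup>2"
proof -
  define P where "P = law_G wX r"
  interpret prob_space P using P by (simp add: tight_centered_gaussian_def P_def)
  have w0: "0 < wX x" for x using wX_ge1[of x] by linarith
  have G: "(\<lambda>g. g x) \<in> borel_measurable P" "integrable P (\<lambda>g. (g x)\<^sup>2)" "(\<integral>g. g x \<partial>P) = 0" for x
    using gaussian_coordinate[OF w0 P] unfolding P_def by blast+
  have sp: "space P = ell1 wX" using gaussian_space[OF P] by (simp add: P_def)
  have c2: "(\<integral>g. g x * g x' \<partial>P) = multinomial_cov r x x'" for x x'
    using cov[of x x'] G(3) by (simp add: covar_def P_def[symmetric])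
  have G2: "(\<integral>g. (g x)\<^sup>2 \<partial>P) \<le> (sqrt (pmf r x))\<^sup>2" for x
    using c2[of x x] by (simp add: power2_eq_square multinomial_cov_def mult_left_le)
  define d where "d z x = Dp (indicator {x}) z" for z x
  have D: "Dp g z = (\<Sum>\<^sub>\<infinity>x. g x * d z x)" "(\<lambda>x. g x * d z x) summable_on UNIV" if "g \<in> space P" for g z
    using Dp_has_sum[of g z] that unfolding d_def sp by (auto simp: summable_on_def dest: infsumI)
  have dq: "(\<lambda>x. \<bar>d z x\<bar> * sqrt (pmf r x)) summable_on UNIV" for z
  proof -
    obtain K where K: "\<And>x. \<bar>d z x\<bar> \<le> K * wX x" using Dp_indicator_bound unfolding d_def by blast
    show ?thesis
    proof (rule summable_on_real_bound)
      show "(\<lambda>x. K * (wX x * sqrt (pmf r x))) summable_on UNIV" by (intro summable_on_cmult_right sq)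
      show "\<bar>\<bar>d z x\<bar> * sqrt (pmf r x)\<bar> \<le> K * (wX x * sqrt (pmf r x))" for x
        using mult_right_mono[OF K, of "sqrt (pmf r x)" x] by (simp add: abs_mult mult_ac)
    qed
  qed
  have mean: "(\<integral>g. Dp g z \<partial>P) = 0" for z
  proof -
    have "(\<integral>g. Dp g z \<partial>P) = (\<integral>g. (\<Sum>\<^sub>\<infinity>x. g x * d z x) \<partial>P)"
      by (rule Bochner_Integration.integral_cong) (auto simp: D)
    also have "\<dots> = (\<Sum>\<^sub>\<infinity>x. d z x * (\<integral>g. g x \<partial>P))"
      by (rule second_moment_infsum(2)[OF prob_space_axioms G(1,2) G2 _ dq[of z] dq[of z]]) (auto simp: D)
    finally show ?thesis by (simp add: G(3))
  qed
  have pc: "plan_cov wX phi plan r s y1 z z' = (\<Sum>\<^sub>\<infinity>(x, x'). d z x * d z' x' * multinomial_cov r x x')" for z z'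
  proof -
    have "plan_cov wX phi plan r s y1 z z' = (\<integral>g. Dp g z * Dp g z' \<partial>P)"
      using mean by (simp add: plan_cov_def covar_def P_def[symmetric])
    also have "\<dots> = (\<integral>g. (\<Sum>\<^sub>\<infinity>x. g x * d z x) * (\<Sum>\<^sub>\<infinity>x. g x * d z' x) \<partial>P)"
      by (rule Bochner_Integration.integral_cong) (auto simp: D)
    also have "\<dots> = (\<Sum>\<^sub>\<infinity>(x, x'). d z x * d z' x' * (\<integral>g. g x * g x' \<partial>P))"
      by (rule second_moment_infsum(1)[OF prob_space_axioms G(1,2) G2 _ dq[of z] dq[of z']]) (auto simp: D)
    finally show ?thesis by (simp add: c2)
  qed
  define V where "V = (\<lambda>(x, x'). multinomial_cov r x x')"
  define F where "F = (\<lambda>xx zz. (c (fst zz) * d (fst zz) (fst xx)) * (c (snd zz) * d (snd zz) (snd xx)) * V xx)"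
  have cds: "(\<lambda>z. \<bar>c z * d z x\<bar>) summable_on UNIV" "(\<Sum>\<^sub>\<infinity>z. \<bar>c z * d z x\<bar>) \<le> CL * wX x"
    "(\<lambda>z. c z * d z x) summable_on UNIV" "(\<Sum>\<^sub>\<infinity>z. c z * d z x) = vX x" for x
    using c_Dp_indicator_summable[of x] c_Dp_summable'[OF indicator_ell1[of x]]
    by (auto simp: d_def vX_def Lc_def)
  \<comment> \<open>Cauchy-Schwarz for the Gaussian coordinates bounds diagonal and off-diagonal
    entries alike in product form, matching the hypothesis on \<open>sqrt (pmf r x)\<close>.\<close>
  have V: "\<bar>V (x, x')\<bar> \<le> sqrt (pmf r x) * sqrt (pmf r x')" for x x'
  proof -
    have "\<bar>\<integral>g. g x * g x' \<partial>P\<bar> \<le> (\<integral>g. \<bar>g x * g x'\<bar> \<partial>P)"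
      using integral_norm_bound[of P "\<lambda>g. g x * g x'"] by simp
    also have "\<dots> \<le> sqrt (pmf r x) * sqrt (pmf r x')"
      by (rule expectation_abs_mult_le(2)) (use G G2 in auto)
    finally show ?thesis by (simp add: V_def c2)
  qed
  define m where "m x = (\<Sum>\<^sub>\<infinity>z. \<bar>c z * d z x\<bar>)" for x
  have m: "0 \<le> m x" "m x \<le> CL * wX x" for x unfolding m_def using cds by (auto intro: infsum_nonneg)
  \<comment> \<open>Absolute summability of the fourfold family: the inner sums over the cost
    indices are at most \<open>CL * wX\<close> in each factor, and with the bound on
    \<open>V\<close> the outer sum is dominated by a product of two summable sequences.\<close>
  have "(\<lambda>(xx, zz). \<bar>F xx zz\<bar>) summable_on Sigma UNIV (\<lambda>_. UNIV)"
  proof (rule summable_on_SigmaI[where g="\<lambda>xx. m (fst xx) * m (snd xx) * \<bar>V xx\<bar>"])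
    fix xx :: "'a \<times> 'a"
    have "((\<lambda>(z, z'). \<bar>c z * d z (fst xx)\<bar> * \<bar>c z' * d z' (snd xx)\<bar>) has_sum m (fst xx) * m (snd xx)) UNIV"
      unfolding m_def infsum_times[OF cds(1) cds(1), symmetric]
      by (rule has_sum_infsum[OF summable_on_times[OF cds(1) cds(1)]])
    from has_sum_cmult_left[OF this, of "\<bar>V xx\<bar>"]
    show "((\<lambda>zz. case (xx, zz) of (xx, zz) \<Rightarrow> \<bar>F xx zz\<bar>) has_sum m (fst xx) * m (snd xx) * \<bar>V xx\<bar>) UNIV"
      by (simp add: F_def abs_mult case_prod_unfold)
  next
    have wq: "(\<lambda>x. CL * (wX x * sqrt (pmf r x))) summable_on UNIV" by (intro summable_on_cmult_right sq)
    show "(\<lambda>xx. m (fst xx) * m (snd xx) * \<bar>V xx\<bar>) summable_on UNIV"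
    proof (rule summable_on_real_bound[OF summable_on_times[OF wq wq]])
      fix xx :: "'a \<times> 'a"
      obtain x x' where xx: "xx = (x, x')" by (cases xx)
      have "m x * m x' * \<bar>V (x, x')\<bar> \<le> ((CL * wX x) * (CL * wX x')) * (sqrt (pmf r x) * sqrt (pmf r x'))"
        by (intro mult_mono m V) (use m CL_nonneg wX_nonneg in \<open>auto intro!: mult_nonneg_nonneg\<close>)
      then show "\<bar>m (fst xx) * m (snd xx) * \<bar>V xx\<bar>\<bar>
          \<le> (case xx of (x, y) \<Rightarrow> CL * (wX x * sqrt (pmf r x)) * (CL * (wX y * sqrt (pmf r y))))"
        using m by (simp add: xx abs_mult mult_ac)
    qed
  qed auto
  then have Fs: "(\<lambda>(xx, zz). F xx zz) summable_on UNIV \<times> UNIV"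
    by (rule summable_on_real_bound) auto
  have "sinkhorn_var c wX phi plan r s y1 = (\<Sum>\<^sub>\<infinity>zz. \<Sum>\<^sub>\<infinity>xx. F xx zz)"
    unfolding sinkhorn_var_def pc
  proof (rule infsum_cong)
    fix zz :: "('a \<times> 'b) \<times> ('a \<times> 'b)"
    obtain z z' where zz: "zz = (z, z')" by (cases zz)
    have "(\<Sum>\<^sub>\<infinity>xx. F xx zz) = (\<Sum>\<^sub>\<infinity>xx. (c z * c z') * (case xx of (x, x') \<Rightarrow> d z x * d z' x' * multinomial_cov r x x'))"
      by (rule infsum_cong) (auto simp: F_def zz V_def)
    then show "(case zz of (z, z') \<Rightarrow> c z * c z' * (\<Sum>\<^sub>\<infinity>(x, x'). d z x * d z' x' * multinomial_cov r x x'))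
        = (\<Sum>\<^sub>\<infinity>xx. F xx zz)"
      by (simp add: zz infsum_cmult_right')
  qed
  also have "\<dots> = (\<Sum>\<^sub>\<infinity>xx. \<Sum>\<^sub>\<infinity>zz. F xx zz)"
    by (rule infsum_swap_banach[OF Fs, symmetric])
  also have "\<dots> = (\<Sum>\<^sub>\<infinity>(x, x'). vX x * vX x' * multinomial_cov r x x')"
  proof (rule infsum_cong)
    fix xx :: "'a \<times> 'a"
    have "(\<Sum>\<^sub>\<infinity>zz. F xx zz) = (\<Sum>\<^sub>\<infinity>(z, z'). (c z * d z (fst xx)) * (c z' * d z' (snd xx))) * V xx"
      unfolding F_def by (simp add: infsum_cmult_left' case_prod_unfold)
    also have "(\<Sum>\<^sub>\<infinity>(z, z'). (c z * d z (fst xx)) * (c z' * d z' (snd xx))) = vX (fst xx) * vX (snd xx)"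
      unfolding infsum_times[OF cds(3) cds(3)] cds(4) ..
    finally show "(\<Sum>\<^sub>\<infinity>zz. F xx zz) = (case xx of (x, x') \<Rightarrow> vX x * vX x' * multinomial_cov r x x')"
      by (simp add: V_def case_prod_unfold)
  qed
  also have "\<dots> = (\<integral>x. (vX x)\<^sup>2 \<partial>measure_pmf r) - (\<integral>x. vX x \<partial>measure_pmf r)\<^sup>2"
    by (rule multinomial_cov_quadratic(2)[OF vX_integrable[OF sq]])
  finally show ?thesis .
qed

end

section \<open>Measurability and compactness in weighted sequence spaces\<close>

lemma measurable_pair_count_space:
  fixes f :: "'i::countable \<Rightarrow> 'w \<Rightarrow> real"
  assumes "\<And>i. f i \<in> borel_measurable M"
  shows "(\<lambda>(w, i). f i w) \<in> borel_measurable (M \<Otimes>\<^sub>M count_space UNIV)"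
proof -
  have "(\<lambda>z. f (snd z) (fst z)) \<in> borel_measurable (M \<Otimes>\<^sub>M count_space UNIV)"
    by (rule measurable_compose_countable[where f="\<lambda>i z. f i (fst z)"])
       (auto intro: measurable_compose[OF measurable_fst assms])
  then show ?thesis by (simp add: case_prod_unfold)
qed

text \<open>Both the value of an unordered sum and its convergence become statements about an
  integral over a counting measure with a parameter, for which measurability is standard.\<close>

lemma borel_measurable_infsum:
  fixes f :: "'i::countable \<Rightarrow> 'w \<Rightarrow> real"
  assumes "\<And>i. f i \<in> borel_measurable M"
  shows "(\<lambda>w. \<Sum>\<^sub>\<infinity>i. f i w) \<in> borel_measurable M" "Measurable.pred M (\<lambda>w. (\<lambda>i. f i w) summable_on UNIV)"
proof -
  interpret sigma_finite_measure "count_space (UNIV :: 'i set)" by (rule sigma_finite_measure_count_space)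
  show "(\<lambda>w. \<Sum>\<^sub>\<infinity>i. f i w) \<in> borel_measurable M"
    unfolding infsum_eq_integral_count_space
    by (rule borel_measurable_lebesgue_integral) (rule measurable_pair_count_space[OF assms])
  show "Measurable.pred M (\<lambda>w. (\<lambda>i. f i w) summable_on UNIV)"
    unfolding summable_on_iff_integrable_count_space
    by (rule borel_measurable_lebesgue_integrable) (rule measurable_pair_count_space[OF assms])
qed

lemma summable_finite_tail:
  fixes a :: "'a \<Rightarrow> real"
  assumes s: "a summable_on UNIV" and e: "0 < e"
  shows "\<exists>F. finite F \<and> infsum a (- F) \<le> e"
proof -
  obtain F where F: "finite F" "dist (sum a F) (infsum a UNIV) \<le> e"
    using has_sum_finite_approximation[OF has_sum_infsum[OF s] e] by auto
  have "infsum a (UNIV - F) = infsum a UNIV - infsum a F"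
    using F(1) by (intro infsum_Diff s) auto
  then have "infsum a (- F) = infsum a UNIV - sum a F" using F(1) by (simp add: Compl_eq_Diff_UNIV)
  then show ?thesis using F by (intro exI[of _ F]) (auto simp: dist_real_def)
qed

text \<open>Finitely supported rational sequences, the usual countable dense set. Coding them by
  lists puts them in a countable type.\<close>

definition rational_step :: "('a \<times> rat) list \<Rightarrow> 'a \<Rightarrow> real" where
  "rational_step l x = (case map_of l x of Some a \<Rightarrow> of_rat a | None \<Rightarrow> 0)"

lemma rational_step_ell1: "rational_step l \<in> ell1 f"
proof -
  have "rational_step l = (\<lambda>x. if x \<in> fst ` set l then rational_step l x else 0)"
    by (auto simp: rational_step_def fun_eq_iff map_of_eq_None_iff[symmetric] split: option.splits)
  then show ?thesis using ell1_finite_support[of "fst ` set l" "rational_step l" f] by simp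
qed

lemma rational_step_dense:
  fixes f :: "'a \<Rightarrow> real"
  assumes f: "\<And>x. 0 < f x" and g: "g \<in> ell1 f" and e: "0 < e"
  shows "\<exists>l. ell1_norm f (\<lambda>x. g x - rational_step l x) < e"
proof -
  have s: "(\<lambda>x. f x * \<bar>g x\<bar>) summable_on UNIV" using g by (simp add: ell1_def)
  obtain F where F: "finite F" "(\<Sum>\<^sub>\<infinity>x\<in>- F. f x * \<bar>g x\<bar>) \<le> e / 3"
    using summable_finite_tail[OF s, of "e / 3"] e by auto
  \<comment> \<open>The finite part has at most \<open>k\<close> terms, so an accuracy
    \<open>e / (3 * k * f x)\<close> at each point adds up to at most \<open>e / 3\<close>; the
    summand 1 keeps \<open>k\<close> positive for empty \<open>F\<close>.\<close>
  define k where "k = real (card F) + 1"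
  have k: "0 < k" by (simp add: k_def)
  have "\<exists>q :: rat. \<bar>g x - of_rat q\<bar> < e / (3 * k * f x)" for x
  proof -
    have "0 < e / (3 * k * f x)" using e k f[of x] by simp
    then obtain q :: rat where "g x - e / (3 * k * f x) < of_rat q" "of_rat q < g x + e / (3 * k * f x)"
      using of_rat_dense[of "g x - e / (3 * k * f x)" "g x + e / (3 * k * f x)"] by auto
    then show ?thesis by (intro exI[of _ q]) (auto simp: abs_less_iff)
  qed
  then obtain q :: "'a \<Rightarrow> rat" where q: "\<And>x. \<bar>g x - of_rat (q x)\<bar> < e / (3 * k * f x)" by metis
  obtain xs where xs: "set xs = F" "distinct xs" using finite_distinct_list[OF F(1)] by blast
  define l where "l = map (\<lambda>x. (x, q x)) xs"
  have l: "rational_step l x = (if x \<in> F then of_rat (q x) else 0)" for x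
    by (simp add: rational_step_def l_def map_of_map_restrict restrict_map_def xs(1))
  have ds: "(\<lambda>x. f x * \<bar>g x - rational_step l x\<bar>) summable_on UNIV"
    using ell1_lin[OF less_imp_le[OF f] g rational_step_ell1[of l f], of 1 "-1"] by (simp add: ell1_def)
  have "ell1_norm f (\<lambda>x. g x - rational_step l x)
      = (\<Sum>\<^sub>\<infinity>x\<in>F. f x * \<bar>g x - rational_step l x\<bar>) + (\<Sum>\<^sub>\<infinity>x\<in>- F. f x * \<bar>g x - rational_step l x\<bar>)"
    unfolding ell1_norm_def
    by (subst infsum_Un_disjoint[symmetric]) (use F(1) summable_on_subset_banach[OF ds] in auto)
  also have "(\<Sum>\<^sub>\<infinity>x\<in>- F. f x * \<bar>g x - rational_step l x\<bar>) = (\<Sum>\<^sub>\<infinity>x\<in>- F. f x * \<bar>g x\<bar>)"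
    by (rule infsum_cong) (simp add: l)
  also have "(\<Sum>\<^sub>\<infinity>x\<in>F. f x * \<bar>g x - rational_step l x\<bar>) \<le> (\<Sum>x\<in>F. e / (3 * k))"
    using F(1)
  proof (simp only: infsum_finite, intro sum_mono)
    fix x assume "x \<in> F"
    have "f x * \<bar>g x - of_rat (q x)\<bar> \<le> f x * (e / (3 * k * f x))"
      using q[of x] f[of x] by (intro mult_left_mono) auto
    then show "f x * \<bar>g x - rational_step l x\<bar> \<le> e / (3 * k)" using f[of x] \<open>x \<in> F\<close> by (simp add: l)
  qed
  also have "(\<Sum>x\<in>F. e / (3 * k)) \<le> e / 3"
    using e k by (simp add: k_def field_simps)
  finally show ?thesis using F(2) e by (intro exI[of _ l]) simp
qed

text \<open>By separability an open set is a countable union of balls with rational centres, and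
  membership in such a ball is a condition on a countable sum of coordinates. Hence coordinatewise
  measurability suffices.\<close>

lemma measurable_ell1_borelI:
  fixes f :: "'a::countable \<Rightarrow> real" and G :: "'w \<Rightarrow> 'a \<Rightarrow> real"
  assumes f: "\<And>x. 0 < f x" and sp: "\<And>w. w \<in> space M \<Longrightarrow> G w \<in> ell1 f"
    and m: "\<And>x. (\<lambda>w. G w x) \<in> borel_measurable M"
  shows "G \<in> measurable M (ell1_borel f)"
proof -
  interpret Metric_space "ell1 f" "\<lambda>a b. ell1_norm f (\<lambda>z. a z - b z)" by (rule Metric_space_ell1[OF f])
  show ?thesis
    unfolding ell1_borel_def
  proof (rule measurable_measure_of)
    show "{U. openin (ell1_topology f) U} \<subseteq> Pow (ell1 f)"
      unfolding ell1_topology_def using openin_subset by fastforce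
    show "G \<in> space M \<rightarrow> ell1 f" using sp by auto
    fix U assume "U \<in> {U. openin (ell1_topology f) U}"
    then have U: "U \<subseteq> ell1 f" "\<And>g. g \<in> U \<Longrightarrow> \<exists>e>0. mball g e \<subseteq> U"
      unfolding ell1_topology_def openin_mtopology by auto
    define B where "B z = mball (rational_step (fst z)) (1 / real (Suc (snd z)))" for z :: "('a \<times> rat) list \<times> nat"
    define I where "I = {z. B z \<subseteq> U}"
    have cov: "U = (\<Union>z\<in>I. B z)"
    proof
      show "(\<Union>z\<in>I. B z) \<subseteq> U" by (auto simp: I_def)
      show "U \<subseteq> (\<Union>z\<in>I. B z)"
      proof
        fix g assume g: "g \<in> U"
        then obtain e where e: "0 < e" "mball g e \<subseteq> U" using U(2) by blast
        obtain n where n: "1 / real (Suc n) < e / 2" using e(1) nat_approx_posE[of "e / 2"] by auto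
        have gE: "g \<in> ell1 f" using g U(1) by blast
        obtain l where l: "ell1_norm f (\<lambda>x. g x - rational_step l x) < 1 / real (Suc n)"
          using rational_step_dense[OF f gE, of "1 / real (Suc n)"] by auto
        have "mball (rational_step l) (1 / real (Suc n)) \<subseteq> mball g e"
          by (rule mball_subset) (use l n gE rational_step_ell1 in \<open>auto simp: commute[of "rational_step l"]\<close>)
        then have "(l, n) \<in> I" using e(2) by (auto simp: I_def B_def)
        moreover have "g \<in> B (l, n)"
          using l gE rational_step_ell1 by (auto simp: B_def commute[of "rational_step l"])
        ultimately show "g \<in> (\<Union>z\<in>I. B z)" by blast
      qed
    qed
    have "G -` U \<inter> space M = (\<Union>z\<in>I. {w \<in> space M. G w \<in> B z})"
      unfolding cov by auto
    also have "\<dots> \<in> sets M"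
    proof (rule sets.countable_UN'')
      show "countable I" by (rule countableI_type)
      fix z assume "z \<in> I"
      have [measurable]: "(\<lambda>w. ell1_norm f (\<lambda>x. rational_step l x - G w x)) \<in> borel_measurable M" for l
        unfolding ell1_norm_def
        by (intro borel_measurable_infsum borel_measurable_times borel_measurable_abs borel_measurable_diff borel_measurable_const m)
      have "{w \<in> space M. G w \<in> B z}
          = {w \<in> space M. ell1_norm f (\<lambda>x. rational_step (fst z) x - G w x) < 1 / real (Suc (snd z))}"
        using sp by (auto simp: B_def rational_step_ell1)
      also have "\<dots> \<in> sets M" by measurable
      finally show "{w \<in> space M. G w \<in> B z} \<in> sets M" .
    qed
    finally show "G -` U \<inter> space M \<in> sets M" .
  qed
qed

text \<open>Tychonoff gives compactness of the cube; over a countable index type the product is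
  metrizable, so compactness is sequential and replaces a diagonal argument.\<close>

lemma bounded_pointwise_subsequence:
  fixes h :: "nat \<Rightarrow> 'a::countable \<Rightarrow> real"
  assumes "\<And>n x. \<bar>h n x\<bar> \<le> B"
  shows "\<exists>l \<rho>. strict_mono (\<rho> :: nat \<Rightarrow> nat) \<and> (\<forall>x. (\<lambda>n. h (\<rho> n) x) \<longlonglongrightarrow> l x)"
proof -
  have "compactin (product_topology (\<lambda>_ :: 'a. euclideanreal) UNIV) (PiE UNIV (\<lambda>_. {-B..B}))"
    by (subst compactin_PiE) auto
  then have "compact (PiE UNIV (\<lambda>_ :: 'a. {-B..B}))"
    by (simp add: euclidean_product_topology)
  then have "seq_compact (PiE UNIV (\<lambda>_ :: 'a. {-B..B}))" by (simp add: compact_eq_seq_compact_metric)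
  moreover have "h n \<in> PiE UNIV (\<lambda>_. {-B..B})" for n
    using assms[of n] by (auto simp: abs_le_iff) (metis minus_le_iff)
  ultimately obtain l \<rho> where r: "strict_mono (\<rho> :: nat \<Rightarrow> nat)" "(h \<circ> \<rho>) \<longlonglongrightarrow> l"
    unfolding seq_compact_def by metis
  have "(\<lambda>n. h (\<rho> n) x) \<longlonglongrightarrow> l x" for x
  proof -
    have "isCont (\<lambda>g :: 'a \<Rightarrow> real. g x) l"
      by (rule continuous_on_eq_continuous_at[THEN iffD1, OF open_UNIV continuous_on_product_coordinates, rule_format]) simp
    from isCont_tendsto_compose[OF this r(2)] show ?thesis by (simp add: o_def)
  qed
  then show ?thesis using r(1) by blast
qed

text \<open>Uniformly small tails upgrade pointwise convergence of a subsequence to convergence in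
  norm: on the finite set \<open>F m\<close> convergence is termwise, off it both sequences
  contribute at most \<open>d m\<close>. The case \<open>F 0 = {}\<close> makes \<open>d 0\<close> a
  bound on the norm itself.\<close>

lemma ell1_compact_tails:
  fixes f :: "'a::countable \<Rightarrow> real" and F :: "nat \<Rightarrow> 'a set"
  assumes f: "\<And>x. 1 \<le> f x" and F: "\<And>m. finite (F m)" "F 0 = {}" and d: "\<And>e. 0 < e \<Longrightarrow> \<exists>m. d m < e"
  shows "compactin (ell1_topology f) {g \<in> ell1 f. \<forall>m. (\<Sum>\<^sub>\<infinity>x\<in>- F m. f x * \<bar>g x\<bar>) \<le> d m}"
proof -
  let ?K = "{g \<in> ell1 f. \<forall>m. (\<Sum>\<^sub>\<infinity>x\<in>- F m. f x * \<bar>g x\<bar>) \<le> d m}"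
  have f0: "0 < f x" for x using f[of x] by linarith
  interpret Metric_space "ell1 f" "\<lambda>a b. ell1_norm f (\<lambda>z. a z - b z)" by (rule Metric_space_ell1[OF f0])
  show ?thesis
    unfolding ell1_topology_def compactin_sequentially
  proof (intro conjI allI impI)
    show "?K \<subseteq> ell1 f" by blast
    fix h :: "nat \<Rightarrow> 'a \<Rightarrow> real" assume "range h \<subseteq> ?K"
    then have h: "\<And>n. h n \<in> ell1 f" "\<And>n m. (\<Sum>\<^sub>\<infinity>x\<in>- F m. f x * \<bar>h n x\<bar>) \<le> d m" by blast+
    have hb: "\<bar>h n x\<bar> \<le> d 0" for n x
    proof -
      have "\<bar>h n x\<bar> \<le> f x * \<bar>h n x\<bar>" using mult_right_mono[OF f[of x], of "\<bar>h n x\<bar>"] by simp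
      also have "\<dots> \<le> ell1_norm f (h n)" using ell1_coordinate_le[OF h(1)] f0 by (simp add: less_imp_le)
      also have "\<dots> \<le> d 0" using h(2)[of n 0] F(2) by (simp add: ell1_norm_def)
      finally show ?thesis .
    qed
    obtain l \<rho> where r: "strict_mono (\<rho> :: nat \<Rightarrow> nat)" "\<And>x. (\<lambda>n. h (\<rho> n) x) \<longlonglongrightarrow> l x"
      using bounded_pointwise_subsequence[of h "d 0", OF hb] by blast
    \<comment> \<open>Finite partial sums pass to the pointwise limit, so the limit satisfies all
      the tail bounds; in particular it lies in the space.\<close>
    have lfin: "(\<Sum>x\<in>H. f x * \<bar>l x\<bar>) \<le> d m" if H: "finite H" "H \<subseteq> - F m" for H m
    proof (rule LIMSEQ_le_const2)
      show "(\<lambda>n. \<Sum>x\<in>H. f x * \<bar>h (\<rho> n) x\<bar>) \<longlonglongrightarrow> (\<Sum>x\<in>H. f x * \<bar>l x\<bar>)"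
        by (intro tendsto_intros r(2))
      have "(\<Sum>x\<in>H. f x * \<bar>h (\<rho> n) x\<bar>) \<le> d m" for n
      proof -
        have "(\<Sum>x\<in>H. f x * \<bar>h (\<rho> n) x\<bar>) \<le> (\<Sum>\<^sub>\<infinity>x\<in>- F m. f x * \<bar>h (\<rho> n) x\<bar>)"
          using h(1)[of "\<rho> n"] H f0
          by (intro finite_sum_le_infsum) (auto simp: ell1_def less_imp_le intro: summable_on_subset_banach)
        then show ?thesis using h(2)[of "\<rho> n" m] by linarith
      qed
      then show "\<exists>N. \<forall>n\<ge>N. (\<Sum>x\<in>H. f x * \<bar>h (\<rho> n) x\<bar>) \<le> d m" by blast
    qed
    have "(\<lambda>x. f x * \<bar>l x\<bar>) summable_on UNIV"
    proof (rule nonneg_bdd_above_summable_on)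
      show "bdd_above (sum (\<lambda>x. f x * \<bar>l x\<bar>) ` {H. H \<subseteq> UNIV \<and> finite H})"
        using lfin[of _ 0] F(2) by (intro bdd_aboveI[where M="d 0"]) auto
    qed (use f0 in \<open>auto simp: less_imp_le\<close>)
    then have lE: "l \<in> ell1 f" and ls: "(\<lambda>x. f x * \<bar>l x\<bar>) summable_on A" for A
      by (auto simp: ell1_def intro: summable_on_subset_banach)
    have lt: "(\<Sum>\<^sub>\<infinity>x\<in>- F m. f x * \<bar>l x\<bar>) \<le> d m" for m
      by (rule infsum_le_finite_sums[OF ls]) (use lfin in auto)
    have "limitin mtopology (h \<circ> \<rho>) l sequentially"
      unfolding limitin_metric
    proof (intro conjI allI impI)
      fix e :: real assume e: "0 < e"
      obtain m where m: "d m < e / 4" using d[of "e / 4"] e by auto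
      have "(\<lambda>n. \<Sum>x\<in>F m. f x * \<bar>h (\<rho> n) x - l x\<bar>) \<longlonglongrightarrow> (\<Sum>x\<in>F m. f x * \<bar>l x - l x\<bar>)"
        by (intro tendsto_intros r(2))
      then have "\<forall>\<^sub>F n in sequentially. (\<Sum>x\<in>F m. f x * \<bar>h (\<rho> n) x - l x\<bar>) < e / 2"
        by (rule order_tendstoD) (use e in simp)
      then show "\<forall>\<^sub>F n in sequentially. (h \<circ> \<rho>) n \<in> ell1 f \<and> ell1_norm f (\<lambda>z. (h \<circ> \<rho>) n z - l z) < e"
      proof eventually_elim
        case (elim n)
        have hs: "(\<lambda>x. f x * \<bar>h (\<rho> n) x\<bar>) summable_on A" for A
          using h(1)[of "\<rho> n"] by (auto simp: ell1_def intro: summable_on_subset_banach)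
        have le: "f x * \<bar>h (\<rho> n) x - l x\<bar> \<le> f x * \<bar>h (\<rho> n) x\<bar> + f x * \<bar>l x\<bar>" for x
          using mult_left_mono[OF abs_triangle_ineq4[of "h (\<rho> n) x" "l x"], of "f x"] f0[of x]
          by (simp add: distrib_left)
        have ds: "(\<lambda>x. f x * \<bar>h (\<rho> n) x - l x\<bar>) summable_on A" for A
          by (rule summable_on_real_bound[OF summable_on_add[OF hs ls]])
             (use le f0 in \<open>auto simp: abs_mult less_imp_le abs_of_pos\<close>)
        have "ell1_norm f (\<lambda>z. h (\<rho> n) z - l z)
            = (\<Sum>\<^sub>\<infinity>x\<in>F m. f x * \<bar>h (\<rho> n) x - l x\<bar>) + (\<Sum>\<^sub>\<infinity>x\<in>- F m. f x * \<bar>h (\<rho> n) x - l x\<bar>)"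
          unfolding ell1_norm_def by (subst infsum_Un_disjoint[symmetric]) (use ds in auto)
        also have "(\<Sum>\<^sub>\<infinity>x\<in>- F m. f x * \<bar>h (\<rho> n) x - l x\<bar>)
            \<le> (\<Sum>\<^sub>\<infinity>x\<in>- F m. f x * \<bar>h (\<rho> n) x\<bar> + f x * \<bar>l x\<bar>)"
          by (intro infsum_mono ds summable_on_add hs ls le)
        also have "\<dots> = (\<Sum>\<^sub>\<infinity>x\<in>- F m. f x * \<bar>h (\<rho> n) x\<bar>) + (\<Sum>\<^sub>\<infinity>x\<in>- F m. f x * \<bar>l x\<bar>)"
          by (intro infsum_add hs ls)
        also have "\<dots> \<le> d m + d m" by (intro add_mono h(2) lt)
        finally show ?case using elim m h(1) F(1) by simp
      qed
    qed (rule lE)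
    then show "\<exists>l r. l \<in> ?K \<and> strict_mono r \<and> limitin mtopology (h \<circ> r) l sequentially"
      using lE lt r(1) by blast
  qed
qed

section \<open>Existence of the Gaussian law\<close>

lemma has_sum_real_diff:
  fixes f g :: "'a \<Rightarrow> real"
  assumes "(f has_sum a) A" "(g has_sum b) A"
  shows "((\<lambda>x. f x - g x) has_sum (a - b)) A"
  using has_sum_add[OF assms(1) has_sum_uminusI[OF assms(2)]] by simp

text \<open>Markov's inequality for the tail norms \<open>T m\<close>: the set where all of them are
  at most \<open>d m\<close> is compact by \<open>ell1_compact_tails\<close>, and its complement is
  covered by events of probability at most \<open>b m\<close>.\<close>

lemma ell1_tight:
  fixes f q :: "'a::countable \<Rightarrow> real"
  assumes f: "\<And>x. 1 \<le> f x" and P: "prob_space P" and sP: "sets P = sets (ell1_borel f)"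
    and g: "\<And>x. integrable P (\<lambda>g. g x)" "\<And>x. (\<integral>g. \<bar>g x\<bar> \<partial>P) \<le> q x"
    and q: "(\<lambda>x. f x * q x) summable_on UNIV" and e: "0 < e"
  shows "\<exists>K. compactin (ell1_topology f) K \<and> K \<in> sets P \<and> measure P K \<ge> 1 - e"
proof -
  interpret prob_space P by fact
  have f0: "0 < f x" for x using f[of x] by linarith
  have sp: "space P = ell1 f" using sets_eq_imp_space_eq[OF sP] by (simp add: space_ell1_borel)
  have q0: "0 \<le> q x" for x by (rule order_trans[OF _ g(2)]) (simp add: Bochner_Integration.integral_nonneg)
  \<comment> \<open>The allowed probabilities sum to exactly \<open>e\<close>.\<close>
  define b where "b m = e * (1/2) ^ (m + 1)" for m :: nat
  have b0: "0 < b m" for m using e by (simp add: b_def)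
  define A where "A = (\<Sum>\<^sub>\<infinity>x. f x * q x)"
  have A0: "0 \<le> A" unfolding A_def using f0 q0 by (intro infsum_nonneg mult_nonneg_nonneg) (auto simp: less_imp_le)
  \<comment> \<open>The value at 0 is large enough for the empty set to serve as \<open>F 0\<close>,
    since \<open>A \<le> b 0 * d 0\<close>; the later values tend to 0, as compactness
    requires.\<close>
  define d where "d m = (case m of 0 \<Rightarrow> A / b 0 + 1 | Suc k \<Rightarrow> 1 / real (Suc k))" for m
  have d0: "0 < d m" for m using A0 b0[of 0] by (cases m) (auto simp: d_def add_nonneg_pos)
  have "\<exists>F. finite F \<and> (m = 0 \<longrightarrow> F = {}) \<and> (\<Sum>\<^sub>\<infinity>x\<in>- F. f x * q x) \<le> b m * d m" for m
  proof (cases m)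
    case 0
    have "A \<le> b 0 * d 0" using b0[of 0] by (simp add: d_def distrib_left)
    then show ?thesis using 0 by (intro exI[of _ "{}"]) (simp add: A_def)
  next
    case (Suc k)
    then show ?thesis using summable_finite_tail[OF q, of "b m * d m"] b0 d0 by simp
  qed
  then obtain F where F: "\<And>m. finite (F m)" "F 0 = {}" "\<And>m. (\<Sum>\<^sub>\<infinity>x\<in>- F m. f x * q x) \<le> b m * d m" by metis
  \<comment> \<open>Written as a sum over the whole type, with zero terms on \<open>F m\<close>, so
    that the exchange of sum and expectation applies directly.\<close>
  define T where "T m g = (\<Sum>\<^sub>\<infinity>x. f x * \<bar>if x \<in> F m then 0 else g x\<bar>)" for m and g :: "'a \<Rightarrow> real"
  have Teq: "T m g = (\<Sum>\<^sub>\<infinity>x\<in>- F m. f x * \<bar>g x\<bar>)" for m g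
    unfolding T_def by (rule infsum_cong_neutral) auto
  define K where "K = {g \<in> ell1 f. \<forall>m. T m g \<le> d m}"
  have dsmall: "\<exists>m. d m < t" if t: "0 < t" for t
  proof -
    obtain n where "1 / real (Suc n) < t" using nat_approx_posE[OF t] by auto
    then show ?thesis by (intro exI[of _ "Suc n"]) (simp add: d_def)
  qed
  have comp: "compactin (ell1_topology f) K"
    unfolding K_def Teq by (rule ell1_compact_tails[of f F d, OF f F(1,2) dsmall])
  have E: "integrable P (T m)" "(\<integral>g. T m g \<partial>P) \<le> b m * d m" for m
  proof -
    let ?h = "\<lambda>x (g :: 'a \<Rightarrow> real). f x * \<bar>if x \<in> F m then 0 else g x\<bar>"
    have i: "integrable P (?h x)" for x using g(1)[of x] by (cases "x \<in> F m") auto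
    have le: "(\<integral>g. \<bar>?h x g\<bar> \<partial>P) \<le> (if x \<in> F m then 0 else f x * q x)" for x
      using mult_left_mono[OF g(2)[of x] less_imp_le[OF f0[of x]]] f0[of x] by (auto simp: abs_mult)
    have sq: "(\<lambda>x. if x \<in> F m then 0 else f x * q x) summable_on UNIV"
      by (rule summable_on_real_bound[OF q]) (use f0 q0 in \<open>auto simp: less_imp_le abs_mult\<close>)
    have hs: "(\<lambda>x. \<integral>g. \<bar>?h x g\<bar> \<partial>P) summable_on UNIV"
      by (rule summable_on_real_bound[OF sq]) (use le in \<open>auto simp: Bochner_Integration.integral_nonneg abs_of_nonneg\<close>)
    have T: "T m = (\<lambda>g. \<Sum>\<^sub>\<infinity>x. ?h x g)" by (auto simp: T_def)
    show "integrable P (T m)" unfolding T by (rule expectation_infsum(1)[OF sigma_finite_measure_axioms i hs])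
    have "(\<integral>g. T m g \<partial>P) = (\<Sum>\<^sub>\<infinity>x. \<integral>g. ?h x g \<partial>P)"
      unfolding T by (rule expectation_infsum(2)[OF sigma_finite_measure_axioms i hs])
    also have "\<dots> \<le> (\<Sum>\<^sub>\<infinity>x. if x \<in> F m then 0 else f x * q x)"
    proof (rule infsum_mono[OF _ sq])
      have nn: "\<bar>?h x g\<bar> = ?h x g" for x g using f0[of x] by (simp add: abs_mult)
      show "(\<lambda>x. \<integral>g. ?h x g \<partial>P) summable_on UNIV" using hs by (simp only: nn)
      show "(\<integral>g. ?h x g \<partial>P) \<le> (if x \<in> F m then 0 else f x * q x)" for x using le[of x] by (simp only: nn)
    qed
    also have "\<dots> = (\<Sum>\<^sub>\<infinity>x\<in>- F m. f x * q x)" by (rule infsum_cong_neutral) auto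
    finally show "(\<integral>g. T m g \<partial>P) \<le> b m * d m" using F(3)[of m] by linarith
  qed
  have Tm [measurable]: "T m \<in> borel_measurable P" for m using E(1) by (rule borel_measurable_integrable)
  define B where "B m = {g \<in> space P. d m \<le> T m g}" for m
  have Bm: "B m \<in> sets P" for m unfolding B_def by measurable
  have T0: "0 \<le> T m g" for m g unfolding T_def using f0 by (intro infsum_nonneg) (auto simp: less_imp_le)
  have PB: "measure P (B m) \<le> b m" for m
  proof -
    have "measure P (B m) \<le> (\<integral>g. T m g \<partial>P) / d m"
      unfolding B_def by (rule integral_Markov_inequality_measure[OF E(1) sets.top]) (use T0 d0 in auto)
    also have "\<dots> \<le> b m" using E(2)[of m] d0[of m] by (simp add: divide_le_eq)
    finally show ?thesis .
  qed
  have sb: "summable b" unfolding b_def power_add by (intro summable_mult summable_mult2 summable_geometric) simp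
  have sB: "summable (\<lambda>m. measure P (B m))" by (rule summable_comparison_test'[OF sb, of 0]) (use PB in auto)
  have "measure P (\<Union>m. B m) \<le> (\<Sum>m. measure P (B m))"
    by (rule finite_measure_subadditive_countably[OF _ sB]) (use Bm in auto)
  also have "\<dots> \<le> suminf b" by (rule suminf_le[OF PB sB sb])
  also have "suminf b = e"
  proof -
    have "b = (\<lambda>m. (e / 2) * (1/2) ^ m)" by (auto simp: b_def)
    then show ?thesis
      using suminf_mult[of "\<lambda>n. (1/2 :: real) ^ n" "e / 2"] suminf_geometric[of "1/2 :: real"]
      by (simp add: summable_geometric)
  qed
  finally have U: "measure P (\<Union>m. B m) \<le> e" .
  have Ks: "K \<in> sets P"
  proof -
    have "K = {g \<in> space P. \<forall>m. T m g \<le> d m}" by (simp add: K_def sp)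
    also have "\<dots> \<in> sets P" by measurable
    finally show ?thesis .
  qed
  have "space P - (\<Union>m. B m) \<subseteq> K" by (auto simp: K_def B_def sp not_le less_imp_le)
  then have "measure P (space P - (\<Union>m. B m)) \<le> measure P K" by (rule finite_measure_mono[OF _ Ks])
  moreover have "measure P (space P - (\<Union>m. B m)) = 1 - measure P (\<Union>m. B m)"
    by (rule prob_compl) (use Bm in auto)
  ultimately have "1 - e \<le> measure P K" using U by linarith
  then show ?thesis using comp Ks by blast
qed

text \<open>Passes from unordered summation to partial sums along an enumeration, the sequential
  form needed for dominated convergence.\<close>

lemma filterlim_to_nat_less:
  "filterlim (\<lambda>n. {x :: 'a::countable. to_nat x < n}) (finite_subsets_at_top UNIV) sequentially"
  unfolding filterlim_finite_subsets_at_top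
proof (intro allI impI)
  fix X :: "'a set" assume X: "finite X \<and> X \<subseteq> UNIV"
  have fin: "finite {x :: 'a. to_nat x < n}" for n
    by (rule finite_imageD[of to_nat]) (auto intro: finite_subset[of _ "{..<n}"] inj_on_subset[OF inj_to_nat])
  obtain N where "\<And>x. x \<in> X \<Longrightarrow> to_nat x < N"
    using X finite_nat_set_iff_bounded[of "to_nat ` X"] by auto
  then have "\<forall>n\<ge>N. X \<subseteq> {x. to_nat x < n}" by fastforce
  then show "\<forall>\<^sub>F n in sequentially. finite {x :: 'a. to_nat x < n} \<and> X \<subseteq> {x. to_nat x < n} \<and> {x :: 'a. to_nat x < n} \<subseteq> UNIV"
    using fin by (auto simp: eventually_sequentially)
qed

section \<open>Series of independent normal variables\<close>

definition iid_normal :: "('a \<Rightarrow> real) measure" where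
  "iid_normal = PiM UNIV (\<lambda>_. std_normal_distribution)"

lemma iid_normal_props:
  shows "prob_space (iid_normal :: ('a \<Rightarrow> real) measure)"
    and "(\<lambda>\<omega>. \<omega> x) \<in> borel_measurable (iid_normal :: ('a \<Rightarrow> real) measure)"
    and "distr iid_normal borel (\<lambda>\<omega>. \<omega> x) = std_normal_distribution"
    and "prob_space.indep_vars (iid_normal :: ('a \<Rightarrow> real) measure) (\<lambda>_. borel) (\<lambda>x \<omega>. \<omega> x) UNIV"
proof -
  have N: "prob_space std_normal_distribution" by (rule prob_space_normal_density) simp
  show P: "prob_space (iid_normal :: ('a \<Rightarrow> real) measure)"
    unfolding iid_normal_def by (rule prob_space_PiM[OF N])
  interpret prob_space "iid_normal :: ('a \<Rightarrow> real) measure" by fact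
  have "(\<lambda>\<omega>. \<omega> x) \<in> measurable (PiM UNIV (\<lambda>_ :: 'a. std_normal_distribution)) std_normal_distribution" for x
    by (rule measurable_component_singleton) simp
  then show m: "(\<lambda>\<omega>. \<omega> x) \<in> borel_measurable (iid_normal :: ('a \<Rightarrow> real) measure)" for x
    unfolding iid_normal_def by (simp add: measurable_def)
  have "distr (PiM UNIV (\<lambda>_ :: 'a. std_normal_distribution)) std_normal_distribution (\<lambda>\<omega>. \<omega> x) = std_normal_distribution" for x
    by (rule distr_PiM_component[OF N]) simp
  moreover have "distr (PiM UNIV (\<lambda>_ :: 'a. std_normal_distribution)) std_normal_distribution (\<lambda>\<omega>. \<omega> x)
      = distr iid_normal borel (\<lambda>\<omega>. \<omega> x)" for x
    unfolding iid_normal_def by (rule distr_cong) auto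
  ultimately show d: "distr iid_normal borel (\<lambda>\<omega>. \<omega> x) = std_normal_distribution" for x :: 'a by simp
  show "indep_vars (\<lambda>_. borel) (\<lambda>x \<omega>. \<omega> x) (UNIV :: 'a set)"
  proof (subst indep_vars_iff_distr_eq_PiM)
    have s: "sets (PiM UNIV (\<lambda>_ :: 'a. borel :: real measure)) = sets (iid_normal :: ('a \<Rightarrow> real) measure)"
      unfolding iid_normal_def by (rule sets_PiM_cong) auto
    have "distr iid_normal (PiM UNIV (\<lambda>_ :: 'a. borel :: real measure)) (\<lambda>\<omega>. \<lambda>i\<in>UNIV. \<omega> i)
        = distr iid_normal iid_normal (\<lambda>\<omega>. \<omega>)"
      by (rule distr_cong[OF refl s]) auto
    also have "\<dots> = (iid_normal :: ('a \<Rightarrow> real) measure)" by (rule distr_id2[OF refl])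
    finally show "distr iid_normal (PiM UNIV (\<lambda>_ :: 'a. borel :: real measure)) (\<lambda>\<omega>. \<lambda>i\<in>UNIV. \<omega> i)
        = PiM UNIV (\<lambda>i :: 'a. distr iid_normal borel (\<lambda>\<omega>. \<omega> i))"
      by (simp only: d iid_normal_def[symmetric])
  qed (use m in auto)
qed

lemma iid_normal_abs_moment: "integrable iid_normal (\<lambda>\<omega>. \<omega> x)" "(\<integral>\<omega>. \<bar>\<omega> x\<bar> \<partial>iid_normal) \<le> 1"
proof -
  note m = iid_normal_props(2)[of x] and d = iid_normal_props(3)[of x]
  interpret prob_space iid_normal by (rule iid_normal_props(1))
  have 2: "integrable iid_normal (\<lambda>\<omega>. (\<omega> x)\<^sup>2)" "(\<integral>\<omega>. (\<omega> x)\<^sup>2 \<partial>iid_normal) = 1"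
  proof -
    have "integrable std_normal_distribution (\<lambda>x. x\<^sup>2)" using integrable_std_normal_distribution_moment[of 2] by simp
    then show "integrable iid_normal (\<lambda>\<omega>. (\<omega> x)\<^sup>2)"
      unfolding d[symmetric] by (subst (asm) integrable_distr_eq[OF m]) auto
    have "(\<integral>z. z\<^sup>2 \<partial>std_normal_distribution) = 1" using std_normal_distribution_even_moments(1)[of 1] by simp
    then show "(\<integral>\<omega>. (\<omega> x)\<^sup>2 \<partial>iid_normal) = 1"
      unfolding d[symmetric] by (subst (asm) integral_distr[OF m]) auto
  qed
  have "integrable iid_normal (\<lambda>\<omega>. 1\<^sup>2 :: real)" "(\<integral>\<omega>. 1\<^sup>2 \<partial>iid_normal) \<le> (1::real)\<^sup>2" by (auto simp: prob_space)
  from expectation_abs_mult_le[OF m _ 2(1) _ _ this, of 1]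
  show "integrable iid_normal (\<lambda>\<omega>. \<omega> x)" "(\<integral>\<omega>. \<bar>\<omega> x\<bar> \<partial>iid_normal) \<le> 1" using 2(2) by auto
qed

lemma iid_normal_series_AE:
  fixes a :: "'a::countable \<Rightarrow> real"
  assumes "a summable_on UNIV"
  shows "AE \<omega> in iid_normal. (\<lambda>x. a x * \<bar>\<omega> x\<bar>) summable_on UNIV"
proof (rule expectation_infsum(3))
  interpret prob_space "iid_normal :: ('a \<Rightarrow> real) measure" by (rule iid_normal_props(1))
  show "sigma_finite_measure (iid_normal :: ('a \<Rightarrow> real) measure)" by unfold_locales
  show "integrable iid_normal (\<lambda>\<omega>. a x * \<bar>\<omega> x\<bar>)" for x using iid_normal_abs_moment(1)[of x] by simp
  show "(\<lambda>x. \<integral>\<omega>. \<bar>a x * \<bar>\<omega> x\<bar>\<bar> \<partial>iid_normal) summable_on UNIV"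
  proof (rule summable_on_real_bound[OF summable_on_real_abs[OF assms]])
    fix x
    show "\<bar>\<integral>\<omega>. \<bar>a x * \<bar>\<omega> x\<bar>\<bar> \<partial>iid_normal\<bar> \<le> \<bar>a x\<bar>"
      using mult_left_mono[OF iid_normal_abs_moment(2)[of x], of "\<bar>a x\<bar>"]
      by (simp add: abs_mult abs_of_nonneg Bochner_Integration.integral_nonneg)
  qed
qed

text \<open>Finite partial sums have Gaussian characteristic functions by independence. The series
  converges absolutely almost surely, so by bounded convergence these functions tend to that of the
  series, and uniqueness of characteristic functions identifies the law.\<close>

lemma iid_normal_series:
  fixes a :: "'a::countable \<Rightarrow> real"
  assumes a: "a summable_on UNIV"
  shows "distr iid_normal borel (\<lambda>\<omega>. \<Sum>\<^sub>\<infinity>x. a x * \<omega> x) = normal_law 0 (\<Sum>\<^sub>\<infinity>x. (a x)\<^sup>2)"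
proof (rule Levy_uniqueness)
  interpret prob_space "iid_normal :: ('a \<Rightarrow> real) measure" by (rule iid_normal_props(1))
  have v: "0 \<le> (\<Sum>\<^sub>\<infinity>x. (a x)\<^sup>2)" by (intro infsum_nonneg) simp
  note m [measurable] = iid_normal_props(2)
  have mm [measurable]: "(\<lambda>\<omega>. \<Sum>\<^sub>\<infinity>x. a x * \<omega> x) \<in> borel_measurable iid_normal"
    by (rule borel_measurable_infsum(1)) (use m in simp)
  show "real_distribution (distr iid_normal borel (\<lambda>\<omega>. \<Sum>\<^sub>\<infinity>x. a x * \<omega> x))"
    by (rule real_distribution_distr[OF mm])
  show "real_distribution (normal_law 0 (\<Sum>\<^sub>\<infinity>x. (a x)\<^sup>2))" by (rule normal_law_moments(1)[OF v])
  define Fn where "Fn n = {x :: 'a. to_nat x < n}" for n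
  have fin: "finite (Fn n)" for n
    unfolding Fn_def
    by (rule finite_imageD[of to_nat]) (auto intro: finite_subset[of _ "{..<n}"] inj_on_subset[OF inj_to_nat])
  have lim: "(\<lambda>n. sum h (Fn n)) \<longlonglongrightarrow> infsum h UNIV" if "h summable_on UNIV" for h :: "'a \<Rightarrow> real"
    using filterlim_compose[OF has_sum_infsum[OF that, unfolded has_sum_def] filterlim_to_nat_less] by (simp add: Fn_def)
  show "char (distr iid_normal borel (\<lambda>\<omega>. \<Sum>\<^sub>\<infinity>x. a x * \<omega> x)) = char (normal_law 0 (\<Sum>\<^sub>\<infinity>x. (a x)\<^sup>2))"
  proof
    fix t
    have cn: "char (distr iid_normal borel (\<lambda>\<omega>. \<Sum>x\<in>Fn n. a x * \<omega> x)) t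
        = complex_of_real (exp (- ((\<Sum>x\<in>Fn n. (a x)\<^sup>2) * t\<^sup>2) / 2))" for n
    proof -
      have ind: "indep_vars (\<lambda>_. borel) (\<lambda>x \<omega>. a x * \<omega> x) (Fn n)"
        by (rule indep_vars_compose2[where X="\<lambda>x \<omega>. \<omega> x" and Y="\<lambda>x z. a x * z", OF indep_vars_subset[OF iid_normal_props(4)]]) auto
      have one: "char (distr iid_normal borel (\<lambda>\<omega>. a x * \<omega> x)) t = complex_of_real (exp (- ((a x)\<^sup>2 * t\<^sup>2) / 2))" for x
      proof -
        have "char (distr iid_normal borel (\<lambda>\<omega>. a x * \<omega> x)) t = char (distr iid_normal borel (\<lambda>\<omega>. \<omega> x)) (t * a x)"
          unfolding char_def by (simp add: integral_distr mult.assoc)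
        then show ?thesis
          unfolding iid_normal_props(3) by (simp add: char_std_normal_distribution power_mult_distrib mult.commute)
      qed
      have "char (distr iid_normal borel (\<lambda>\<omega>. \<Sum>x\<in>Fn n. a x * \<omega> x)) t
          = (\<Prod>x\<in>Fn n. complex_of_real (exp (- ((a x)\<^sup>2 * t\<^sup>2) / 2)))"
        by (simp add: char_distr_sum[OF ind] one)
      also have "\<dots> = complex_of_real (exp (\<Sum>x\<in>Fn n. - ((a x)\<^sup>2 * t\<^sup>2) / 2))"
        by (simp add: exp_sum[OF fin])
      also have "(\<Sum>x\<in>Fn n. - ((a x)\<^sup>2 * t\<^sup>2) / 2) = - ((\<Sum>x\<in>Fn n. (a x)\<^sup>2) * t\<^sup>2) / 2"
        by (simp add: sum_negf sum_divide_distrib sum_distrib_right)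
      finally show ?thesis .
    qed
    have "(\<lambda>n. char (distr iid_normal borel (\<lambda>\<omega>. \<Sum>x\<in>Fn n. a x * \<omega> x)) t)
        \<longlonglongrightarrow> complex_of_real (exp (- ((\<Sum>\<^sub>\<infinity>x. (a x)\<^sup>2) * t\<^sup>2) / 2))"
      unfolding cn by (intro tendsto_intros lim summable_on_square a) auto
    moreover have "(\<lambda>n. char (distr iid_normal borel (\<lambda>\<omega>. \<Sum>x\<in>Fn n. a x * \<omega> x)) t)
        \<longlonglongrightarrow> char (distr iid_normal borel (\<lambda>\<omega>. \<Sum>\<^sub>\<infinity>x. a x * \<omega> x)) t"
    proof -
      have c: "char (distr iid_normal borel X) t = (CLINT \<omega>|iid_normal. iexp (t * X \<omega>))"
        if "X \<in> borel_measurable iid_normal" for X :: "('a \<Rightarrow> real) \<Rightarrow> real"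
        unfolding char_def using that by (subst integral_distr) auto
      have ms: "(\<lambda>\<omega>. \<Sum>x\<in>Fn n. a x * \<omega> x) \<in> borel_measurable iid_normal" for n by measurable
      show ?thesis
        unfolding c[OF mm] c[OF ms]
      proof (rule integral_dominated_convergence[where w="\<lambda>_. 1"])
        show "AE \<omega> in iid_normal. (\<lambda>n. iexp (t * (\<Sum>x\<in>Fn n. a x * \<omega> x))) \<longlonglongrightarrow> iexp (t * (\<Sum>\<^sub>\<infinity>x. a x * \<omega> x))"
          using iid_normal_series_AE[OF summable_on_real_abs[OF a]]
        proof eventually_elim
          case (elim \<omega>)
          have "(\<lambda>x. a x * \<omega> x) summable_on UNIV"
            by (rule summable_on_real_bound[OF elim]) (simp add: abs_mult)
          from lim[OF this] show ?case by (intro tendsto_intros)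
        qed
      qed (use ms mm in auto)
    qed
    ultimately show "char (distr iid_normal borel (\<lambda>\<omega>. \<Sum>\<^sub>\<infinity>x. a x * \<omega> x)) t = char (normal_law 0 (\<Sum>\<^sub>\<infinity>x. (a x)\<^sup>2)) t"
      unfolding normal_law_moments(6)[OF v] using LIMSEQ_unique by blast
  qed
qed

text \<open>The process is \<open>G\<^sub>x = sqrt r\<^sub>x Z\<^sub>x - r\<^sub>x (\<Sum>j. sqrt r\<^sub>j Z\<^sub>j)\<close> for independent standard normal \<open>Z\<close>.\<close>

lemma multinomial_gaussian_exists:
  fixes f :: "'a::countable \<Rightarrow> real" and r :: "'a pmf"
  assumes f: "\<And>x. 1 \<le> f x" and fq: "(\<lambda>x. f x * sqrt (pmf r x)) summable_on UNIV"
  shows "\<exists>P. tight_centered_gaussian f P \<and> (\<forall>x x'. covar P (\<lambda>g. g x) (\<lambda>g. g x') = multinomial_cov r x x')"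
proof -
  interpret Z: prob_space "iid_normal :: ('a \<Rightarrow> real) measure" by (rule iid_normal_props(1))
  have f0: "0 < f x" for x using f[of x] by linarith
  define q where "q x = sqrt (pmf r x)" for x
  have q: "0 \<le> q x" "q x * q x = pmf r x" "pmf r x \<le> q x" for x
    using pmf_le_1[of r x] by (auto simp: q_def) (metis pmf_nonneg real_sqrt_le_iff real_le_rsqrt power2_eq_square mult_left_le)
  have fqs: "(\<lambda>x. f x * q x) summable_on UNIV" using fq by (simp add: q_def)
  have qs: "q summable_on UNIV"
    by (rule summable_on_real_bound[OF fqs]) (use q f mult_right_mono[OF f q(1)] in auto)
  have q2s: "(\<lambda>x. (q x)\<^sup>2) summable_on UNIV" "(\<Sum>\<^sub>\<infinity>x. (q x)\<^sup>2) = 1"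
    using pmf_summable[of r] infsum_pmf[of r] by (simp_all add: power2_eq_square q(2))
  define W where "W \<omega> = (\<Sum>\<^sub>\<infinity>j. q j * \<omega> j)" for \<omega> :: "'a \<Rightarrow> real"
  \<comment> \<open>Off this almost sure event the sequence might leave the space; \<open>G\<close>
    is set to 0 there so that it takes values in \<open>ell1 f\<close> everywhere.\<close>
  define good where "good \<omega> \<longleftrightarrow> (\<lambda>x. (f x * q x) * \<bar>\<omega> x\<bar>) summable_on UNIV" for \<omega> :: "'a \<Rightarrow> real"
  define G where "G \<omega> = (\<lambda>x. if good \<omega> then q x * \<omega> x - pmf r x * W \<omega> else 0)" for \<omega> :: "'a \<Rightarrow> real"
  have AEgood: "AE \<omega> in iid_normal. good \<omega>" unfolding good_def by (rule iid_normal_series_AE[OF fqs])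
  note m [measurable] = iid_normal_props(2)
  have [measurable]: "W \<in> borel_measurable iid_normal"
    unfolding W_def by (rule borel_measurable_infsum(1)) measurable
  have [measurable]: "Measurable.pred iid_normal good"
    unfolding good_def by (rule borel_measurable_infsum(2)) measurable
  have Gm: "(\<lambda>\<omega>. G \<omega> x) \<in> borel_measurable iid_normal" for x unfolding G_def by measurable
  have GE: "G \<omega> \<in> ell1 f" for \<omega>
  proof (cases "good \<omega>")
    case True
    show ?thesis unfolding ell1_def mem_Collect_eq
    proof (rule summable_on_real_bound)
      show "(\<lambda>x. (f x * q x) * \<bar>\<omega> x\<bar> + \<bar>W \<omega>\<bar> * (f x * q x)) summable_on UNIV"
        using True unfolding good_def by (intro summable_on_add summable_on_cmult_right fqs)
      fix x
      have "f x * \<bar>q x * \<omega> x - pmf r x * W \<omega>\<bar> \<le> f x * (q x * \<bar>\<omega> x\<bar> + q x * \<bar>W \<omega>\<bar>)"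
        using f0[of x] q by (intro mult_left_mono order_trans[OF abs_triangle_ineq4] add_mono) (auto simp: abs_mult intro: mult_right_mono)
      then show "\<bar>f x * \<bar>G \<omega> x\<bar>\<bar> \<le> (f x * q x) * \<bar>\<omega> x\<bar> + \<bar>W \<omega>\<bar> * (f x * q x)"
        using True f0[of x] by (simp add: G_def abs_mult algebra_simps)
    qed
  qed (simp add: G_def ell1_def)
  have GB: "G \<in> measurable iid_normal (ell1_borel f)" by (rule measurable_ell1_borelI[OF f0 GE Gm])
  define P where "P = distr iid_normal (ell1_borel f) G"
  have P: "prob_space P" unfolding P_def by (rule Z.prob_space_distr[OF GB])
  have sP: "sets P = sets (ell1_borel f)" by (simp add: P_def)
  have cm: "(\<lambda>g. g x) \<in> borel_measurable P" for x
    unfolding measurable_cong_sets[OF sP refl] by (rule ell1_coordinate_measurable[OF f0])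
  \<comment> \<open>The variance of the function \<open>t\<close>, cut off to \<open>F\<close>,
    under \<open>r\<close>; it is what the prescribed covariances assign to the linear form.\<close>
  define var where "var F t = (\<Sum>x\<in>F. (t x)\<^sup>2 * pmf r x) - (\<Sum>x\<in>F. t x * pmf r x)\<^sup>2" for F and t :: "'a \<Rightarrow> real"
  have fd: "distr P borel (\<lambda>g. \<Sum>x\<in>F. t x * g x) = normal_law 0 (var F t) \<and> 0 \<le> var F t" if F: "finite F" for F and t :: "'a \<Rightarrow> real"
  proof -
    \<comment> \<open>Substituting the formula for \<open>G\<close>, the finite linear form becomes
      the single series with coefficients \<open>a x = b x - \<tau> * q x\<close>. The squares of
      these coefficients sum to \<open>var F t\<close> because the squares of \<open>q\<close> sum
      to 1.\<close>
    define \<tau> where "\<tau> = (\<Sum>x\<in>F. t x * pmf r x)"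
    define b where "b x = (if x \<in> F then t x * q x else 0)" for x
    define a where "a x = b x - \<tau> * q x" for x
    have bsum: "(h has_sum sum h F) UNIV" if "\<And>x. x \<notin> F \<Longrightarrow> h x = 0" for h :: "'a \<Rightarrow> real"
      by (rule has_sum_cong_neutral[THEN iffD1, OF _ _ _ has_sum_finite[OF F]]) (use that in auto)
    have bs: "(b has_sum sum b F) UNIV" by (rule bsum) (simp add: b_def)
    have as: "a summable_on UNIV"
      unfolding a_def by (intro summable_on_real_diff has_sum_imp_summable[OF bs] summable_on_cmult_right qs)
    have a2: "(\<Sum>\<^sub>\<infinity>x. (a x)\<^sup>2) = var F t"
    proof -
      have 1: "((\<lambda>x. (b x)\<^sup>2) has_sum (\<Sum>x\<in>F. (b x)\<^sup>2)) UNIV" by (rule bsum) (simp add: b_def)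
      have 2: "((\<lambda>x. (2 * \<tau>) * (b x * q x)) has_sum (2 * \<tau>) * (\<Sum>x\<in>F. b x * q x)) UNIV"
        by (intro has_sum_cmult_right bsum) (simp add: b_def)
      have 3: "((\<lambda>x. \<tau>\<^sup>2 * (q x)\<^sup>2) has_sum \<tau>\<^sup>2 * 1) UNIV"
        using has_sum_infsum[OF q2s(1)] q2s(2) by (intro has_sum_cmult_right) simp
      have "(a x)\<^sup>2 = (b x)\<^sup>2 - (2 * \<tau>) * (b x * q x) + \<tau>\<^sup>2 * (q x)\<^sup>2" for x
        by (simp add: a_def power2_eq_square algebra_simps)
      then have "((\<lambda>x. (a x)\<^sup>2) has_sum ((\<Sum>x\<in>F. (b x)\<^sup>2) - (2 * \<tau>) * (\<Sum>x\<in>F. b x * q x) + \<tau>\<^sup>2 * 1)) UNIV"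
        using has_sum_add[OF has_sum_real_diff[OF 1 2] 3] by simp
      moreover have "(\<Sum>x\<in>F. (b x)\<^sup>2) = (\<Sum>x\<in>F. (t x)\<^sup>2 * pmf r x)"
        by (rule sum.cong) (auto simp: b_def power_mult_distrib power2_eq_square[of "q _"] q(2))
      moreover have "(\<Sum>x\<in>F. b x * q x) = \<tau>"
        unfolding \<tau>_def by (rule sum.cong) (auto simp: b_def mult.assoc q(2))
      ultimately have "((\<lambda>x. (a x)\<^sup>2) has_sum var F t) UNIV"
        by (simp add: var_def \<tau>_def[symmetric] power2_eq_square algebra_simps)
      then show ?thesis by (rule infsumI)
    qed
    have "distr P borel (\<lambda>g. \<Sum>x\<in>F. t x * g x) = distr iid_normal borel ((\<lambda>g. \<Sum>x\<in>F. t x * g x) \<circ> G)"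
      unfolding P_def
    proof (rule distr_distr[OF _ GB])
      have "(\<lambda>g. \<Sum>x\<in>F. t x * g x) \<in> borel_measurable P" using cm by measurable
      then show "(\<lambda>g. \<Sum>x\<in>F. t x * g x) \<in> borel_measurable (ell1_borel f)"
        unfolding measurable_cong_sets[OF sP refl] .
    qed
    also have "\<dots> = distr iid_normal borel (\<lambda>\<omega>. \<Sum>\<^sub>\<infinity>x. a x * \<omega> x)"
    proof (rule distr_cong_AE[OF refl refl])
      show "AE \<omega> in iid_normal. ((\<lambda>g. \<Sum>x\<in>F. t x * g x) \<circ> G) \<omega> = (\<Sum>\<^sub>\<infinity>x. a x * \<omega> x)"
        using AEgood
      proof eventually_elim
        case (elim \<omega>)
        have qw: "(\<lambda>x. q x * \<omega> x) summable_on UNIV"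
        proof (rule summable_on_real_bound)
          show "(\<lambda>x. (f x * q x) * \<bar>\<omega> x\<bar>) summable_on UNIV" using elim by (simp add: good_def)
          show "\<bar>q x * \<omega> x\<bar> \<le> (f x * q x) * \<bar>\<omega> x\<bar>" for x
            using mult_right_mono[OF mult_right_mono[OF f[of x] q(1)[of x]], of "\<bar>\<omega> x\<bar>"] q(1)[of x] by (simp add: abs_mult)
        qed
        have bw: "((\<lambda>x. b x * \<omega> x) has_sum (\<Sum>x\<in>F. b x * \<omega> x)) UNIV" by (rule bsum) (simp add: b_def)
        have "((\<lambda>x. a x * \<omega> x) has_sum ((\<Sum>x\<in>F. b x * \<omega> x) - \<tau> * W \<omega>)) UNIV"
          using has_sum_real_diff[OF bw has_sum_cmult_right[OF has_sum_infsum[OF qw], of \<tau>]]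
          by (simp add: a_def W_def algebra_simps)
        then have "(\<Sum>\<^sub>\<infinity>x. a x * \<omega> x) = (\<Sum>x\<in>F. b x * \<omega> x) - \<tau> * W \<omega>" by (rule infsumI)
        also have "\<dots> = (\<Sum>x\<in>F. t x * (q x * \<omega> x - pmf r x * W \<omega>))"
          unfolding \<tau>_def sum_distrib_right sum_subtractf[symmetric]
          by (rule sum.cong) (auto simp: b_def algebra_simps)
        finally show ?case using elim by (simp add: G_def)
      qed
      show "(\<lambda>g. \<Sum>x\<in>F. t x * g x) \<circ> G \<in> borel_measurable iid_normal"
        unfolding comp_def using Gm by measurable
      show "(\<lambda>\<omega>. \<Sum>\<^sub>\<infinity>x. a x * \<omega> x) \<in> borel_measurable iid_normal"
        by (rule borel_measurable_infsum(1)) measurable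
    qed
    also have "\<dots> = normal_law 0 (var F t)" unfolding iid_normal_series[OF as] a2 ..
    finally show ?thesis using infsum_nonneg[of UNIV "\<lambda>x. (a x)\<^sup>2"] unfolding a2 by simp
  qed
  have mom: "integrable P (\<lambda>g. (\<Sum>x\<in>F. t x * g x)\<^sup>2)" "(\<integral>g. (\<Sum>x\<in>F. t x * g x)\<^sup>2 \<partial>P) = var F t"
    "integrable P (\<lambda>g. \<Sum>x\<in>F. t x * g x)" "(\<integral>g. (\<Sum>x\<in>F. t x * g x) \<partial>P) = 0"
    if F: "finite F" for F and t :: "'a \<Rightarrow> real"
  proof -
    have mF: "(\<lambda>g. \<Sum>x\<in>F. t x * g x) \<in> borel_measurable P" using cm by measurable
    have v: "0 \<le> var F t" and d: "normal_law 0 (var F t) = distr P borel (\<lambda>g. \<Sum>x\<in>F. t x * g x)"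
      using fd[OF F, of t] by auto
    note N = normal_law_moments(2-5)[OF v, unfolded d]
    show "integrable P (\<lambda>g. (\<Sum>x\<in>F. t x * g x)\<^sup>2)" using N(3) by (subst (asm) integrable_distr_eq[OF mF]) auto
    show "integrable P (\<lambda>g. \<Sum>x\<in>F. t x * g x)" using N(1) by (subst (asm) integrable_distr_eq[OF mF]) auto
    show "(\<integral>g. (\<Sum>x\<in>F. t x * g x)\<^sup>2 \<partial>P) = var F t" using N(4) by (subst (asm) integral_distr[OF mF]) auto
    show "(\<integral>g. (\<Sum>x\<in>F. t x * g x) \<partial>P) = 0" using N(2) by (subst (asm) integral_distr[OF mF]) auto
  qed
  interpret P: prob_space P by (rule P)
  have g: "integrable P (\<lambda>g. g x)" "(\<integral>g. g x \<partial>P) = 0" "integrable P (\<lambda>g. (g x)\<^sup>2)"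
    "(\<integral>g. (g x)\<^sup>2 \<partial>P) = pmf r x - (pmf r x)\<^sup>2" for x
    using mom[of "{x}" "\<lambda>_. 1"] by (simp_all add: var_def)
  have gabs: "(\<integral>g. \<bar>g x\<bar> \<partial>P) \<le> q x" for x
  proof -
    have one: "integrable P (\<lambda>g. 1\<^sup>2 :: real)" "(\<integral>g. 1\<^sup>2 \<partial>P) \<le> (1::real)\<^sup>2" by (auto simp: P.prob_space)
    have "(\<integral>g. (g x)\<^sup>2 \<partial>P) \<le> (q x)\<^sup>2" using g(4)[of x] by (simp add: power2_eq_square q(2))
    from expectation_abs_mult_le(2)[OF cm _ g(3) this q(1) one] show ?thesis by simp
  qed
  have cov: "covar P (\<lambda>g. g x) (\<lambda>g. g x') = multinomial_cov r x x'" for x x'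
  proof (cases "x = x'")
    case True
    then show ?thesis using g[of x] by (simp add: covar_def multinomial_cov_def power2_eq_square right_diff_distrib)
  next
    case False
    have s: "(\<Sum>z\<in>{x, x'}. (if z = x then 1 else c) * h z) = h x + c * h x'" for c :: real and h
      using False by auto
    have e: "(\<integral>g. (g x + c * g x')\<^sup>2 \<partial>P) = pmf r x + c\<^sup>2 * pmf r x' - (pmf r x + c * pmf r x')\<^sup>2"
      "integrable P (\<lambda>g. (g x + c * g x')\<^sup>2)" for c :: real
    proof -
      have "var {x, x'} (\<lambda>z. if z = x then 1 else c) = pmf r x + c\<^sup>2 * pmf r x' - (pmf r x + c * pmf r x')\<^sup>2"
        using False by (auto simp: var_def)
      then show "(\<integral>g. (g x + c * g x')\<^sup>2 \<partial>P) = pmf r x + c\<^sup>2 * pmf r x' - (pmf r x + c * pmf r x')\<^sup>2"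
        "integrable P (\<lambda>g. (g x + c * g x')\<^sup>2)"
        using mom(1,2)[of "{x, x'}" "\<lambda>z. if z = x then 1 else c"] unfolding s by auto
    qed
    \<comment> \<open>Polarisation: the mixed moment is recovered from the variances of the sum and
      the difference of the two coordinates, i.e. \<open>c = 1\<close> and \<open>c = -1\<close>
      above.\<close>
    have "(\<integral>g. g x * g x' \<partial>P) = (\<integral>g. ((g x + 1 * g x')\<^sup>2 - (g x + (-1) * g x')\<^sup>2) / 4 \<partial>P)"
      by (rule Bochner_Integration.integral_cong) (auto simp: power2_eq_square algebra_simps)
    also have "\<dots> = ((\<integral>g. (g x + 1 * g x')\<^sup>2 \<partial>P) - (\<integral>g. (g x + (-1) * g x')\<^sup>2 \<partial>P)) / 4"
      using e(2)[of 1] e(2)[of "-1"] by (simp only: integral_divide_zero Bochner_Integration.integral_diff)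
    also have "\<dots> = - (pmf r x * pmf r x')"
      unfolding e(1) by (simp add: power2_eq_square algebra_simps)
    finally show ?thesis using False g(2) by (simp add: covar_def multinomial_cov_def)
  qed
  have "tight_centered_gaussian f P"
    unfolding tight_centered_gaussian_def
    using P sP ell1_tight[OF f P sP g(1) gabs fqs] fd by blast
  then show ?thesis using cov by blast
qed

section \<open>The central limit theorem\<close>

text \<open>The last clause displays the empirical measure as a function of the list of the first
  \<open>n\<close> samples, a value in a countable type; measurability of functionals rests on
  it.\<close>

lemma empirical_props:
  assumes "0 < n"
  shows "set_pmf (empirical n Y) = Y ` {..<n}"
    and "(\<integral>x. f x \<partial>measure_pmf (empirical n Y)) = (\<Sum>i<n. f (Y i)) / real n"
    and "pmf (empirical n Y) x = (\<Sum>i<n. indicator {x} (Y i)) / real n"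
    and "empirical n Y = empirical n ((!) (map Y [0..<n]))"
proof -
  have ne: "{..<n} \<noteq> {}" "finite {..<n}" using assms by auto
  show "set_pmf (empirical n Y) = Y ` {..<n}" by (simp add: empirical_def ne set_pmf_of_set)
  show I: "(\<integral>x. f x \<partial>measure_pmf (empirical n Y)) = (\<Sum>i<n. f (Y i)) / real n" for f :: "_ \<Rightarrow> real"
    by (simp add: empirical_def integral_pmf_of_set[OF ne])
  show "pmf (empirical n Y) x = (\<Sum>i<n. indicator {x} (Y i)) / real n"
    using I[of "indicator {x}"] by (simp add: measure_pmf_single)
  show "empirical n Y = empirical n ((!) (map Y [0..<n]))"
    unfolding empirical_def by (rule map_pmf_cong) (use ne in auto)
qed

lemma cmod_iexp_diff_le: "cmod (iexp a - iexp b) \<le> min 2 \<bar>a - b\<bar>"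
proof -
  have "iexp a - iexp b = iexp b * (iexp (a - b) - 1)"
    by (simp add: algebra_simps exp_add[symmetric])
  then have "cmod (iexp a - iexp b) = cmod (iexp (a - b) - 1)" by (simp add: norm_mult)
  also have "\<dots> \<le> \<bar>a - b\<bar>" using iexp_approx1[of "a - b" 0] by simp
  finally have "cmod (iexp a - iexp b) \<le> \<bar>a - b\<bar>" .
  moreover have "cmod (iexp a - iexp b) \<le> 2"
    using norm_triangle_ineq4[of "iexp a" "iexp b"] by simp
  ultimately show ?thesis by simp
qed

text \<open>Interpolates between the two bounds for differences of characteristic exponentials.
  Applied to a remainder quadratic in the empirical norm, it leaves a bound linear in that
  norm.\<close>

lemma min_2_le_sqrt:
  fixes z :: real
  assumes "0 \<le> z"
  shows "min 2 z \<le> sqrt (2 * z)"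
proof (cases "z \<le> 2")
  case True
  then have "z * z \<le> 2 * z" using assms by (intro mult_right_mono) auto
  then have "z \<le> sqrt (2 * z)" by (intro real_le_rsqrt) (simp add: power2_eq_square)
  then show ?thesis by simp
next
  case False
  then have "2 \<le> sqrt (2 * z)" by (intro real_le_rsqrt) simp
  then show ?thesis by simp
qed

lemma map_upt_eq_iff: "map g [0..<n] = l \<longleftrightarrow> length l = n \<and> (\<forall>i\<in>{..<n}. g i = l ! i)"
proof
  assume "map g [0..<n] = l"
  then have "l = map g [0..<n]" by (rule sym)
  then show "length l = n \<and> (\<forall>i\<in>{..<n}. g i = l ! i)" by simp
next
  assume l: "length l = n \<and> (\<forall>i\<in>{..<n}. g i = l ! i)"
  show "map g [0..<n] = l"
  proof (rule nth_equalityI)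
    show "length (map g [0..<n]) = length l" using l by simp
    fix i assume "i < length (map g [0..<n])"
    then have "i < n" by simp
    then show "map g [0..<n] ! i = l ! i" using l by simp
  qed
qed

section \<open>Limit theorems for i.i.d. samples\<close>

context prob_space
begin

lemma iid_square_sum:
  fixes Z :: "nat \<Rightarrow> 'a \<Rightarrow> real"
  assumes ind: "indep_vars (\<lambda>_. borel) Z UNIV" and i1: "\<And>i. integrable M (Z i)" and i2: "\<And>i. integrable M (\<lambda>w. (Z i w)\<^sup>2)"
    and m: "\<And>i. (\<integral>w. Z i w \<partial>M) = 0" and v: "\<And>i. (\<integral>w. (Z i w)\<^sup>2 \<partial>M) = v"
  shows "integrable M (\<lambda>w. (\<Sum>i<n. Z i w)\<^sup>2)" "(\<integral>w. (\<Sum>i<n. Z i w)\<^sup>2 \<partial>M) = real n * v"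
proof -
  have e: "(\<lambda>w. (\<Sum>i<n. Z i w)\<^sup>2) = (\<lambda>w. \<Sum>i<n. \<Sum>j<n. Z i w * Z j w)"
    by (simp add: power2_eq_square sum_product)
  have ij: "integrable M (\<lambda>w. Z i w * Z j w) \<and> (\<integral>w. Z i w * Z j w \<partial>M) = (if i = j then v else 0)" for i j
  proof (cases "i = j")
    case True
    then show ?thesis using i2[of i] v[of i] by (simp add: power2_eq_square)
  next
    case False
    have I: "indep_vars (\<lambda>_. borel) Z {i, j}" by (rule indep_vars_subset[OF ind]) simp
    have "(\<integral>w. (\<Prod>k\<in>{i, j}. Z k w) \<partial>M) = (\<Prod>k\<in>{i, j}. \<integral>w. Z k w \<partial>M)"
      "integrable M (\<lambda>w. \<Prod>k\<in>{i, j}. Z k w)"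
      by (rule indep_vars_lebesgue_integral[OF _ I] indep_vars_integrable[OF _ I], simp, rule i1)+
    then show ?thesis using m False by simp
  qed
  then show "integrable M (\<lambda>w. (\<Sum>i<n. Z i w)\<^sup>2)" unfolding e by (intro Bochner_Integration.integrable_sum) simp
  have "(\<integral>w. (\<Sum>i<n. Z i w)\<^sup>2 \<partial>M) = (\<Sum>i<n. \<Sum>j<n. (if i = j then v else 0))"
    unfolding e using ij by (simp add: Bochner_Integration.integral_sum)
  also have "\<dots> = (\<Sum>i<n. v)" by (intro sum.cong) (auto simp: sum.delta')
  finally show "(\<integral>w. (\<Sum>i<n. Z i w)\<^sup>2 \<partial>M) = real n * v" by simp
qed

text \<open>Lists over a countable type form a countable discrete space, so any functional of
  finitely many samples is measurable. This matters because the Sinkhorn cost is defined by a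
  minimisation, with no measurability known in advance.\<close>

lemma measurable_of_samples:
  fixes X :: "nat \<Rightarrow> 'a \<Rightarrow> 'x::countable" and Phi :: "'x list \<Rightarrow> real"
  assumes X: "\<And>i. X i \<in> measurable M (count_space UNIV)"
  shows "(\<lambda>w. Phi (map (\<lambda>i. X i w) [0..<n])) \<in> borel_measurable M"
proof -
  have "(\<lambda>w. map (\<lambda>i. X i w) [0..<n]) -` {l} \<inter> space M \<in> sets M" for l :: "'x list"
  proof -
    have "map (\<lambda>i. X i w) [0..<n] = l \<longleftrightarrow> length l = n \<and> (\<forall>i\<in>{..<n}. X i w = l ! i)" for w
      by (rule map_upt_eq_iff)
    then have "(\<lambda>w. map (\<lambda>i. X i w) [0..<n]) -` {l} \<inter> space M
        = {w \<in> space M. length l = n \<and> (\<forall>i\<in>{..<n}. X i w = l ! i)}" by blast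
    also have "\<dots> \<in> sets M"
    proof -
      have "{w \<in> space M. X i w = l ! i} \<in> sets M" for i
        using measurable_sets[OF X[of i], of "{l ! i}"] by (simp add: vimage_def Int_def conj_commute)
      then have "{w \<in> space M. \<forall>i\<in>{..<n}. X i w = l ! i} \<in> sets M"
        by (intro sets.sets_Collect_finite_All) auto
      then show ?thesis by (cases "length l = n") simp_all
    qed
    finally show ?thesis .
  qed
  then have "(\<lambda>w. map (\<lambda>i. X i w) [0..<n]) \<in> measurable M (count_space UNIV)"
    by (subst measurable_count_space_eq2_countable) simp
  from measurable_compose[OF this, of Phi borel] show ?thesis by simp
qed

lemma expectation_distr_pmf:
  fixes g :: "'x \<Rightarrow> real"
  assumes Y: "Y \<in> measurable M (count_space UNIV)" and d: "distr M (count_space UNIV) Y = measure_pmf r"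
  shows "integrable M (\<lambda>w. g (Y w)) \<longleftrightarrow> integrable (measure_pmf r) g"
    "(\<integral>w. g (Y w) \<partial>M) = (\<integral>x. g x \<partial>measure_pmf r)"
  unfolding d[symmetric] by (subst integrable_distr_eq[OF Y]; simp) (subst integral_distr[OF Y]; simp)

text \<open>Stated through characteristic functions because the remainder will be compared at that
  level; this form also includes the degenerate limit \<open>s2 = 0\<close>.\<close>

lemma iid_clt_char:
  fixes X :: "nat \<Rightarrow> 'a \<Rightarrow> 'x" and v :: "'x \<Rightarrow> real"
  assumes ind: "indep_vars (\<lambda>_. count_space UNIV) X UNIV" and d: "\<And>i. distr M (count_space UNIV) (X i) = measure_pmf r"
    and v: "integrable (measure_pmf r) v" "integrable (measure_pmf r) (\<lambda>x. (v x)\<^sup>2)"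
  defines "s2 \<equiv> (\<integral>x. (v x)\<^sup>2 \<partial>measure_pmf r) - (\<integral>x. v x \<partial>measure_pmf r)\<^sup>2"
  shows "0 \<le> s2"
    and "(\<lambda>n. char (distr M borel (\<lambda>w. (\<Sum>i<n. v (X i w) - (\<integral>x. v x \<partial>measure_pmf r)) / sqrt (real n))) t)
      \<longlonglongrightarrow> complex_of_real (exp (- (s2 * t\<^sup>2) / 2))"
proof -
  have X: "X i \<in> measurable M (count_space UNIV)" for i using ind by (simp add: indep_vars_def2)
  define m where "m = (\<integral>x. v x \<partial>measure_pmf r)"
  define Z where "Z i w = v (X i w) - m" for i w
  have indv: "indep_vars (\<lambda>_. borel) (\<lambda>i w. v (X i w)) UNIV"
    by (rule indep_vars_compose2[OF ind]) simp
  have ci: "integrable (measure_pmf r) (\<lambda>x. (v x - m)\<^sup>2)"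
    using v by (simp add: power2_diff)
  have var: "(\<integral>x. (v x - m)\<^sup>2 \<partial>measure_pmf r) = s2"
  proof -
    have "(\<integral>x. (v x - m)\<^sup>2 \<partial>measure_pmf r) = (\<integral>x. ((v x)\<^sup>2 - (2 * m) * v x) + m\<^sup>2 \<partial>measure_pmf r)"
      by (rule Bochner_Integration.integral_cong) (auto simp: power2_diff)
    also have "\<dots> = (\<integral>x. (v x)\<^sup>2 \<partial>measure_pmf r) - (2 * m) * m + m\<^sup>2"
      using v by (simp add: m_def)
    finally show ?thesis by (simp add: s2_def m_def[symmetric] power2_eq_square)
  qed
  show s20: "0 \<le> s2" unfolding var[symmetric] by (rule Bochner_Integration.integral_nonneg) simp
  have E: "integrable M (\<lambda>w. g (X i w)) \<longleftrightarrow> integrable (measure_pmf r) g"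
    "(\<integral>w. g (X i w) \<partial>M) = (\<integral>x. g x \<partial>measure_pmf r)" for g :: "'x \<Rightarrow> real" and i
    by (rule expectation_distr_pmf[OF X d])+
  have Zm [measurable]: "Z i \<in> borel_measurable M" for i
    unfolding Z_def using measurable_compose[OF X[of i], of "\<lambda>x. v x - m" borel] by simp
  have Sm: "(\<lambda>w. (\<Sum>i<n. Z i w) / c) \<in> borel_measurable M" for n c by measurable
  have ch: "char (distr M borel Y) t = (CLINT w|M. iexp (t * Y w))" if "Y \<in> borel_measurable M" for Y t
    unfolding char_def using that by (subst integral_distr) auto
  have "(\<lambda>n. char (distr M borel (\<lambda>w. (\<Sum>i<n. Z i w) / sqrt (real n))) t) \<longlonglongrightarrow> complex_of_real (exp (- (s2 * t\<^sup>2) / 2))"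
  proof (cases "s2 = 0")
    \<comment> \<open>Zero variance means that \<open>v\<close> equals its mean almost surely, so
      the centred sums vanish almost surely and the limit is the point mass at 0.\<close>
    case True
    have "AE x in measure_pmf r. (v x - m)\<^sup>2 = 0"
      using integral_nonneg_eq_0_iff_AE[OF ci] var True by auto
    then have "AE x in distr M (count_space UNIV) (X i). v x - m = 0" for i unfolding d by simp
    then have "AE w in M. Z i w = 0" for i
      unfolding Z_def by (subst (asm) AE_distr_iff[OF X]) auto
    then have "AE w in M. \<forall>i. Z i w = 0" by (simp add: AE_all_countable)
    then have "AE w in M. iexp (t * ((\<Sum>i<n. Z i w) / sqrt (real n))) = 1" for n by eventually_elim simp
    then have "(CLINT w|M. iexp (t * ((\<Sum>i<n. Z i w) / sqrt (real n)))) = (CLINT w|M. 1)" for n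
      by (intro integral_cong_AE) auto
    then have "char (distr M borel (\<lambda>w. (\<Sum>i<n. Z i w) / sqrt (real n))) t = 1" for n
      unfolding ch[OF Sm] by (simp add: prob_space)
    then show ?thesis using True by simp
  next
    case False
    then have s: "0 < sqrt s2" "(sqrt s2)\<^sup>2 = s2" using s20 by auto
    have "weak_conv_m (\<lambda>n. distr M borel (\<lambda>w. (\<Sum>i<n. v (X i w) - m) / sqrt (real n * (sqrt s2)\<^sup>2))) std_normal_distribution"
    proof (rule central_limit_theorem[OF indv _ s(1)])
      show "expectation (\<lambda>w. v (X n w)) = m" for n using E(2)[of v n] by (simp add: m_def)
      show "integrable M (\<lambda>w. (v (X n w))\<^sup>2)" for n using E(1)[of "\<lambda>x. (v x)\<^sup>2" n] v by simp
      show "variance (\<lambda>w. v (X n w)) = (sqrt s2)\<^sup>2" for n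
        using E(2)[of v n] E(2)[of "\<lambda>x. (v x - m)\<^sup>2" n] var s by (simp add: m_def)
      show "distr M borel (\<lambda>w. v (X n w)) = distr (measure_pmf r) borel v" for n
        unfolding d[of n, symmetric] using distr_distr[of v "count_space UNIV" borel "X n" M] X by (simp add: comp_def)
    qed
    then have w: "weak_conv_m (\<lambda>n. distr M borel (\<lambda>w. (\<Sum>i<n. Z i w) / sqrt (real n * s2))) std_normal_distribution"
      unfolding s(2) Z_def .
    \<comment> \<open>Evaluating at \<open>t * sqrt s2\<close> undoes the division by the standard
      deviation in the normalised sums.\<close>
    have "(\<lambda>n. char (distr M borel (\<lambda>w. (\<Sum>i<n. Z i w) / sqrt (real n * s2))) (t * sqrt s2)) \<longlonglongrightarrow> char std_normal_distribution (t * sqrt s2)"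
      by (rule levy_continuity1[OF _ real_dist_normal_dist w]) (rule real_distribution_distr[OF Sm])
    moreover have "char (distr M borel (\<lambda>w. (\<Sum>i<n. Z i w) / sqrt (real n * s2))) (t * sqrt s2)
        = char (distr M borel (\<lambda>w. (\<Sum>i<n. Z i w) / sqrt (real n))) t" for n
    proof -
      have "(t * sqrt s2) * ((\<Sum>i<n. Z i w) / sqrt (real n * s2)) = t * ((\<Sum>i<n. Z i w) / sqrt (real n))" for w
        using s(1) by (simp add: real_sqrt_mult)
      then show ?thesis unfolding ch[OF Sm] by simp
    qed
    ultimately show ?thesis using s by (simp add: char_std_normal_distribution power_mult_distrib mult.commute)
  qed
  then show "(\<lambda>n. char (distr M borel (\<lambda>w. (\<Sum>i<n. v (X i w) - (\<integral>x. v x \<partial>measure_pmf r)) / sqrt (real n))) t)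
      \<longlonglongrightarrow> complex_of_real (exp (- (s2 * t\<^sup>2) / 2))"
    by (simp add: Z_def m_def)
qed

text \<open>Each coordinate is a centred binomial proportion of variance at most
  \<open>pmf r x / n\<close>, so its mean absolute value is at most
  \<open>sqrt (pmf r x) / sqrt n\<close>. Summation against the weight is where the summability of
  \<open>f x * sqrt (pmf r x)\<close> is decisive.\<close>

lemma empirical_ell1_norm:
  fixes X :: "nat \<Rightarrow> 'a \<Rightarrow> 'x::countable" and f :: "'x \<Rightarrow> real"
  assumes ind: "indep_vars (\<lambda>_. count_space UNIV) X UNIV" and d: "\<And>i. distr M (count_space UNIV) (X i) = measure_pmf r"
    and f: "\<And>x. 0 \<le> f x" and fs: "(\<lambda>x. f x * sqrt (pmf r x)) summable_on UNIV" and n: "0 < n"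
  defines "N \<equiv> \<lambda>w. ell1_norm f (\<lambda>x. pmf (empirical n (\<lambda>i. X i w)) x - pmf r x)"
  shows "integrable M N" "(\<integral>w. N w \<partial>M) \<le> (\<Sum>\<^sub>\<infinity>x. f x * sqrt (pmf r x)) / sqrt (real n)"
proof -
  have X: "X i \<in> measurable M (count_space UNIV)" for i using ind by (simp add: indep_vars_def2)
  have E: "integrable M (\<lambda>w. g (X i w)) \<longleftrightarrow> integrable (measure_pmf r) g"
    "(\<integral>w. g (X i w) \<partial>M) = (\<integral>x. g x \<partial>measure_pmf r)" for g :: "'x \<Rightarrow> real" and i
    by (rule expectation_distr_pmf[OF X d])+
  define D where "D x w = pmf (empirical n (\<lambda>i. X i w)) x - pmf r x" for x w
  have D: "integrable M (D x)" "(\<integral>w. \<bar>D x w\<bar> \<partial>M) \<le> sqrt (pmf r x) / sqrt (real n)" for x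
  proof -
    define Z where "Z i w = indicator {x} (X i w) - pmf r x" for i w
    have ind': "indep_vars (\<lambda>_. borel) Z UNIV"
      unfolding Z_def by (rule indep_vars_compose2[OF ind, where Y="\<lambda>_ z. indicator {x} z - pmf r x"]) simp
    have iI: "integrable (measure_pmf r) (indicator {x} :: 'x \<Rightarrow> real)"
      by (rule pmf_integrable_bound[where g="\<lambda>_. 1"]) auto
    have Ii: "(\<integral>z. indicator {x} z \<partial>measure_pmf r) = pmf r x" by (simp add: measure_pmf_single)
    have i1: "integrable M (Z i)" for i
      using E(1)[of "\<lambda>z. indicator {x} z - pmf r x" i] iI by (simp add: Z_def[abs_def])
    have m1: "(\<integral>w. Z i w \<partial>M) = 0" for i
      using E(2)[of "\<lambda>z. indicator {x} z - pmf r x" i] iI Ii by (simp add: Z_def)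
    have sq: "(indicator {x} z - pmf r x)\<^sup>2 = indicator {x} z * (1 - 2 * pmf r x) + (pmf r x)\<^sup>2" for z
      by (cases "z = x") (auto simp: power2_eq_square algebra_simps)
    have r2: "integrable (measure_pmf r) (\<lambda>z. (indicator {x} z - pmf r x)\<^sup>2)"
      unfolding sq using iI by simp
    have "(\<integral>z. (indicator {x} z - pmf r x)\<^sup>2 \<partial>measure_pmf r) = pmf r x * (1 - 2 * pmf r x) + (pmf r x)\<^sup>2"
      unfolding sq using iI Ii by (subst Bochner_Integration.integral_add) auto
    then have m2': "(\<integral>z. (indicator {x} z - pmf r x)\<^sup>2 \<partial>measure_pmf r) = pmf r x * (1 - pmf r x)"
      by (simp add: power2_eq_square algebra_simps)
    have i2: "integrable M (\<lambda>w. (Z i w)\<^sup>2)" for i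
      using E(1)[of "\<lambda>z. (indicator {x} z - pmf r x)\<^sup>2" i] r2 by (simp only: Z_def)
    have m2: "(\<integral>w. (Z i w)\<^sup>2 \<partial>M) = pmf r x * (1 - pmf r x)" for i
      using E(2)[of "\<lambda>z. (indicator {x} z - pmf r x)\<^sup>2" i] m2' by (simp only: Z_def)
    note S = iid_square_sum[OF ind' i1 i2 m1 m2, of n]
    have DZ: "D x w = (\<Sum>i<n. Z i w) / real n" for w
      unfolding D_def empirical_props(3)[OF n] Z_def using n by (simp add: sum_subtractf diff_divide_distrib)
    show "integrable M (D x)" unfolding DZ[abs_def] using i1 by simp
    have b: "(\<integral>w. (\<Sum>i<n. Z i w)\<^sup>2 \<partial>M) \<le> (sqrt (real n * pmf r x))\<^sup>2"
      unfolding S(2) by (simp add: mult_left_le mult_left_mono)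
    have one: "integrable M (\<lambda>w. 1\<^sup>2 :: real)" "(\<integral>w. 1\<^sup>2 \<partial>M) \<le> (1::real)\<^sup>2" by (auto simp: prob_space)
    have "(\<lambda>w. \<Sum>i<n. Z i w) \<in> borel_measurable M" using i1 by simp
    from expectation_abs_mult_le(2)[OF this _ S(1) b _ one]
    have "(\<integral>w. \<bar>\<Sum>i<n. Z i w\<bar> \<partial>M) \<le> sqrt (real n * pmf r x)" by simp
    then have "(\<integral>w. \<bar>\<Sum>i<n. Z i w\<bar> \<partial>M) / real n \<le> sqrt (real n * pmf r x) / real n"
      by (rule divide_right_mono) simp
    also have "sqrt (real n * pmf r x) / real n = sqrt (pmf r x) / sqrt (real n)"
      using n by (simp add: real_sqrt_mult field_simps)
    finally show "(\<integral>w. \<bar>D x w\<bar> \<partial>M) \<le> sqrt (pmf r x) / sqrt (real n)" by (simp add: DZ abs_divide)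
  qed
  have N: "N = (\<lambda>w. \<Sum>\<^sub>\<infinity>x. f x * \<bar>D x w\<bar>)" by (simp add: N_def ell1_norm_def D_def)
  have le: "(\<integral>w. f x * \<bar>D x w\<bar> \<partial>M) \<le> (1 / sqrt (real n)) * (f x * sqrt (pmf r x))" for x
    using mult_left_mono[OF D(2)[of x] f[of x]] by simp
  have i: "integrable M (\<lambda>w. f x * \<bar>D x w\<bar>)" for x using D(1)[of x] by simp
  have gs: "(\<lambda>x. (1 / sqrt (real n)) * (f x * sqrt (pmf r x))) summable_on UNIV" by (intro summable_on_cmult_right fs)
  have nn: "\<bar>f x * \<bar>D x w\<bar>\<bar> = f x * \<bar>D x w\<bar>" for x w using f[of x] by simp
  have s0: "(\<lambda>x. \<integral>w. f x * \<bar>D x w\<bar> \<partial>M) summable_on UNIV"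
    by (rule summable_on_real_bound[OF gs])
       (use le f in \<open>auto simp: abs_of_nonneg Bochner_Integration.integral_nonneg\<close>)
  then have s: "(\<lambda>x. \<integral>w. \<bar>f x * \<bar>D x w\<bar>\<bar> \<partial>M) summable_on UNIV" by (simp only: nn)
  note EI = expectation_infsum[OF sigma_finite_measure_axioms i s]
  show "integrable M N" unfolding N by (rule EI(1))
  have "(\<integral>w. N w \<partial>M) = (\<Sum>\<^sub>\<infinity>x. \<integral>w. f x * \<bar>D x w\<bar> \<partial>M)" unfolding N by (rule EI(2))
  also have "\<dots> \<le> (\<Sum>\<^sub>\<infinity>x. (1 / sqrt (real n)) * (f x * sqrt (pmf r x)))"
    by (rule infsum_mono[OF s0 gs le])
  also have "\<dots> = (\<Sum>\<^sub>\<infinity>x. f x * sqrt (pmf r x)) / sqrt (real n)" by (simp only: infsum_cmult_right') simp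
  finally show "(\<integral>w. N w \<partial>M) \<le> (\<Sum>\<^sub>\<infinity>x. f x * sqrt (pmf r x)) / sqrt (real n)" .
qed

text \<open>Delta method with a quadratic remainder: at the rate \<open>1 / sqrt n\<close> of the empirical process the
  remainder is negligible, and the linear part is a sum of i.i.d. variables.\<close>

theorem empirical_functional_clt:
  fixes X :: "nat \<Rightarrow> 'a \<Rightarrow> 'x::countable" and f v :: "'x \<Rightarrow> real" and Phi :: "'x pmf \<Rightarrow> real"
  assumes ind: "indep_vars (\<lambda>_. count_space UNIV) X UNIV" and d: "\<And>i. distr M (count_space UNIV) (X i) = measure_pmf r"
    and f: "\<And>x. 0 \<le> f x" and fs: "(\<lambda>x. f x * sqrt (pmf r x)) summable_on UNIV"
    and v: "integrable (measure_pmf r) v" "integrable (measure_pmf r) (\<lambda>x. (v x)\<^sup>2)" and C: "0 \<le> C"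
    and exp: "\<And>r'. finite (set_pmf r') \<Longrightarrow> set_pmf r' \<subseteq> set_pmf r \<Longrightarrow>
      \<bar>Phi r' - Phi r - ((\<integral>x. v x \<partial>measure_pmf r') - (\<integral>x. v x \<partial>measure_pmf r))\<bar> \<le> C * (ell1_norm f (\<lambda>x. pmf r' x - pmf r x))\<^sup>2"
  shows "weak_conv_m (\<lambda>n. distr M borel (\<lambda>w. sqrt (real n) * (Phi (empirical n (\<lambda>i. X i w)) - Phi r)))
    (normal_law 0 ((\<integral>x. (v x)\<^sup>2 \<partial>measure_pmf r) - (\<integral>x. v x \<partial>measure_pmf r)\<^sup>2))"
proof -
  have X: "X i \<in> measurable M (count_space UNIV)" for i using ind by (simp add: indep_vars_def2)
  define s2 where "s2 = (\<integral>x. (v x)\<^sup>2 \<partial>measure_pmf r) - (\<integral>x. v x \<partial>measure_pmf r)\<^sup>2"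
  note clt = iid_clt_char[OF ind d v, folded s2_def]
  define m where "m = (\<integral>x. v x \<partial>measure_pmf r)"
  define Y where "Y n w = sqrt (real n) * (Phi (empirical n (\<lambda>i. X i w)) - Phi r)" for n w
  define T where "T n w = (\<Sum>i<n. v (X i w) - m) / sqrt (real n)" for n w
  define N where "N n w = ell1_norm f (\<lambda>x. pmf (empirical n (\<lambda>i. X i w)) x - pmf r x)" for n w
  define A where "A = (\<Sum>\<^sub>\<infinity>x. f x * sqrt (pmf r x))"
  have Ym: "Y n \<in> borel_measurable M" for n
  \<comment> \<open>For \<open>n = 0\<close> the empirical measure has no meaning, but the factor
    \<open>sqrt 0\<close> makes the variable 0.\<close>
  proof (cases "n = 0")
    case False
    then have e: "Y n = (\<lambda>w. sqrt (real n) * (Phi (empirical n ((!) (map (\<lambda>i. X i w) [0..<n]))) - Phi r))"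
      unfolding Y_def using empirical_props(4)[of n "\<lambda>i. X i w" for w] by auto
    show ?thesis unfolding e
      by (rule measurable_of_samples[OF X, of "\<lambda>l. sqrt (real n) * (Phi (empirical n ((!) l)) - Phi r)"])
  qed (simp add: Y_def[abs_def])
  have Tm: "T n \<in> borel_measurable M" for n
  proof -
    have "(\<lambda>w. v (X i w) - m) \<in> borel_measurable M" for i
      using measurable_compose[OF X[of i], of "\<lambda>x. v x - m" borel] by simp
    then show ?thesis unfolding T_def[abs_def] by measurable
  qed
  have ch: "char (distr M borel Z) t = (CLINT w|M. iexp (t * Z w))" if "Z \<in> borel_measurable M" for Z t
    unfolding char_def using that by (subst integral_distr) auto
  \<comment> \<open>Almost surely all samples lie in the support of \<open>r\<close>, so the
    empirical measure satisfies the support condition of the expansion.\<close>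
  have AEs: "AE w in M. \<forall>i. X i w \<in> set_pmf r"
    unfolding AE_all_countable
  proof
    fix i
    have "AE x in distr M (count_space UNIV) (X i). x \<in> set_pmf r" unfolding d by (simp add: AE_measure_pmf)
    then show "AE w in M. X i w \<in> set_pmf r" by (subst (asm) AE_distr_iff[OF X]) auto
  qed
  have N0: "0 \<le> N n w" for n w unfolding N_def ell1_norm_def using f by (intro infsum_nonneg) auto
  have rem: "AE w in M. \<bar>Y n w - T n w\<bar> \<le> sqrt (real n) * (C * (N n w)\<^sup>2)" if n: "0 < n" for n
    using AEs
  proof eventually_elim
    case (elim w)
    let ?r = "empirical n (\<lambda>i. X i w)"
    have "\<bar>Phi ?r - Phi r - ((\<integral>x. v x \<partial>measure_pmf ?r) - m)\<bar> \<le> C * (N n w)\<^sup>2"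
      unfolding m_def N_def by (rule exp) (use elim in \<open>auto simp: empirical_props(1)[OF n]\<close>)
    moreover have "Y n w - T n w = sqrt (real n) * (Phi ?r - Phi r - ((\<integral>x. v x \<partial>measure_pmf ?r) - m))"
    proof -
      have "(\<Sum>i<n. v (X i w) - m) = (\<Sum>i<n. v (X i w)) - real n * m" by (simp add: sum_subtractf)
      moreover have "(S - real n * m) / sqrt (real n) = sqrt (real n) * (S / real n - m)" for S
      proof -
        have "(S - q * q * m) / q = q * (S / (q * q) - m)" if "0 < q" for q :: real
          using that by (simp add: field_simps)
        from this[of "sqrt (real n)"] show ?thesis using n by simp
      qed
      ultimately show ?thesis
        unfolding Y_def T_def empirical_props(2)[OF n] by (simp only: right_diff_distrib)
    qed
    ultimately show ?case by (simp add: abs_mult mult_left_mono)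
  qed
  have cd: "cmod (char (distr M borel (Y n)) t - char (distr M borel (T n)) t)
      \<le> (sqrt (2 * \<bar>t\<bar> * C) * A) * (1 / sqrt (sqrt (real n)))" if n: "0 < n" for n t
  proof -
    \<comment> \<open>The factor that remains of
      \<open>sqrt (2 * \<bar>t\<bar> * sqrt n * C * N\<^sup>2)\<close> once \<open>N\<close> is
      taken out. As \<open>K\<close> grows like the fourth root of \<open>n\<close> and the mean of
      \<open>N\<close> decays like \<open>1 / sqrt n\<close>, the bound is of order \<open>n\<close>
      to the power \<open>-1/4\<close>.\<close>
    define K where "K = sqrt (2 * \<bar>t\<bar> * C) * sqrt (sqrt (real n))"
    have K0: "0 \<le> K" using C by (simp add: K_def)
    have iY: "integrable M (\<lambda>w. iexp (t * Z w))" if "Z \<in> borel_measurable M" for Z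
      using integrable_iexp[of "\<lambda>w. complex_of_real (t * Z w)"] that by simp
    note EN = empirical_ell1_norm[OF ind d f fs n, folded N_def A_def]
    have "cmod (char (distr M borel (Y n)) t - char (distr M borel (T n)) t)
        = cmod (CLINT w|M. iexp (t * Y n w) - iexp (t * T n w))"
      unfolding ch[OF Ym] ch[OF Tm] by (simp add: Bochner_Integration.integral_diff iY[OF Ym] iY[OF Tm] del: of_real_mult)
    also have "\<dots> \<le> (\<integral>w. cmod (iexp (t * Y n w) - iexp (t * T n w)) \<partial>M)" by (rule integral_norm_bound)
    also have "\<dots> \<le> (\<integral>w. K * N n w \<partial>M)"
    proof (rule integral_mono_AE)
      show "integrable M (\<lambda>w. cmod (iexp (t * Y n w) - iexp (t * T n w)))"
        by (intro integrable_norm Bochner_Integration.integrable_diff iY Ym Tm)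
      show "integrable M (\<lambda>w. K * N n w)" using EN(1) by simp
      show "AE w in M. cmod (iexp (t * Y n w) - iexp (t * T n w)) \<le> K * N n w"
        using rem[OF n]
      proof eventually_elim
        case (elim w)
        have "\<bar>t * Y n w - t * T n w\<bar> \<le> \<bar>t\<bar> * (sqrt (real n) * (C * (N n w)\<^sup>2))"
          unfolding right_diff_distrib[symmetric] abs_mult by (rule mult_left_mono[OF elim]) simp
        then have "cmod (iexp (t * Y n w) - iexp (t * T n w)) \<le> min 2 (\<bar>t\<bar> * (sqrt (real n) * (C * (N n w)\<^sup>2)))"
          using cmod_iexp_diff_le[of "t * Y n w" "t * T n w"] by linarith
        also have "\<dots> \<le> sqrt (2 * (\<bar>t\<bar> * (sqrt (real n) * (C * (N n w)\<^sup>2))))"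
          by (rule min_2_le_sqrt) (use C in simp)
        also have "2 * (\<bar>t\<bar> * (sqrt (real n) * (C * (N n w)\<^sup>2))) = (2 * \<bar>t\<bar> * C) * sqrt (real n) * (N n w)\<^sup>2" by simp
        also have "sqrt ((2 * \<bar>t\<bar> * C) * sqrt (real n) * (N n w)\<^sup>2) = K * N n w"
          unfolding K_def real_sqrt_mult real_sqrt_abs using N0[of n w] by simp
        finally show ?case .
      qed
    qed
    also have "\<dots> = K * (\<integral>w. N n w \<partial>M)" by simp
    also have "\<dots> \<le> K * (A / sqrt (real n))" by (rule mult_left_mono[OF EN(2) K0])
    also have "\<dots> = (sqrt (2 * \<bar>t\<bar> * C) * A) * (1 / sqrt (sqrt (real n)))"
    proof -
      have ss: "sqrt (sqrt (real n)) / sqrt (real n) = 1 / sqrt (sqrt (real n))"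
        using n real_sqrt_mult_self[of "sqrt (real n)"] by (simp add: field_simps)
      have g: "a * b * (A / b') = (a * A) * (b / b')" for a b b' by simp
      show ?thesis unfolding K_def g ss ..
    qed
    finally show ?thesis .
  qed
  have "weak_conv_m (\<lambda>n. distr M borel (Y n)) (normal_law 0 s2)"
  proof (rule levy_continuity)
    show "real_distribution (distr M borel (Y n))" for n by (rule real_distribution_distr[OF Ym])
    show "real_distribution (normal_law 0 s2)" by (rule normal_law_moments(1)[OF clt(1)])
    fix t
    have "(\<lambda>n. (sqrt (2 * \<bar>t\<bar> * C) * A) * (1 / sqrt (sqrt (real n)))) \<longlonglongrightarrow> (sqrt (2 * \<bar>t\<bar> * C) * A) * 0"
      by (intro tendsto_mult tendsto_const real_tendsto_divide_at_top[OF tendsto_const]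
          filterlim_compose[OF sqrt_at_top] filterlim_real_sequentially)
    then have z: "(\<lambda>n. (sqrt (2 * \<bar>t\<bar> * C) * A) * (1 / sqrt (sqrt (real n)))) \<longlonglongrightarrow> 0" by simp
    have "(\<lambda>n. char (distr M borel (Y n)) t - char (distr M borel (T n)) t) \<longlonglongrightarrow> 0"
    proof (rule Lim_null_comparison[OF _ z])
      show "\<forall>\<^sub>F n in sequentially. cmod (char (distr M borel (Y n)) t - char (distr M borel (T n)) t)
          \<le> (sqrt (2 * \<bar>t\<bar> * C) * A) * (1 / sqrt (sqrt (real n)))"
        by (rule eventually_sequentiallyI[of 1]) (rule cd, simp)
    qed
    from tendsto_add[OF this clt(2)[of t, folded m_def, folded T_def]]
    show "(\<lambda>n. char (distr M borel (Y n)) t) \<longlonglongrightarrow> char (normal_law 0 s2) t"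
      unfolding normal_law_moments(6)[OF clt(1)] by simp
  qed
  then show ?thesis by (simp add: Y_def[abs_def] s2_def)
qed

end

theorem corollary3p8:
  fixes c :: "'x::countable \<times> 'y::countable \<Rightarrow> real"
    and cXm cXp :: "'x \<Rightarrow> real" and cYm cYp :: "'y \<Rightarrow> real"
    and lam :: real
    and r :: "'x pmf" and s :: "'y pmf" and y1 :: 'y
    and M :: "'w measure" and X :: "nat \<Rightarrow> 'w \<Rightarrow> 'x"
  assumes "lam > 0"
    and "dominating c cXm cXp cYm cYp"
    and "bounded (range (\<lambda>x. cXp x - cXm x))"
    and "(\<lambda>x. cost_weight cXm cXp x * sqrt (pmf r x)) summable_on UNIV"
    and "(\<lambda>y. cost_weight cYm cYp y * exp_weight lam cYm cYp y ^ 4 * pmf s y) summable_on UNIV"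
    and "y1 \<in> set_pmf s"
    and "prob_space M"
    and "prob_space.indep_vars M (\<lambda>_. count_space UNIV) X UNIV"
    and "\<And>i. distr M (count_space UNIV) (X i) = measure_pmf r"
  shows "weak_conv_m
    (\<lambda>n. distr M borel (\<lambda>w. sqrt (real n) *
        (sinkhorn_cost c lam (empirical n (\<lambda>i. X i w)) s - sinkhorn_cost c lam r s)))
    (normal_law 0
      (sinkhorn_var c (cost_weight cXm cXp) (exp_weight lam cYm cYp) (erot_plan c lam r s) r s y1))"
proof -
  obtain Kx where Kx: "\<And>x. \<bar>cXp x - cXm x\<bar> \<le> Kx" using assms(3) by (auto simp: bounded_iff)
  interpret M: prob_space M by fact
  interpret erot_problem c cXm cXp cYm cYp lam s y1 Kx
    by unfold_locales (use assms Kx in \<open>auto intro: order_trans[OF abs_ge_self]\<close>)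
  have "integrable (measure_pmf r) wX"
    unfolding integrable_measure_pmf_iff_summable_on
  proof (rule summable_on_real_bound[OF assms(4)])
    fix x
    have "pmf r x \<le> sqrt (pmf r x)"
      using pmf_le_1[of r x] by (intro real_le_rsqrt) (simp add: power2_eq_square mult_left_le)
    then show "\<bar>pmf r x * wX x\<bar> \<le> wX x * sqrt (pmf r x)"
      using wX_ge1[of x] by (simp add: abs_mult mult.commute)
  qed
  moreover obtain u w where "is_scaling r u w" using scaling_exists by blast
  ultimately interpret erot_scaled c cXm cXp cYm cYp lam s y1 Kx r u w by unfold_locales
  have "\<exists>P. tight_centered_gaussian wX P \<and> (\<forall>x x'. covar P (\<lambda>g. g x) (\<lambda>g. g x') = multinomial_cov r x x')"
    by (rule multinomial_gaussian_exists[OF wX_ge1 assms(4)])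
  \<comment> \<open>\<open>law_G\<close> is an arbitrary choice; existence of a law with the
    required properties is what entitles it to them.\<close>
  then have "tight_centered_gaussian wX (law_G wX r) \<and> (\<forall>x x'. covar (law_G wX r) (\<lambda>g. g x) (\<lambda>g. g x') = multinomial_cov r x x')"
    unfolding law_G_def by (rule someI_ex)
  then have var: "sinkhorn_var c wX phi (erot_plan c lam r s) r s y1
      = (\<integral>x. (vX x)\<^sup>2 \<partial>measure_pmf r) - (\<integral>x. vX x \<partial>measure_pmf r)\<^sup>2"
    unfolding plan_eq by (intro sinkhorn_var_eq[OF assms(4)]) auto
  show ?thesis
    unfolding var
  proof (rule M.empirical_functional_clt[OF assms(8,9) wX_nonneg assms(4) vX_integrable[OF assms(4)]])
    show "0 \<le> CE" using C_nonneg RX_nonneg QY_nonneg by (simp add: CE_def)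
    \<comment> \<open>Empirical measures have finite support, so \<open>wX\<close> and
      \<open>vX\<close> are integrable for \<open>r'\<close>, and the linear term is a difference of
      two means of \<open>vX\<close>.\<close>
    fix r' :: "'x pmf" assume r': "finite (set_pmf r')" "set_pmf r' \<subseteq> set_pmf r"
    have i: "(\<lambda>x. pmf r' x * vX x) summable_on UNIV" "(\<lambda>x. pmf r x * vX x) summable_on UNIV"
      using integrable_measure_pmf_finite[OF r'(1), of vX] vX_integrable(1)[OF assms(4)]
      by (simp_all add: integrable_measure_pmf_iff_summable_on)
    have "(\<Sum>\<^sub>\<infinity>x. (pmf r' x - pmf r x) * vX x) = (\<integral>x. vX x \<partial>measure_pmf r') - (\<integral>x. vX x \<partial>measure_pmf r)"
      unfolding integral_measure_pmf_infsum infsum_real_diff[OF i, symmetric] by (simp add: left_diff_distrib)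
    then show "\<bar>sinkhorn_cost c lam r' s - sinkhorn_cost c lam r s
        - ((\<integral>x. vX x \<partial>measure_pmf r') - (\<integral>x. vX x \<partial>measure_pmf r))\<bar> \<le> CE * (nX (\<lambda>x. pmf r' x - pmf r x))\<^sup>2"
      using sinkhorn_expansion[OF integrable_measure_pmf_finite[OF r'(1)] r'(2)] by simp
  qed
qed

end
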